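(* Let $f:M\to S^n$ be an isometric immersion of an oriented $m$-manifold with unit normal bundle $\pi^\perp:UM^\perp\to M$ and spherical Gauss map $\mu:UM^\perp\to US^n$. Let $T(UM^\perp)=\mathcal H_M\oplus\mathcal V_M$ be the decomposition into $\pi^\perp$-horizontal and $\pi^\perp$-vertical subbundles. About $\xi\in UM^\perp$ choose local orthonormal frames $\{E_i: 1\le i\le m\}$ of $\mathcal H_M$ and $\{E_\beta: m+1\le\beta\le n-1\}$ of $\mathcal V_M$, and set $\bar E_i=d\pi(E_i)$ and $\bar E_\beta=d\pi(JE_\beta)$ (tangent vectors to $UM^\perp$ being identified with their images under $d\mu$). Then at $\xi$, with $p=\pi(\xi)$, for all $1\le i\le m$ and $m+1\le\beta\le n-1$, $$h_\xi(H_\mu,JE_i)=-g_p\Big(\sum_{j=1}^m[\nabla\mathrm{II}_f](\bar E_i,\bar E_j,\bar E_j),\xi\Big),$$ $$h_\xi(H_\mu,JE_\beta)=g_p\Big(\sum_{j=1}^m\mathrm{II}_f(\bar E_j,\bar E_j),\bar E_\beta\Big).$$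
   Context: Homogeneous model. $G=SO(n+1)$, $\mathfrak g=\mathfrak{so}(n+1)$, $\langle\eta,\zeta\rangle=-\tfrac12\operatorname{tr}(\eta\zeta)$, $o=(0,\dots,0,1)\in S^n\subset\mathbb{R}^{n+1}$, $K\cong SO(n)$ the stabilizer of $o$ with Lie algebra $\mathfrak k$, $\mathfrak m=\mathfrak k^\perp$; thus $S^n=G/K$ with the round metric $g$ of curvature $1$, and $T_{aK}S^n\cong \operatorname{Ad}a\cdot\mathfrak m$, where $\xi\in\operatorname{Ad}a\cdot\mathfrak m$ corresponds to $\frac{d}{dt}(e^{t\xi}\cdot p)|_{t=0}$, $p=aK$. Let $\nu_0\in\mathfrak m$ be the matrix with $(n,n+1)$ entry $1$, $(n+1,n)$ entry $-1$ and all others $0$, regarded as a unit tangent vector at $o$. $G$ acts transitively on the unit tangent bundle $US^n$; the isotropy group of $\nu_0$ is $H=\{a\in K:\operatorname{Ad}a\cdot\nu_0=\nu_0\}\cong SO(n-1)$, with Lie algebra $\mathfrak h$, so $US^n=G/H$. With $\mathfrak p=\mathfrak h^\perp$, there is the isomorphism $\beta_H:T_{aH}US^n\to\operatorname{Ad}a\cdot\mathfrak p$ defined in the same way ($\beta_H(X)=\xi$ when $X=\frac{d}{dt}(e^{t\xi}\cdot aH)|_{t=0}$, $\xi\in \operatorname{Ad}a\cdot\mathfrak p$). $US^n$ carries the metric $h(X,Y)=\langle\beta_H(X),\beta_H(Y)\rangle$ (which is the restriction of the Sasaki metric). $\pi:US^n\to S^n$ is the projection. $J\in\operatorname{End}(TUS^n)$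 is defined at $aH$ by $\beta_H(JX)=[\operatorname{Ad}a\cdot\nu_0,\beta_H(X)]$. $M$ has the induced metric. The spherical Gauss map $\mu$ sends a unit normal vector to itself as a unit tangent vector of $S^n$; it is an immersion, and $UM^\perp$ has the metric $\mu^*h$. $\mathcal V_M=\ker d\pi^\perp$ and $\mathcal H_M$ is its orthogonal complement for $\mu^*h$. $\mathrm{II}_f(X,Y)=(\nabla_XY)^\perp$ is the second fundamental form; $[\nabla\mathrm{II}_f](X,Y,W)=\nabla^\perp_X(\mathrm{II}_f(Y,W))-\mathrm{II}_f(\nabla^f_XY,W)-\mathrm{II}_f(Y,\nabla^f_XW)$, with $\nabla^f$ the Levi-Civita connexion of $M$ and $\nabla^\perp$ the normal connexion (it is totally symmetric, by the Codazzi equation). $H_\mu$ is the mean curvature vector of $\mu:(UM^\perp,\mu^*h)\to(US^n,h)$, the (unnormalized) trace of its second fundamental form. *)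

theory Defs
  imports "HOL-Analysis.Analysis"
begin

section \<open>Smooth maps, tangent spaces, manifolds\<close>

text \<open>The predicates \<open>ck_on\<close> and \<open>smooth_on\<close> are only meant for open sets \<open>S\<close>.\<close>

primrec ck_on :: "nat \<Rightarrow> 'd::euclidean_space set \<Rightarrow> ('d \<Rightarrow> 'k::real_normed_vector) \<Rightarrow> bool" where
  "ck_on 0 S F \<longleftrightarrow> continuous_on S F"
| "ck_on (Suc k) S F \<longleftrightarrow>
     (\<forall>x\<in>S. F differentiable (at x)) \<and> (\<forall>v. ck_on k S (\<lambda>x. frechet_derivative F (at x) v))"

definition smooth_on :: "'d::euclidean_space set \<Rightarrow> ('d \<Rightarrow> 'k::real_normed_vector) \<Rightarrow> bool" where
  "smooth_on S F \<longleftrightarrow> (\<forall>k. ck_on k S F)"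

text \<open>Tangent space of an embedded submanifold \<open>N\<close> of a Euclidean space: velocities of curves in
  \<open>N\<close>.  For such \<open>N\<close> it is immaterial that only differentiability at \<open>0\<close> is asked of the curve.\<close>

definition tangent_space :: "'k::euclidean_space set \<Rightarrow> 'k \<Rightarrow> 'k set" where
  "tangent_space N q = {v. \<exists>c. c 0 = q \<and> (\<forall>\<^sub>F t in nhds (0::real). c t \<in> N) \<and>
     (c has_vector_derivative v) (at 0)}"

text \<open>Abstract manifolds are given by local parametrizations, i.e. inverses of charts.\<close>

definition local_param ::
  "'a::topological_space set \<Rightarrow> 'd::euclidean_space set \<Rightarrow> ('d \<Rightarrow> 'a) \<Rightarrow> bool" where
  "local_param S U x \<longleftrightarrow> open U \<and> openin (top_of_set S) (x ` U) \<and> (\<exists>y. homeomorphism U (x ` U) x y)"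

type_synonym ('a, 'm) atlas = "((real ^ 'm) set \<times> (real ^ 'm \<Rightarrow> 'a)) set"

definition smooth_atlas :: "'a::topological_space set \<Rightarrow> ('a, 'm::finite) atlas \<Rightarrow> bool" where
  "smooth_atlas M A \<longleftrightarrow>
     (\<forall>(U, x)\<in>A. local_param M U x) \<and> (\<Union>(U, x)\<in>A. x ` U) = M \<and>
     (\<forall>(U, x)\<in>A. \<forall>(V, y)\<in>A. smooth_on {u \<in> U. x u \<in> y ` V} (\<lambda>u. inv_into V y (x u)))"

definition oriented_atlas :: "('a, 'm::finite) atlas \<Rightarrow> bool" where
  "oriented_atlas A \<longleftrightarrow>
     (\<forall>(U, x)\<in>A. \<forall>(V, y)\<in>A. \<forall>u\<in>U. x u \<in> y ` V \<longrightarrow>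
        det (matrix (frechet_derivative (\<lambda>u. inv_into V y (x u)) (at u))) > 0)"

definition smooth_immersion :: "('a, 'm::finite) atlas \<Rightarrow> ('a \<Rightarrow> 'k::euclidean_space) \<Rightarrow> bool" where
  "smooth_immersion A f \<longleftrightarrow>
     (\<forall>(U, x)\<in>A. smooth_on U (f \<circ> x) \<and> (\<forall>u\<in>U. inj (frechet_derivative (f \<circ> x) (at u))))"

section \<open>Levi-Civita connection and second fundamental form\<close>

text \<open>A Riemannian manifold is a submanifold \<open>N\<close> of a Euclidean space with a metric \<open>G\<close> for which only
  the values \<open>G q v w\<close> with \<open>q \<in> N\<close> and \<open>v, w\<close> tangent at \<open>q\<close> matter.  An open \<open>U\<close> with an arbitrary
  metric is a special case; so charts of an abstract Riemannian manifold are covered.\<close>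

definition vfields :: "'k::euclidean_space set \<Rightarrow> ('k \<Rightarrow> 'k) set" where
  "vfields N = {X. (\<exists>D. open D \<and> N \<subseteq> D \<and> smooth_on D X) \<and> (\<forall>q\<in>N. X q \<in> tangent_space N q)}"

text \<open>Derivative along \<open>N\<close> in the direction \<open>v\<close>. The derivative of \<open>\<phi>\<close> within \<open>N\<close> is not
  unique as a linear map on the ambient space, but its value on tangent vectors \<open>v\<close> is.\<close>

definition deriv_along ::
  "'k::euclidean_space set \<Rightarrow> ('k \<Rightarrow> 'c::real_normed_vector) \<Rightarrow> 'k \<Rightarrow> 'k \<Rightarrow> 'c" where
  "deriv_along N \<phi> q v = frechet_derivative \<phi> (at q within N) v"

definition lie_bracket ::
  "'k::euclidean_space set \<Rightarrow> ('k \<Rightarrow> 'k) \<Rightarrow> ('k \<Rightarrow> 'k) \<Rightarrow> 'k \<Rightarrow> 'k" where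
  "lie_bracket N X Y q = deriv_along N Y q (X q) - deriv_along N X q (Y q)"

type_synonym 'k metric = "'k \<Rightarrow> 'k \<Rightarrow> 'k \<Rightarrow> real"

definition koszul ::
  "'k::euclidean_space set \<Rightarrow> 'k metric \<Rightarrow> ('k \<Rightarrow> 'k) \<Rightarrow> ('k \<Rightarrow> 'k) \<Rightarrow> ('k \<Rightarrow> 'k) \<Rightarrow> 'k \<Rightarrow> real" where
  "koszul N G X Y Z q =
     deriv_along N (\<lambda>p. G p (Y p) (Z p)) q (X q)
   + deriv_along N (\<lambda>p. G p (X p) (Z p)) q (Y q)
   - deriv_along N (\<lambda>p. G p (X p) (Y p)) q (Z q)
   + G q (lie_bracket N X Y q) (Z q)
   - G q (lie_bracket N X Z q) (Y q)
   - G q (lie_bracket N Y Z q) (X q)"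

text \<open>\<open>levi_civita N G v Y q\<close> is the Levi-Civita derivative at \<open>q\<close> of the field \<open>Y\<close> in the direction of
  the tangent vector \<open>v\<close>, by the Koszul formula.\<close>

definition levi_civita ::
  "'k::euclidean_space set \<Rightarrow> 'k metric \<Rightarrow> 'k \<Rightarrow> ('k \<Rightarrow> 'k) \<Rightarrow> 'k \<Rightarrow> 'k" where
  "levi_civita N G v Y q = (THE z. z \<in> tangent_space N q \<and>
     (\<forall>X\<in>vfields N. X q = v \<longrightarrow> (\<forall>Z\<in>vfields N. 2 * G q z (Z q) = koszul N G X Y Z q)))"

text \<open>Pull-back connection: \<open>cov_along N G W F V w a\<close> is the covariant derivative at \<open>w\<close>, in the
  direction \<open>a\<close>, of a field \<open>V\<close> along the map \<open>F\<close> from the open set \<open>W\<close> to \<open>N\<close>.  It is determined by the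
  Leibniz rule from its values on the fields \<open>Y \<circ> F\<close>.\<close>

definition cov_along ::
  "'k::euclidean_space set \<Rightarrow> 'k metric \<Rightarrow> 'd::euclidean_space set \<Rightarrow> ('d \<Rightarrow> 'k) \<Rightarrow> ('d \<Rightarrow> 'k)
     \<Rightarrow> 'd \<Rightarrow> 'd \<Rightarrow> 'k" where
  "cov_along N G W F V w a = (THE z. \<exists>(r::nat) c Y.
     (\<forall>i<r. Y i \<in> vfields N \<and> c i differentiable (at w)) \<and>
     (\<forall>w'\<in>W. V w' = (\<Sum>i<r. c i w' *\<^sub>R Y i (F w'))) \<and>
     z = (\<Sum>i<r. frechet_derivative (c i) (at w) a *\<^sub>R Y i (F w)
              + c i w *\<^sub>R levi_civita N G (frechet_derivative F (at w) a) (Y i) (F w)))"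

definition normal_part :: "('k::euclidean_space \<Rightarrow> 'k \<Rightarrow> real) \<Rightarrow> 'k set \<Rightarrow> 'k \<Rightarrow> 'k" where
  "normal_part g T z = (THE y. z - y \<in> T \<and> (\<forall>t\<in>T. g y t = 0))"

text \<open>In the next definitions \<open>F\<close> is an immersion from the open set \<open>W\<close> into \<open>N\<close>, and
  arguments \<open>a\<close>, \<open>b\<close> are coordinate vectors, standing for the tangent vectors \<open>dF a\<close>, \<open>dF b\<close>.
  The vector \<open>b\<close> is extended to a constant field; \<open>second_ff\<close> does not depend on the extension.\<close>

definition second_ff ::
  "'k::euclidean_space set \<Rightarrow> 'k metric \<Rightarrow> 'd::euclidean_space set \<Rightarrow> ('d \<Rightarrow> 'k) \<Rightarrow> 'd \<Rightarrow> 'd \<Rightarrow> 'd \<Rightarrow> 'k" where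
  "second_ff N G W F w a b =
     normal_part (G (F w)) (range (frechet_derivative F (at w)))
       (cov_along N G W F (\<lambda>w'. frechet_derivative F (at w') b) w a)"

definition mean_curvature ::
  "'k::euclidean_space set \<Rightarrow> 'k metric \<Rightarrow> 'd::euclidean_space set \<Rightarrow> ('d \<Rightarrow> 'k) \<Rightarrow> 'd \<Rightarrow> 'k" where
  "mean_curvature N G W F w = (THE H. \<forall>e :: nat \<Rightarrow> 'd.
     (\<forall>i\<in>{1..DIM('d)}. \<forall>j\<in>{1..DIM('d)}.
        G (F w) (frechet_derivative F (at w) (e i)) (frechet_derivative F (at w) (e j))
          = (if i = j then 1 else 0))
     \<longrightarrow> H = (\<Sum>i=1..DIM('d). second_ff N G W F w (e i) (e i)))"

definition normal_connection ::
  "'k::euclidean_space set \<Rightarrow> 'k metric \<Rightarrow> 'd::euclidean_space set \<Rightarrow> ('d \<Rightarrow> 'k) \<Rightarrow> ('d \<Rightarrow> 'k)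
     \<Rightarrow> 'd \<Rightarrow> 'd \<Rightarrow> 'k" where
  "normal_connection N G W F \<eta> w a =
     normal_part (G (F w)) (range (frechet_derivative F (at w))) (cov_along N G W F \<eta> w a)"

definition induced_metric :: "'k metric \<Rightarrow> ('d::euclidean_space \<Rightarrow> 'k::euclidean_space) \<Rightarrow> 'd metric" where
  "induced_metric G F w a b =
     G (F w) (frechet_derivative F (at w) a) (frechet_derivative F (at w) b)"

text \<open>Here \<open>X\<close>, \<open>Y\<close>, \<open>Z\<close> are vector fields on \<open>W\<close>.\<close>

definition nabla_II ::
  "'k::euclidean_space set \<Rightarrow> 'k metric \<Rightarrow> 'd::euclidean_space set \<Rightarrow> ('d \<Rightarrow> 'k)
     \<Rightarrow> ('d \<Rightarrow> 'd) \<Rightarrow> ('d \<Rightarrow> 'd) \<Rightarrow> ('d \<Rightarrow> 'd) \<Rightarrow> 'd \<Rightarrow> 'k" where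
  "nabla_II N G W F X Y Z w =
     normal_connection N G W F (\<lambda>w'. second_ff N G W F w' (Y w') (Z w')) w (X w)
   - second_ff N G W F w (levi_civita W (induced_metric G F) (X w) Y w) (Z w)
   - second_ff N G W F w (Y w) (levi_civita W (induced_metric G F) (X w) Z w)"

section \<open>The homogeneous model of the unit tangent bundle of the sphere\<close>

type_synonym 'n rvec = "(real, 'n) vec"
type_synonym 'n rmat = "('n rvec, 'n) vec"

text \<open>The index type has \<open>n + 1\<close> elements, ordered by its linear order; \<open>last_ix\<close> and \<open>prev_ix\<close> are the
  indices \<open>n + 1\<close> and \<open>n\<close>.\<close>

definition last_ix :: "'n::{finite,linorder}" where
  "last_ix = Max UNIV"

definition prev_ix :: "'n::{finite,linorder}" where
  "prev_ix = Max (UNIV - {last_ix})"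

definition SO_group :: "('n::finite rmat) set" where
  "SO_group = {a. rotation_matrix a}"

definition so_algebra :: "('n::finite rmat) set" where
  "so_algebra = {X. transpose X = - X}"

definition so_inner :: "'n rmat \<Rightarrow> 'n::finite rmat \<Rightarrow> real" where
  "so_inner X Y = - (1 / 2) * trace (X ** Y)"

definition commutator :: "'n rmat \<Rightarrow> 'n rmat \<Rightarrow> 'n::finite rmat" where
  "commutator X Y = X ** Y - Y ** X"

definition Ad :: "'n rmat \<Rightarrow> 'n rmat \<Rightarrow> 'n::finite rmat" where
  "Ad a X = a ** X ** matrix_inv a"

definition mat_exp :: "'n rmat \<Rightarrow> 'n::finite rmat" where
  "mat_exp X = (\<Sum>k. (1 / fact k) *\<^sub>R (((**) X ^^ k) (mat 1)))"

definition base_pt :: "'n::{finite,linorder} rvec" where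
  "base_pt = axis last_ix 1"

definition nu0 :: "'n::{finite,linorder} rmat" where
  "nu0 = (\<chi> i j. if i = prev_ix \<and> j = last_ix then 1
                 else if i = last_ix \<and> j = prev_ix then -1 else 0)"

definition K_group :: "('n::{finite,linorder} rmat) set" where
  "K_group = {a \<in> SO_group. a *v base_pt = base_pt}"

definition H_group :: "('n::{finite,linorder} rmat) set" where
  "H_group = {a \<in> K_group. Ad a nu0 = nu0}"

definition h_algebra :: "('n::{finite,linorder} rmat) set" where
  "h_algebra = {X \<in> so_algebra. \<forall>t. mat_exp (t *\<^sub>R X) \<in> H_group}"

definition p_space :: "('n::{finite,linorder} rmat) set" where
  "p_space = {X \<in> so_algebra. \<forall>Y\<in>h_algebra. so_inner X Y = 0}"

text \<open>A unit tangent vector of the sphere is a pair (foot point, vector).  The homogeneous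
  space \<open>G/H\<close> is identified with this set by sending \<open>aH\<close> to \<open>act a base_vec\<close>, where \<open>base_vec\<close> is
  the tangent vector at the base point corresponding to \<open>nu0\<close>; \<open>act\<close> is the action by differentials.\<close>

definition unit_tangent_bundle :: "('n rvec \<times> 'n::finite rvec) set" where
  "unit_tangent_bundle = {(p, v). norm p = 1 \<and> norm v = 1 \<and> p \<bullet> v = 0}"

definition act :: "'n rmat \<Rightarrow> 'n rvec \<times> 'n rvec \<Rightarrow> 'n rvec \<times> 'n::finite rvec" where
  "act a u = (a *v fst u, a *v snd u)"

definition base_vec :: "'n rvec \<times> 'n::{finite,linorder} rvec" where
  "base_vec = (base_pt, vector_derivative (\<lambda>t. mat_exp (t *\<^sub>R nu0) *v base_pt) (at 0))"

definition beta_H ::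
  "'n rvec \<times> 'n rvec \<Rightarrow> 'n rvec \<times> 'n rvec \<Rightarrow> 'n::{finite,linorder} rmat" where
  "beta_H u X = (THE \<xi>. (\<exists>a\<in>SO_group. act a base_vec = u \<and> \<xi> \<in> Ad a ` p_space) \<and>
     ((\<lambda>t. act (mat_exp (t *\<^sub>R \<xi>)) u) has_vector_derivative X) (at 0))"

definition h_metric :: "('n rvec \<times> 'n::{finite,linorder} rvec) metric" where
  "h_metric u X Y = so_inner (beta_H u X) (beta_H u Y)"

definition J_end ::
  "'n rvec \<times> 'n rvec \<Rightarrow> 'n rvec \<times> 'n rvec \<Rightarrow> 'n rvec \<times> 'n::{finite,linorder} rvec" where
  "J_end u X = (THE Y. Y \<in> tangent_space unit_tangent_bundle u \<and>
     (\<exists>a\<in>SO_group. act a base_vec = u \<and> beta_H u Y = commutator (Ad a nu0) (beta_H u X)))"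

text \<open>Round metric of the unit sphere.\<close>

definition g_metric :: "('n::finite rvec) metric" where
  "g_metric p v w = v \<bullet> w"

section \<open>Unit normal bundle and spherical Gauss map\<close>

definition unit_normal_bundle ::
  "'a set \<Rightarrow> ('a, 'm::finite) atlas \<Rightarrow> ('a \<Rightarrow> 'n::finite rvec) \<Rightarrow> ('a \<times> 'n rvec) set" where
  "unit_normal_bundle M A f = {(q, v). q \<in> M \<and> norm v = 1 \<and> v \<bullet> f q = 0 \<and>
     (\<forall>(U, x)\<in>A. \<forall>u\<in>U. x u = q \<longrightarrow> (\<forall>a. g_metric (f q) v (frechet_derivative (f \<circ> x) (at u) a) = 0))}"

definition gauss_map :: "('a \<Rightarrow> 'n rvec) \<Rightarrow> 'a \<times> 'n rvec \<Rightarrow> 'n rvec \<times> 'n::finite rvec" where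
  "gauss_map f \<xi> = (f (fst \<xi>), snd \<xi>)"

text \<open>Smooth local parametrizations of the unit normal bundle as a submanifold of the product of
  \<open>M\<close> with the ambient Euclidean space.  As \<open>f\<close> is an immersion, regularity of \<open>\<psi>\<close> is the same as
  regularity of \<open>gauss_map f \<circ> \<psi>\<close>.\<close>

definition normal_bundle_param ::
  "'a::topological_space set \<Rightarrow> ('a, 'm::finite) atlas \<Rightarrow> ('a \<Rightarrow> 'n::finite rvec)
     \<Rightarrow> (real ^ 'b) set \<Rightarrow> (real ^ 'b::finite \<Rightarrow> 'a \<times> 'n rvec) \<Rightarrow> bool" where
  "normal_bundle_param M A f W \<psi> \<longleftrightarrow>
     local_param (unit_normal_bundle M A f) W \<psi> \<and>
     (\<forall>(U, x)\<in>A. smooth_on {w \<in> W. fst (\<psi> w) \<in> x ` U} (\<lambda>w. inv_into U x (fst (\<psi> w)))) \<and>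
     smooth_on W (snd \<circ> \<psi>) \<and>
     (\<forall>w\<in>W. inj (frechet_derivative (gauss_map f \<circ> \<psi>) (at w)))"

text \<open>Tangent vectors of the unit normal bundle at \<open>\<psi> w\<close> are identified with their images under the
  differential of the Gauss map, and those of \<open>M\<close> with their images under \<open>df\<close>; hence the metric
  on them is \<open>h_metric\<close>, and the differential of the bundle projection
  appears composed with the injective \<open>df\<close>.\<close>

definition vertical_space ::
  "('a \<Rightarrow> 'n::finite rvec) \<Rightarrow> (real ^ 'b::finite \<Rightarrow> 'a \<times> 'n rvec) \<Rightarrow> real ^ 'b
     \<Rightarrow> ('n rvec \<times> 'n rvec) set" where
  "vertical_space f \<psi> w =
     frechet_derivative (gauss_map f \<circ> \<psi>) (at w) ` {a. frechet_derivative (f \<circ> fst \<circ> \<psi>) (at w) a = 0}"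

definition horizontal_space ::
  "('a \<Rightarrow> 'n::{finite,linorder} rvec) \<Rightarrow> (real ^ 'b::finite \<Rightarrow> 'a \<times> 'n rvec) \<Rightarrow> real ^ 'b
     \<Rightarrow> ('n rvec \<times> 'n rvec) set" where
  "horizontal_space f \<psi> w =
     {X \<in> range (frechet_derivative (gauss_map f \<circ> \<psi>) (at w)).
        \<forall>Y\<in>vertical_space f \<psi> w. h_metric (gauss_map f (\<psi> w)) X Y = 0}"

text \<open>\<open>local_frame I f \<psi> W D E\<close>: the fields \<open>E i\<close>, \<open>i \<in> I\<close>, are smooth on \<open>W\<close>, take values in the
  distribution \<open>D\<close> and are orthonormal (a frame if \<open>I\<close> has the rank of \<open>D\<close> as its cardinality).\<close>

definition local_frame ::
  "nat set \<Rightarrow> ('a \<Rightarrow> 'n::{finite,linorder} rvec) \<Rightarrow> (real ^ 'b::finite \<Rightarrow> 'a \<times> 'n rvec)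
     \<Rightarrow> (real ^ 'b) set \<Rightarrow> (real ^ 'b \<Rightarrow> ('n rvec \<times> 'n rvec) set)
     \<Rightarrow> (nat \<Rightarrow> real ^ 'b \<Rightarrow> 'n rvec \<times> 'n rvec) \<Rightarrow> bool" where
  "local_frame I f \<psi> W D E \<longleftrightarrow>
     (\<forall>i\<in>I. smooth_on W (E i) \<and> (\<forall>w\<in>W. E i w \<in> D w)) \<and>
     (\<forall>w\<in>W. \<forall>i\<in>I. \<forall>j\<in>I.
        h_metric (gauss_map f (\<psi> w)) (E i w) (E j w) = (if i = j then 1 else 0))"

end

theory Submission
  imports Defs
begin

text \<open>On \<open>US\<^sup>n\<close>, realised as orthonormal pairs \<open>(p, v)\<close>, one computes
  \<open>h(X, Y) = X\<^sub>1 \<bullet> Y\<^sub>1 + X\<^sub>2 \<bullet> Y\<^sub>2 - \<theta>(X) \<theta>(Y)\<close> with the contact form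
  \<open>\<theta>(X) = X\<^sub>1 \<bullet> v\<close>, and \<open>J X = (- X\<^sub>2, X\<^sub>1)\<close> on \<open>ker \<theta>\<close>.  The spherical Gauss map
  \<open>\<mu> = (F, \<nu>)\<close> is Legendrian, so all corrections to the flat derivative in its second fundamental
  form are orthogonal to the vectors \<open>J d\<mu>(c)\<close> and
  \<open>h(II\<^sub>\<mu>(a, b), J d\<mu>(c)) = D\<^sub>a D\<^sub>b \<nu> \<bullet> D\<^sub>c F - D\<^sub>a D\<^sub>b F \<bullet> D\<^sub>c \<nu>\<close>.
  Differentiating \<open>\<nu> \<bullet> d\<sigma> = 0\<close> twice, for \<open>F = \<sigma> \<circ> u\<close> with a parametrization \<open>\<sigma>\<close> of the
  immersion, turns this into a symmetric cubic form in the derivatives of \<open>\<sigma>\<close>.  It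
  is \<open>- \<nabla>II\<^sub>f\<close> on horizontal vectors, \<open>- II\<^sub>f(a, b) \<bullet> D\<^sub>c \<nu>\<close> for vertical \<open>c\<close>, and vanishes
  when two arguments are vertical.\<close>

section \<open>Directional derivatives and smooth maps\<close>

text \<open>The central notions of the statement are definite descriptions over fields, frames or
  group elements, so each needs an explicit candidate and a uniqueness argument before anything can
  be computed. The candidates are written with ambient vectors and iterated directional derivatives
  \<open>dd a (dd b f)\<close>. Why the corrections are invisible to \<open>J d\<mu>(c)\<close>:
  since \<open>\<theta>\<close> vanishes on the image of \<open>d\<mu>\<close>, the Christoffel term
  only retains a multiple of \<open>v\<close> in its first slot, and that slot of
  \<open>J d\<mu>(c)\<close> is orthogonal to \<open>v\<close>. Symmetry of second derivatives turns
  \<open>\<theta> = 0\<close> into the Lagrangian condition, so \<open>J d\<mu>(c)\<close> is normal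
  to the immersion and the tangential part is lost as well. Two domains must be kept apart: the mean
  curvature refers to the whole parameter domain \<open>W\<close>, which may meet many charts of
  \<open>M\<close>, while the cubic form is computed in the one chart at the foot point. Hence the
  Legendrian conditions are proved on all of \<open>W\<close>, and derivatives are compared near
  \<open>w\<^sub>0\<close> only. Horizontality enters as tangency of \<open>d\<nu>\<close> to the
  immersion, which comes from a dimension count.\<close>

definition dd :: "'a::real_normed_vector \<Rightarrow> ('a \<Rightarrow> 'b::real_normed_vector) \<Rightarrow> 'a \<Rightarrow> 'b" where
  "dd a f u = frechet_derivative f (at u) a"

lemma dd_has_derivative: "f differentiable (at u) \<Longrightarrow> (f has_derivative (\<lambda>a. dd a f u)) (at u)"
  unfolding dd_def by (simp add: frechet_derivative_works[symmetric])

lemma dd_eqI: "(f has_derivative f') (at u) \<Longrightarrow> dd a f u = f' a"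
  unfolding dd_def using frechet_derivative_at by metis

lemma dd_linear: "f differentiable (at u) \<Longrightarrow> linear (\<lambda>a. dd a f u)"
  using dd_has_derivative has_derivative_linear by blast

lemma has_derivative_dd_chain:
  assumes "(g has_derivative g') (at x within S)" "f differentiable (at (g x))"
  shows "((\<lambda>x. f (g x)) has_derivative (\<lambda>h. dd (g' h) f (g x))) (at x within S)"
  using has_derivative_compose[of g g' x S f "\<lambda>a. dd a f (g x)"] assms dd_has_derivative by blast

text \<open>Both maps have the same set of derivatives at \<open>u\<close>, and
  \<open>frechet_derivative\<close> is a choice from that set; so the values agree even where no
  derivative exists.\<close>

lemma dd_cong_open:
  assumes "open S" "u \<in> S" "\<And>x. x \<in> S \<Longrightarrow> f x = g x"
  shows "dd a f u = dd a g u"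
proof -
  have "(f has_derivative f') (at u) \<longleftrightarrow> (g has_derivative f') (at u)" for f'
  proof
    show "(g has_derivative f') (at u)" if "(f has_derivative f') (at u)"
      by (rule has_derivative_transform_within_open[OF that assms(1,2)]) (rule assms(3))
    show "(f has_derivative f') (at u)" if "(g has_derivative f') (at u)"
      by (rule has_derivative_transform_within_open[OF that assms(1,2)]) (simp add: assms(3))
  qed
  then show ?thesis
    unfolding dd_def frechet_derivative_def by simp
qed

lemma differentiable_cong_open:
  assumes "open S" "u \<in> S" "\<And>x. x \<in> S \<Longrightarrow> f x = g x" "f differentiable (at u)"
  shows "g differentiable (at u)"
proof -
  obtain f' where "(f has_derivative f') (at u)" using assms(4) unfolding differentiable_def by blast
  from has_derivative_transform_within_open[OF this assms(1,2,3)]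
  show ?thesis unfolding differentiable_def by blast
qed

lemma ck_on_cong:
  assumes "open S" "\<And>x. x \<in> S \<Longrightarrow> f x = g x" "ck_on k S f"
  shows "ck_on k S g"
  using assms(2,3)
proof (induction k arbitrary: f g)
  case 0
  then show ?case using continuous_on_cong[of S S f g] by auto
next
  case (Suc k)
  have "g differentiable (at x)" if "x \<in> S" for x
    using differentiable_cong_open[OF assms(1) that, of f g] Suc.prems that by auto
  moreover have "ck_on k S (\<lambda>x. frechet_derivative g (at x) v)" for v
  proof (rule Suc.IH)
    show "frechet_derivative f (at x) v = frechet_derivative g (at x) v" if "x \<in> S" for x
      using dd_cong_open[OF assms(1) that, of f g v] Suc.prems unfolding dd_def by auto
    show "ck_on k S (\<lambda>x. frechet_derivative f (at x) v)"
      using Suc.prems by auto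
  qed
  ultimately show ?case by simp
qed

lemma ck_on_Suc_imp: "ck_on (Suc k) S f \<Longrightarrow> ck_on k S f"
proof (induction k arbitrary: f)
  case 0
  then show ?case
    by (auto intro!: continuous_at_imp_continuous_on differentiable_imp_continuous_within)
next
  case (Suc k)
  then show ?case by (metis ck_on.simps(2))
qed

lemma smooth_on_differentiable: "smooth_on S f \<Longrightarrow> x \<in> S \<Longrightarrow> f differentiable (at x)"
  unfolding smooth_on_def using ck_on.simps(2)[of 0 S f] by blast

lemma smooth_on_dd: "smooth_on S f \<Longrightarrow> smooth_on S (dd a f)"
  unfolding smooth_on_def dd_def[abs_def] using ck_on.simps(2)[of _ S f] by blast

lemma smooth_on_subset: "smooth_on S f \<Longrightarrow> T \<subseteq> S \<Longrightarrow> smooth_on T f"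
proof -
  have "ck_on k S f \<Longrightarrow> T \<subseteq> S \<Longrightarrow> ck_on k T f" for k
    by (induction k arbitrary: f) (auto intro: continuous_on_subset)
  then show "smooth_on S f \<Longrightarrow> T \<subseteq> S \<Longrightarrow> smooth_on T f"
    unfolding smooth_on_def by blast
qed

lemma smooth_on_cong:
  assumes "open S" "\<And>x. x \<in> S \<Longrightarrow> f x = g x" "smooth_on S f"
  shows "smooth_on S g"
  using assms ck_on_cong unfolding smooth_on_def by blast

section \<open>Closure properties of smoothness\<close>

lemma ck_on_const: "ck_on k S (\<lambda>x. c)"
  by (induction k arbitrary: c) auto

lemma ck_on_bounded_linear: "bounded_linear f \<Longrightarrow> ck_on k S f"
proof (induction k)
  case 0
  then show ?case by (simp add: linear_continuous_on)
next
  case (Suc k)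
  then have "frechet_derivative f (at x) = f" for x
    by (metis bounded_linear_imp_has_derivative frechet_derivative_at)
  with Suc show ?case
    by (auto simp: ck_on_const bounded_linear_imp_differentiable)
qed

lemma ck_on_add:
  assumes "open S" "ck_on k S f" "ck_on k S g"
  shows "ck_on k S (\<lambda>x. f x + g x)"
  using assms(2,3)
proof (induction k arbitrary: f g)
  case 0
  then show ?case by (auto intro: continuous_intros)
next
  case (Suc k)
  have "ck_on k S (\<lambda>x. frechet_derivative (\<lambda>x. f x + g x) (at x) v)" for v
  proof (rule ck_on_cong[OF assms(1)])
    show "ck_on k S (\<lambda>x. frechet_derivative f (at x) v + frechet_derivative g (at x) v)"
      using Suc by auto
    show "frechet_derivative f (at x) v + frechet_derivative g (at x) v
        = frechet_derivative (\<lambda>x. f x + g x) (at x) v" if "x \<in> S" for x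
    proof -
      have "((\<lambda>x. f x + g x) has_derivative (\<lambda>a. dd a f x + dd a g x)) (at x)"
        using Suc.prems that by (intro has_derivative_add dd_has_derivative) auto
      from dd_eqI[OF this, of v] show ?thesis unfolding dd_def by simp
    qed
  qed
  with Suc.prems show ?case by auto
qed

text \<open>The product rule leaves one factor undifferentiated; \<open>ck_on_Suc_imp\<close> lowers
  its order so that the induction hypothesis applies to both summands.\<close>

lemma ck_on_bilinear:
  assumes "bounded_bilinear B" "open S" "ck_on k S f" "ck_on k S g"
  shows "ck_on k S (\<lambda>x. B (f x) (g x))"
  using assms(3,4)
proof (induction k arbitrary: f g)
  case 0
  then show ?case using bounded_bilinear.continuous_on[OF assms(1)] by auto
next
  case (Suc k)
  have der: "((\<lambda>x. B (f x) (g x)) has_derivative (\<lambda>a. B (f x) (dd a g x) + B (dd a f x) (g x))) (at x)"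
    if "x \<in> S" for x
    using Suc.prems that
    by (intro bounded_bilinear.FDERIV[OF assms(1)] dd_has_derivative) auto
  have "ck_on k S (\<lambda>x. frechet_derivative (\<lambda>x. B (f x) (g x)) (at x) v)" for v
  proof (rule ck_on_cong[OF assms(2)])
    have 1: "ck_on k S f" "ck_on k S g"
      using Suc.prems ck_on_Suc_imp by blast+
    show "ck_on k S (\<lambda>x. B (f x) (dd v g x) + B (dd v f x) (g x))"
      unfolding dd_def using Suc.prems 1
      by (intro ck_on_add[OF assms(2)] Suc.IH) auto
    show "B (f x) (dd v g x) + B (dd v f x) (g x) = frechet_derivative (\<lambda>x. B (f x) (g x)) (at x) v"
      if "x \<in> S" for x
      using dd_eqI[OF der[OF that], of v] unfolding dd_def by simp
  qed
  with der show ?case by (auto simp: differentiable_def)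
qed

lemma smooth_on_const: "smooth_on S (\<lambda>x. c)"
  by (simp add: smooth_on_def ck_on_const)

lemma smooth_on_bounded_linear: "bounded_linear f \<Longrightarrow> smooth_on S f"
  by (simp add: smooth_on_def ck_on_bounded_linear)

lemma smooth_on_add: "open S \<Longrightarrow> smooth_on S f \<Longrightarrow> smooth_on S g \<Longrightarrow> smooth_on S (\<lambda>x. f x + g x)"
  by (simp add: smooth_on_def ck_on_add)

lemma smooth_on_bilinear:
  "bounded_bilinear B \<Longrightarrow> open S \<Longrightarrow> smooth_on S f \<Longrightarrow> smooth_on S g \<Longrightarrow> smooth_on S (\<lambda>x. B (f x) (g x))"
  by (simp add: smooth_on_def ck_on_bilinear)

lemmas smooth_on_scaleR = smooth_on_bilinear[OF bounded_bilinear_scaleR]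

lemma smooth_on_diff:
  assumes "open S" "smooth_on S f" "smooth_on S g"
  shows "smooth_on S (\<lambda>x. f x - g x)"
  using smooth_on_add[OF assms(1,2) smooth_on_scaleR[OF assms(1) smooth_on_const[of S "-1"] assms(3)]]
  by simp

text \<open>The core of Young's theorem: the mean value theorem in direction \<open>a\<close> turns
  the second difference into a difference of values of \<open>dd a f\<close>, and differentiability
  of \<open>dd a f\<close> at the single point \<open>u\<close> gives the limit.\<close>

lemma second_difference_tendsto:
  fixes f :: "'a::real_normed_vector \<Rightarrow> real"
  assumes "open S" "u \<in> S" "\<And>x. x \<in> S \<Longrightarrow> f differentiable (at x)" "dd a f differentiable (at u)"
  shows "((\<lambda>t. (f (u + t *\<^sub>R a + t *\<^sub>R b) - f (u + t *\<^sub>R a) - f (u + t *\<^sub>R b) + f u) / t\<^sup>2)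
           \<longlongrightarrow> dd b (dd a f) u) (at_right 0)"
proof (rule tendstoI)
  fix e :: real assume "e > 0"
  \<comment> \<open>\<open>t * C\<close> bounds the sum of the distances from \<open>u\<close> to
    the two intermediate points \<open>?y1\<close> and \<open>?y2\<close>; the summand 1 makes
    \<open>C\<close> positive.\<close>
  define C where "C = 2 * norm a + norm b + 1"
  have C: "C > 0" unfolding C_def by (simp add: add_nonneg_pos)
  have L: "linear (\<lambda>v. dd v (dd a f) u)" by (rule dd_linear[OF assms(4)])
  obtain d where d: "d > 0" "\<And>y. norm (y - u) < d \<Longrightarrow>
      norm (dd a f y - dd a f u - dd (y - u) (dd a f) u) \<le> (e / (2 * C)) * norm (y - u)"
  proof -
    have "e / (2 * C) > 0" using \<open>e > 0\<close> C by simp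
    with dd_has_derivative[OF assms(4)] show ?thesis
      using that unfolding has_derivative_at_alt by blast
  qed
  obtain r where r: "r > 0" "ball u r \<subseteq> S" using assms(1,2) open_contains_ball by blast
  define \<delta> where "\<delta> = min d r / C"
  have \<delta>: "\<delta> > 0" unfolding \<delta>_def using d r C by simp
  have "dist ((f (u + t *\<^sub>R a + t *\<^sub>R b) - f (u + t *\<^sub>R a) - f (u + t *\<^sub>R b) + f u) / t\<^sup>2) (dd b (dd a f) u) < e"
    if t: "t > 0" "t < \<delta>" for t
  proof -
    have small: "norm (s *\<^sub>R a + r' *\<^sub>R b) < min d r" "norm (s *\<^sub>R a + r' *\<^sub>R b) \<le> t * norm a + t * norm b"
      if "0 \<le> s" "s \<le> t" "0 \<le> r'" "r' \<le> t" for s r'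
    proof -
      have "norm (s *\<^sub>R a + r' *\<^sub>R b) \<le> s * norm a + r' * norm b"
        using norm_triangle_ineq[of "s *\<^sub>R a" "r' *\<^sub>R b"] that by simp
      also have "\<dots> \<le> t * norm a + t * norm b"
        using that by (intro add_mono mult_right_mono) auto
      finally show 1: "norm (s *\<^sub>R a + r' *\<^sub>R b) \<le> t * norm a + t * norm b" .
      also have "\<dots> \<le> t * C" unfolding C_def using t by (simp add: algebra_simps)
      also have "\<dots> < min d r" using t C unfolding \<delta>_def by (simp add: pos_less_divide_eq)
      finally show "norm (s *\<^sub>R a + r' *\<^sub>R b) < min d r" .
    qed
    have inS: "u + s *\<^sub>R a + r' *\<^sub>R b \<in> S" if "0 \<le> s" "s \<le> t" "0 \<le> r'" "r' \<le> t" for s r'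
    proof -
      have "dist u (u + s *\<^sub>R a + r' *\<^sub>R b) = norm (s *\<^sub>R a + r' *\<^sub>R b)"
        by (simp add: dist_norm norm_minus_commute algebra_simps)
      then have "u + s *\<^sub>R a + r' *\<^sub>R b \<in> ball u r" using small(1)[OF that] by simp
      then show ?thesis using r by blast
    qed
    \<comment> \<open>The increment of \<open>\<phi>\<close> from 0 to \<open>t\<close> is the
      second difference.\<close>
    define \<phi> where "\<phi> s = f (u + s *\<^sub>R a + t *\<^sub>R b) - f (u + s *\<^sub>R a)" for s
    have der: "(\<phi> has_derivative (\<lambda>h. h * (dd a f (u + s *\<^sub>R a + t *\<^sub>R b) - dd a f (u + s *\<^sub>R a)))) (at s)"
      if "0 \<le> s" "s \<le> t" for s
    proof -
      have D1: "f differentiable (at (u + s *\<^sub>R a + t *\<^sub>R b))" using inS[of s t] assms(3) that t by auto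
      have D2: "f differentiable (at (u + s *\<^sub>R a))" using inS[of s 0] assms(3) that t by auto
      have 1: "((\<lambda>s. f (u + s *\<^sub>R a + t *\<^sub>R b)) has_derivative (\<lambda>h. dd (h *\<^sub>R a) f (u + s *\<^sub>R a + t *\<^sub>R b))) (at s)"
        by (rule has_derivative_dd_chain) (auto intro!: derivative_eq_intros D1)
      have 2: "((\<lambda>s. f (u + s *\<^sub>R a)) has_derivative (\<lambda>h. dd (h *\<^sub>R a) f (u + s *\<^sub>R a))) (at s)"
        by (rule has_derivative_dd_chain) (auto intro!: derivative_eq_intros D2)
      show ?thesis
        using has_derivative_diff[OF 1 2]
        unfolding \<phi>_def linear_cmul[OF dd_linear[OF D1]] linear_cmul[OF dd_linear[OF D2]]
        by (simp add: right_diff_distrib)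
    qed
    obtain s where s: "0 < s" "s < t"
      "\<phi> t - \<phi> 0 = t * (dd a f (u + s *\<^sub>R a + t *\<^sub>R b) - dd a f (u + s *\<^sub>R a))"
    proof -
      have "\<exists>z>0. z < t \<and> \<phi> t - \<phi> 0 = (t - 0) * (dd a f (u + z *\<^sub>R a + t *\<^sub>R b) - dd a f (u + z *\<^sub>R a))"
        using t der by (intro MVT2) (auto simp: has_field_derivative_def mult_commute_abs)
      then show ?thesis using that by auto
    qed
    let ?y1 = "u + s *\<^sub>R a + t *\<^sub>R b" and ?y2 = "u + s *\<^sub>R a"
    have y1: "norm (?y1 - u) < d" "norm (?y1 - u) \<le> t * norm a + t * norm b"
      using small[of s t] s t by (auto simp: algebra_simps)
    have y2: "norm (?y2 - u) < d" "norm (?y2 - u) \<le> t * norm a"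
      using small[of s 0] s t by (auto simp: algebra_simps mult_right_mono)
    \<comment> \<open>The common displacement \<open>s *\<^sub>R a\<close> cancels, so the unknown
      \<open>s\<close> of the mean value theorem drops out of the linear part.\<close>
    have split: "dd (?y1 - u) (dd a f) u - dd (?y2 - u) (dd a f) u = t * dd b (dd a f) u"
    proof -
      have "dd (?y1 - u) (dd a f) u - dd (?y2 - u) (dd a f) u = dd ((?y1 - u) - (?y2 - u)) (dd a f) u"
        by (rule linear_diff[OF L, symmetric])
      also have "(?y1 - u) - (?y2 - u) = t *\<^sub>R b" by simp
      finally show ?thesis using linear_cmul[OF L] by simp
    qed
    have "\<bar>(dd a f ?y1 - dd a f ?y2) - t * dd b (dd a f) u\<bar>
        \<le> \<bar>dd a f ?y1 - dd a f u - dd (?y1 - u) (dd a f) u\<bar> + \<bar>dd a f ?y2 - dd a f u - dd (?y2 - u) (dd a f) u\<bar>"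
      using split by linarith
    also have "\<dots> \<le> (e / (2 * C)) * norm (?y1 - u) + (e / (2 * C)) * norm (?y2 - u)"
      using d(2)[OF y1(1)] d(2)[OF y2(1)] by simp
    also have "\<dots> \<le> (e / (2 * C)) * (t * C)"
    proof -
      have "norm (?y1 - u) + norm (?y2 - u) \<le> t * C"
        using y1(2) y2(2) t unfolding C_def by (simp add: algebra_simps)
      then have "(e / (2 * C)) * (norm (?y1 - u) + norm (?y2 - u)) \<le> (e / (2 * C)) * (t * C)"
        using \<open>e > 0\<close> C by (intro mult_left_mono) auto
      then show ?thesis by (simp add: distrib_left)
    qed
    also have "\<dots> = e / 2 * t" using C by simp
    finally have *: "\<bar>(dd a f ?y1 - dd a f ?y2) - t * dd b (dd a f) u\<bar> \<le> e / 2 * t" .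
    have eq: "f (u + t *\<^sub>R a + t *\<^sub>R b) - f (u + t *\<^sub>R a) - f (u + t *\<^sub>R b) + f u = \<phi> t - \<phi> 0"
      unfolding \<phi>_def by simp
    have aux: "t * B / t\<^sup>2 - L = (B - t * L) / t" for B L
      using t by (simp add: field_simps power2_eq_square)
    have "(f (u + t *\<^sub>R a + t *\<^sub>R b) - f (u + t *\<^sub>R a) - f (u + t *\<^sub>R b) + f u) / t\<^sup>2 - dd b (dd a f) u
        = ((dd a f ?y1 - dd a f ?y2) - t * dd b (dd a f) u) / t"
      unfolding eq s(3) by (rule aux)
    then have "dist ((f (u + t *\<^sub>R a + t *\<^sub>R b) - f (u + t *\<^sub>R a) - f (u + t *\<^sub>R b) + f u) / t\<^sup>2) (dd b (dd a f) u)
        = \<bar>(dd a f ?y1 - dd a f ?y2) - t * dd b (dd a f) u\<bar> / t"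
      using t by (simp add: dist_real_def)
    also have "\<dots> \<le> e / 2" using * t by (simp add: pos_divide_le_eq)
    also have "\<dots> < e" using \<open>e > 0\<close> by simp
    finally show ?thesis .
  qed
  then show "\<forall>\<^sub>F t in at_right 0. dist ((f (u + t *\<^sub>R a + t *\<^sub>R b) - f (u + t *\<^sub>R a) - f (u + t *\<^sub>R b) + f u) / t\<^sup>2) (dd b (dd a f) u) < e"
    using \<delta> unfolding eventually_at_right_field by auto
qed

lemma dd_inner_const:
  "f differentiable (at u) \<Longrightarrow> dd a (\<lambda>x. f x \<bullet> c) u = dd a f u \<bullet> c"
  by (rule dd_eqI) (auto intro!: derivative_eq_intros dd_has_derivative)

text \<open>The second difference is symmetric in \<open>a\<close> and \<open>b\<close>, so both
  iterated derivatives are its limit.\<close>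

lemma dd_dd_commute_real:
  fixes f :: "'a::real_normed_vector \<Rightarrow> real"
  assumes "open S" "u \<in> S" "\<And>x. x \<in> S \<Longrightarrow> f differentiable (at x)"
    "dd a f differentiable (at u)" "dd b f differentiable (at u)"
  shows "dd a (dd b f) u = dd b (dd a f) u"
proof -
  note second_difference_tendsto[OF assms(1-3,4), of b]
  moreover have "((\<lambda>t. (f (u + t *\<^sub>R a + t *\<^sub>R b) - f (u + t *\<^sub>R a) - f (u + t *\<^sub>R b) + f u) / t\<^sup>2)
           \<longlongrightarrow> dd a (dd b f) u) (at_right 0)"
    using second_difference_tendsto[OF assms(1-3,5), of a] by (simp add: algebra_simps)
  ultimately show ?thesis using tendsto_unique trivial_limit_at_right_real by blast
qed

lemma dd_dd_commute:
  fixes f :: "'a::real_normed_vector \<Rightarrow> 'b::euclidean_space"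
  assumes "open S" "u \<in> S" "\<And>x. x \<in> S \<Longrightarrow> f differentiable (at x)"
    "dd a f differentiable (at u)" "dd b f differentiable (at u)"
  shows "dd a (dd b f) u = dd b (dd a f) u"
proof (rule euclidean_eqI)
  fix c :: 'b
  let ?g = "\<lambda>x. f x \<bullet> c"
  have dg: "dd v ?g x = dd v f x \<bullet> c" if "x \<in> S" for v x
    using dd_inner_const[OF assms(3)[OF that]] .
  have ddg: "dd w (dd v ?g) u = dd w (dd v f) u \<bullet> c" if "dd v f differentiable (at u)" for v w
    using dd_cong_open[OF assms(1,2), of "dd v ?g" "\<lambda>x. dd v f x \<bullet> c"] dg dd_inner_const[OF that] by simp
  have diff: "dd v ?g differentiable (at u)" if "dd v f differentiable (at u)" for v
  proof (rule differentiable_cong_open[OF assms(1,2), of "\<lambda>x. dd v f x \<bullet> c"])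
    show "(\<lambda>x. dd v f x \<bullet> c) differentiable (at u)"
      using that by (intro differentiable_inner) auto
  qed (simp add: dg)
  have "dd a (dd b ?g) u = dd b (dd a ?g) u"
    using assms diff by (intro dd_dd_commute_real[OF assms(1,2)]) (auto intro!: differentiable_inner)
  then show "dd a (dd b f) u \<bullet> c = dd b (dd a f) u \<bullet> c"
    using ddg assms by simp
qed

lemma smooth_dd_commute:
  fixes f :: "'a::euclidean_space \<Rightarrow> 'b::euclidean_space"
  assumes "open S" "smooth_on S f" "u \<in> S"
  shows "dd a (dd b f) u = dd b (dd a f) u"
  using assms smooth_on_differentiable smooth_on_dd
  by (intro dd_dd_commute[OF assms(1,3)]) blast+

section \<open>Derivatives in directions that vary with the point\<close>

lemma dd_basis_sum:
  fixes f :: "'a::euclidean_space \<Rightarrow> 'b::real_normed_vector"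
  assumes "f differentiable (at u)"
  shows "dd y f u = (\<Sum>i\<in>Basis. (y \<bullet> i) *\<^sub>R dd i f u)"
proof -
  note L = dd_linear[OF assms]
  have "dd y f u = dd (\<Sum>i\<in>Basis. (y \<bullet> i) *\<^sub>R i) f u" by (simp add: euclidean_representation)
  also have "\<dots> = (\<Sum>i\<in>Basis. (y \<bullet> i) *\<^sub>R dd i f u)"
    using linear_sum[OF L, of "\<lambda>i. (y \<bullet> i) *\<^sub>R i" Basis] linear_cmul[OF L] by simp
  finally show ?thesis .
qed

lemma dd_sum:
  assumes "\<And>i. i \<in> I \<Longrightarrow> f i differentiable (at u)"
  shows "dd a (\<lambda>x. \<Sum>i\<in>I. f i x) u = (\<Sum>i\<in>I. dd a (f i) u)"
  using assms by (intro dd_eqI) (auto intro!: has_derivative_sum dd_has_derivative)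

lemma dd_scaleR_const: "f differentiable (at u) \<Longrightarrow> dd a (\<lambda>x. c *\<^sub>R f x) u = c *\<^sub>R dd a f u"
  by (rule dd_eqI) (auto intro!: derivative_eq_intros dd_has_derivative)

lemma dd_dd_basis_sum:
  fixes f :: "'a::euclidean_space \<Rightarrow> 'b::euclidean_space"
  assumes "open S" "smooth_on S f" "u \<in> S"
  shows "dd z (dd y f) u = (\<Sum>i\<in>Basis. (y \<bullet> i) *\<^sub>R dd z (dd i f) u)"
proof -
  note d1 = smooth_on_differentiable[OF assms(2)]
  note d2 = smooth_on_differentiable[OF smooth_on_dd[OF assms(2)] assms(3)]
  have "dd z (dd y f) u = dd z (\<lambda>x. \<Sum>i\<in>Basis. (y \<bullet> i) *\<^sub>R dd i f x) u"
    by (rule dd_cong_open[OF assms(1,3)]) (rule dd_basis_sum[OF d1])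
  also have "\<dots> = (\<Sum>i\<in>Basis. (y \<bullet> i) *\<^sub>R dd z (dd i f) u)"
    using d2 by (subst dd_sum) (auto simp: dd_scaleR_const)
  finally show ?thesis .
qed

lemma dd_dd_linear:
  fixes f :: "'a::euclidean_space \<Rightarrow> 'b::euclidean_space"
  assumes "open S" "smooth_on S f" "u \<in> S"
  shows "linear (\<lambda>y. dd z (dd y f) u)"
proof -
  have "(\<lambda>y. dd z (dd y f) u) = (\<lambda>y. \<Sum>i\<in>Basis. (y \<bullet> i) *\<^sub>R dd z (dd i f) u)"
    by (rule ext) (rule dd_dd_basis_sum[OF assms])
  moreover have "linear (\<lambda>y. \<Sum>i\<in>Basis. (y \<bullet> i) *\<^sub>R dd z (dd i f) u)"
    by (intro linear_compose_sum ballI linearI) (auto simp: inner_simps algebra_simps)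
  ultimately show ?thesis by simp
qed

text \<open>Expanding the moving direction \<open>y w\<close> in the fixed basis reduces this to the
  chain rule for each \<open>dd i \<sigma>\<close> and the product rule with scalar
  coefficients.\<close>

lemma has_derivative_dd_compose:
  fixes \<sigma> :: "'a::euclidean_space \<Rightarrow> 'b::euclidean_space"
  assumes "open U" "smooth_on U \<sigma>" "u w \<in> U"
    and u: "(u has_derivative u') (at w)" and y: "(y has_derivative y') (at w)" and W: "open W" "w \<in> W" "\<And>w. w \<in> W \<Longrightarrow> u w \<in> U"
  shows "((\<lambda>w. dd (y w) \<sigma> (u w)) has_derivative
     (\<lambda>a. dd (u' a) (dd (y w) \<sigma>) (u w) + dd (y' a) \<sigma> (u w))) (at w)"
proof -
  note d1 = smooth_on_differentiable[OF assms(2)]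
  note d2 = smooth_on_differentiable[OF smooth_on_dd[OF assms(2)] assms(3)]
  have "((\<lambda>w. \<Sum>i\<in>Basis. (y w \<bullet> i) *\<^sub>R dd i \<sigma> (u w)) has_derivative
     (\<lambda>a. \<Sum>i\<in>Basis. (y w \<bullet> i) *\<^sub>R dd (u' a) (dd i \<sigma>) (u w) + (y' a \<bullet> i) *\<^sub>R dd i \<sigma> (u w))) (at w)"
    by (intro has_derivative_sum has_derivative_scaleR has_derivative_inner_left y
      has_derivative_dd_chain[OF u d2])
  then have "((\<lambda>w. dd (y w) \<sigma> (u w)) has_derivative
     (\<lambda>a. \<Sum>i\<in>Basis. (y w \<bullet> i) *\<^sub>R dd (u' a) (dd i \<sigma>) (u w) + (y' a \<bullet> i) *\<^sub>R dd i \<sigma> (u w))) (at w)"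
    by (rule has_derivative_transform_within_open[OF _ W(1,2)]) (rule dd_basis_sum[OF d1[OF W(3)], symmetric])
  then show ?thesis
    by (simp only: sum.distrib dd_basis_sum[OF d1[OF assms(3)], symmetric] dd_dd_basis_sum[OF assms(1-3), symmetric])
qed

section \<open>Levi-Civita connection and pull-back connection\<close>

text \<open>Composition with a curve in \<open>N\<close> of velocity \<open>v\<close> turns any
  derivative within \<open>N\<close> into the derivative of a map on the real line, which is
  unique.\<close>

lemma deriv_along_eqI:
  fixes N :: "'k::euclidean_space set" and \<phi> :: "'k \<Rightarrow> 'c::real_normed_vector"
  assumes "v \<in> tangent_space N q" "(\<phi> has_derivative D) (at q within N)"
  shows "deriv_along N \<phi> q v = D v"
proof -
  obtain c where c: "c 0 = q" "\<forall>\<^sub>F t in nhds (0::real). c t \<in> N" "(c has_vector_derivative v) (at 0)"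
    using assms(1) unfolding tangent_space_def by blast
  obtain O' where O': "open O'" "0 \<in> O'" "\<And>t. t \<in> O' \<Longrightarrow> c t \<in> N"
    using c(2) unfolding eventually_nhds by blast
  have comp: "((\<lambda>t. \<phi> (c t)) has_derivative (\<lambda>h. E (h *\<^sub>R v))) (at 0)"
    if "(\<phi> has_derivative E) (at q within N)" for E
  proof -
    have "(\<phi> has_derivative E) (at (c 0) within c ` O')"
      unfolding c(1) by (rule has_derivative_subset[OF that]) (use O' in auto)
    moreover have "(c has_derivative (\<lambda>h. h *\<^sub>R v)) (at 0 within O')"
      using c(3) unfolding has_vector_derivative_def by (rule has_derivative_at_withinI)
    ultimately have "((\<lambda>t. \<phi> (c t)) has_derivative (\<lambda>h. E (h *\<^sub>R v))) (at 0 within O')"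
      by (rule has_derivative_in_compose[rotated])
    then show ?thesis using O' at_within_open by metis
  qed
  have "(\<phi> has_derivative frechet_derivative \<phi> (at q within N)) (at q within N)"
    using assms(2) frechet_derivative_works differentiable_def by blast
  from has_derivative_unique[OF comp[OF this] comp[OF assms(2)]]
  have "frechet_derivative \<phi> (at q within N) (1 *\<^sub>R v) = D (1 *\<^sub>R v)" by (rule fun_cong)
  then show ?thesis unfolding deriv_along_def by simp
qed

lemma tangent_space_curve:
  assumes "F differentiable (at w)" "open W" "w \<in> W" "\<And>w'. w' \<in> W \<Longrightarrow> F w' \<in> N"
  shows "dd a F w \<in> tangent_space N (F w)"
proof -
  let ?l = "\<lambda>t::real. w + t *\<^sub>R a"
  have l: "(?l has_derivative (\<lambda>h. h *\<^sub>R a)) (at 0)" by (auto intro!: derivative_eq_intros)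
  have "((\<lambda>t. F (?l t)) has_derivative (\<lambda>h. dd (h *\<^sub>R a) F (?l 0))) (at 0)"
    by (rule has_derivative_dd_chain[OF l]) (simp add: assms)
  then have 1: "((\<lambda>t. F (?l t)) has_vector_derivative dd a F w) (at 0)"
    unfolding has_vector_derivative_def using linear_cmul[OF dd_linear[OF assms(1)]] by simp
  have "open (?l -` W)" by (rule open_vimage[OF assms(2)]) (intro continuous_intros)
  then have "\<forall>\<^sub>F t in nhds 0. t \<in> ?l -` W" using assms(3) eventually_nhds_in_open by fastforce
  then have 2: "\<forall>\<^sub>F t in nhds 0. F (?l t) \<in> N" by (rule eventually_mono) (use assms(4) in auto)
  show ?thesis unfolding tangent_space_def using 1 2
    by (intro CollectI exI[of _ "\<lambda>t. F (?l t)"]) auto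
qed

lemma vfields_differentiable: "X \<in> vfields N \<Longrightarrow> q \<in> N \<Longrightarrow> X differentiable (at q)"
  unfolding vfields_def using smooth_on_differentiable by blast

lemma vfields_tangent: "X \<in> vfields N \<Longrightarrow> q \<in> N \<Longrightarrow> X q \<in> tangent_space N q"
  unfolding vfields_def by blast

lemma deriv_along_vfields:
  assumes "X \<in> vfields N" "q \<in> N" "v \<in> tangent_space N q"
  shows "deriv_along N X q v = dd v X q"
  by (rule deriv_along_eqI[OF assms(3)
    has_derivative_at_withinI[OF dd_has_derivative[OF vfields_differentiable[OF assms(1,2)]]]])

lemma lie_bracket_eq:
  assumes "X \<in> vfields N" "Y \<in> vfields N" "q \<in> N"
  shows "lie_bracket N X Y q = dd (X q) Y q - dd (Y q) X q"
  unfolding lie_bracket_def using assms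
  by (simp add: deriv_along_vfields vfields_tangent)

text \<open>In the locale below \<open>A\<close> and \<open>\<Gamma>\<close> express the Levi-Civita connection through the ambient
  derivative: \<open>\<nabla>\<^sub>X Y = A (D\<^sub>X Y) + \<Gamma> (X, Y)\<close>.  The fields \<open>\<lambda>q. P q e\<close> extend a given
  tangent vector \<open>e\<close> to all of \<open>N\<close> and show that the definitions of \<open>levi_civita\<close> and
  \<open>cov_along\<close> are not vacuous.\<close>

locale connection =
  fixes N :: "'k::euclidean_space set" and G :: "'k metric"
    and P A :: "'k \<Rightarrow> 'k \<Rightarrow> 'k" and \<Gamma> :: "'k \<Rightarrow> 'k \<Rightarrow> 'k \<Rightarrow> 'k"
  assumes P_vfields: "\<And>e. (\<lambda>q. P q e) \<in> vfields N"
    and P_linear: "\<And>q. q \<in> N \<Longrightarrow> linear (P q)"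
    and P_tangent: "\<And>q e. q \<in> N \<Longrightarrow> e \<in> tangent_space N q \<Longrightarrow> P q e = e"
    and A_linear: "\<And>q. q \<in> N \<Longrightarrow> linear (A q)"
    and A_tangent: "\<And>q e. q \<in> N \<Longrightarrow> e \<in> tangent_space N q \<Longrightarrow> A q e = e"
    and \<Gamma>_linear: "\<And>q v. q \<in> N \<Longrightarrow> linear (\<Gamma> q v)"
    and nondegenerate: "\<And>q z z'. q \<in> N \<Longrightarrow> z \<in> tangent_space N q \<Longrightarrow> z' \<in> tangent_space N q \<Longrightarrow>
          (\<And>t. t \<in> tangent_space N q \<Longrightarrow> G q z t = G q z' t) \<Longrightarrow> z = z'"
    and connection_tangent: "\<And>X Y q. X \<in> vfields N \<Longrightarrow> Y \<in> vfields N \<Longrightarrow> q \<in> N \<Longrightarrow>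
          A q (dd (X q) Y q) + \<Gamma> q (X q) (Y q) \<in> tangent_space N q"
    and connection_koszul: "\<And>X Y Z q. X \<in> vfields N \<Longrightarrow> Y \<in> vfields N \<Longrightarrow> Z \<in> vfields N \<Longrightarrow> q \<in> N \<Longrightarrow>
          2 * G q (A q (dd (X q) Y q) + \<Gamma> q (X q) (Y q)) (Z q) = koszul N G X Y Z q"
begin

text \<open>The fields \<open>P q v\<close> and \<open>P q t\<close> realise any prescribed tangent
  vectors at \<open>q\<close>. Testing a competitor of the Koszul formula against them leaves no
  freedom, by \<open>nondegenerate\<close>.\<close>

lemma levi_civita_eq:
  assumes "q \<in> N" "v \<in> tangent_space N q" "Y \<in> vfields N"
  shows "levi_civita N G v Y q = A q (dd v Y q) + \<Gamma> q v (Y q)"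
  unfolding levi_civita_def
proof (rule the_equality)
  have Pv: "P q v = v" using P_tangent assms by blast
  show "A q (dd v Y q) + \<Gamma> q v (Y q) \<in> tangent_space N q \<and>
     (\<forall>X\<in>vfields N. X q = v \<longrightarrow> (\<forall>Z\<in>vfields N. 2 * G q (A q (dd v Y q) + \<Gamma> q v (Y q)) (Z q) = koszul N G X Y Z q))"
    using connection_tangent[OF P_vfields[of v] assms(3,1)] connection_koszul[OF _ assms(3) _ assms(1)] Pv
    by auto
  fix z
  assume z: "z \<in> tangent_space N q \<and>
     (\<forall>X\<in>vfields N. X q = v \<longrightarrow> (\<forall>Z\<in>vfields N. 2 * G q z (Z q) = koszul N G X Y Z q))"
  then have z': "2 * G q z (Z q) = koszul N G X Y Z q" if "X \<in> vfields N" "X q = v" "Z \<in> vfields N" for X Z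
    using that by blast
  show "z = A q (dd v Y q) + \<Gamma> q v (Y q)"
  proof (rule nondegenerate[OF assms(1)])
    show "A q (dd v Y q) + \<Gamma> q v (Y q) \<in> tangent_space N q"
      using connection_tangent[OF P_vfields[of v] assms(3,1)] Pv by simp
    fix t assume "t \<in> tangent_space N q"
    then have "P q t = t" using P_tangent assms by blast
    moreover have "2 * G q z (P q t) = koszul N G (\<lambda>q. P q v) Y (\<lambda>q. P q t) q"
      using z'[of "\<lambda>q. P q v" "\<lambda>q. P q t"] P_vfields Pv by simp
    moreover have "2 * G q (A q (dd v Y q) + \<Gamma> q v (Y q)) (P q t) = koszul N G (\<lambda>q. P q v) Y (\<lambda>q. P q t) q"
      using connection_koszul[OF P_vfields[of v] assms(3) P_vfields[of t] assms(1)] Pv by simp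
    ultimately show "G q z t = G q (A q (dd v Y q) + \<Gamma> q v (Y q)) t" by simp
  qed (use z in blast)
qed

text \<open>By the product rule every admissible decomposition of \<open>V\<close> gives the same
  value. One decomposition exists because \<open>P\<close> fixes tangent vectors. As the
  coefficients need only be differentiable at \<open>w\<close>, no smoothness of \<open>V\<close> is
  asked for.\<close>

lemma cov_along_eq:
  assumes "open W" "w \<in> W" "F differentiable (at w)" "V differentiable (at w)"
    and N: "\<And>w'. w' \<in> W \<Longrightarrow> F w' \<in> N" and T: "\<And>w'. w' \<in> W \<Longrightarrow> V w' \<in> tangent_space N (F w')"
  shows "cov_along N G W F V w a = A (F w) (dd a V w) + \<Gamma> (F w) (dd a F w) (V w)"
  unfolding cov_along_def
proof (rule the_equality)
  let ?z = "A (F w) (dd a V w) + \<Gamma> (F w) (dd a F w) (V w)"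
  have ta: "dd a F w \<in> tangent_space N (F w)"
    by (rule tangent_space_curve[OF assms(3,1,2) N])
  have Fw: "F w \<in> N" using N assms(2) by blast
  note Alin = A_linear[OF Fw] and Glin = \<Gamma>_linear[OF Fw, of "dd a F w"]
  have unique: "?z = (\<Sum>i<r. frechet_derivative (c i) (at w) a *\<^sub>R Y i (F w)
              + c i w *\<^sub>R levi_civita N G (frechet_derivative F (at w) a) (Y i) (F w))"
    if cY: "\<And>i. i < r \<Longrightarrow> Y i \<in> vfields N \<and> c i differentiable (at w)"
      and V: "\<And>w'. w' \<in> W \<Longrightarrow> V w' = (\<Sum>i<r. c i w' *\<^sub>R Y i (F w'))" for r :: nat and c Y
  proof -
    have "((\<lambda>w'. \<Sum>i<r. c i w' *\<^sub>R Y i (F w')) has_derivative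
       (\<lambda>a. \<Sum>i<r. c i w *\<^sub>R dd (dd a F w) (Y i) (F w) + dd a (c i) w *\<^sub>R Y i (F w))) (at w)"
      using cY vfields_differentiable[OF _ Fw]
      by (intro has_derivative_sum has_derivative_scaleR has_derivative_dd_chain
        dd_has_derivative assms) auto
    then have "(V has_derivative
       (\<lambda>a. \<Sum>i<r. c i w *\<^sub>R dd (dd a F w) (Y i) (F w) + dd a (c i) w *\<^sub>R Y i (F w))) (at w)"
      by (rule has_derivative_transform_within_open[OF _ assms(1,2)]) (simp add: V)
    then have dV: "dd a V w = (\<Sum>i<r. c i w *\<^sub>R dd (dd a F w) (Y i) (F w) + dd a (c i) w *\<^sub>R Y i (F w))"
      by (rule dd_eqI)
    have "A (F w) (dd a V w) = (\<Sum>i<r. A (F w) (c i w *\<^sub>R dd (dd a F w) (Y i) (F w) + dd a (c i) w *\<^sub>R Y i (F w)))"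
      unfolding dV by (rule linear_sum[OF Alin])
    \<comment> \<open>\<open>A\<close> fixes the tangent vectors \<open>Y i (F w)\<close>, so the
      terms with differentiated coefficients pass unchanged.\<close>
    also have "\<dots> = (\<Sum>i<r. c i w *\<^sub>R A (F w) (dd (dd a F w) (Y i) (F w)) + dd a (c i) w *\<^sub>R Y i (F w))"
      using A_tangent[OF Fw vfields_tangent[OF _ Fw]] cY
      by (intro sum.cong refl) (simp add: linear_add[OF Alin] linear_cmul[OF Alin])
    finally have 1: "A (F w) (dd a V w) = \<dots>" .
    have 2: "\<Gamma> (F w) (dd a F w) (V w) = (\<Sum>i<r. c i w *\<^sub>R \<Gamma> (F w) (dd a F w) (Y i (F w)))"
      unfolding V[OF assms(2)] linear_sum[OF Glin] linear_cmul[OF Glin] ..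
    have "levi_civita N G (dd a F w) (Y i) (F w) = A (F w) (dd (dd a F w) (Y i) (F w)) + \<Gamma> (F w) (dd a F w) (Y i (F w))"
      if "i < r" for i
      by (rule levi_civita_eq[OF Fw ta]) (use cY that in blast)
    then show ?thesis
      unfolding 1 2 dd_def[symmetric] sum.distrib[symmetric]
      by (intro sum.cong refl) (simp add: scaleR_add_right)
  qed
  \<comment> \<open>\<open>V w'\<close> equals \<open>P (F w') (V w')\<close>; expanding the
    argument in the standard basis yields coefficients \<open>V w' \<bullet> b i\<close> and the
    global fields \<open>\<lambda>q. P q (b i)\<close>.\<close>
  obtain b :: "nat \<Rightarrow> 'k" where b: "bij_betw b {..<DIM('k)} Basis"
    using ex_bij_betw_nat_finite[of "Basis :: 'k set"] by (auto simp: atLeast0LessThan)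
  let ?c = "\<lambda>i w'. V w' \<bullet> b i" and ?Y = "\<lambda>i q. P q (b i)"
  have V: "V w' = (\<Sum>i<DIM('k). ?c i w' *\<^sub>R ?Y i (F w'))" if "w' \<in> W" for w'
  proof -
    have Pl: "linear (P (F w'))" using P_linear N that by blast
    have "V w' = P (F w') (V w')" using P_tangent N T that by simp
    also have "\<dots> = P (F w') (\<Sum>i\<in>Basis. (V w' \<bullet> i) *\<^sub>R i)" by (simp add: euclidean_representation)
    also have "\<dots> = (\<Sum>i\<in>Basis. (V w' \<bullet> i) *\<^sub>R P (F w') i)"
      by (simp add: linear_sum[OF Pl] linear_cmul[OF Pl])
    also have "\<dots> = (\<Sum>i<DIM('k). ?c i w' *\<^sub>R ?Y i (F w'))"
      by (rule sum.reindex_bij_betw[OF b, symmetric])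
    finally show ?thesis .
  qed
  have cY: "?Y i \<in> vfields N \<and> ?c i differentiable (at w)" for i
    using P_vfields assms(4) by (auto intro!: differentiable_inner)
  show "\<exists>(r::nat) c Y. (\<forall>i<r. Y i \<in> vfields N \<and> c i differentiable (at w)) \<and>
     (\<forall>w'\<in>W. V w' = (\<Sum>i<r. c i w' *\<^sub>R Y i (F w'))) \<and>
     ?z = (\<Sum>i<r. frechet_derivative (c i) (at w) a *\<^sub>R Y i (F w)
              + c i w *\<^sub>R levi_civita N G (frechet_derivative F (at w) a) (Y i) (F w))"
  proof (intro exI[of _ "DIM('k)"] exI[of _ ?c] exI[of _ ?Y] conjI)
    show "\<forall>i<DIM('k). ?Y i \<in> vfields N \<and> ?c i differentiable (at w)" using cY by blast
    show "\<forall>w'\<in>W. V w' = (\<Sum>i<DIM('k). ?c i w' *\<^sub>R ?Y i (F w'))" using V by blast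
    show "?z = (\<Sum>i<DIM('k). frechet_derivative (?c i) (at w) a *\<^sub>R ?Y i (F w)
              + ?c i w *\<^sub>R levi_civita N G (frechet_derivative F (at w) a) (?Y i) (F w))"
      by (rule unique) (rule cY, rule V)
  qed
  show "z = ?z" if z: "\<exists>(r::nat) c Y. (\<forall>i<r. Y i \<in> vfields N \<and> c i differentiable (at w)) \<and>
     (\<forall>w'\<in>W. V w' = (\<Sum>i<r. c i w' *\<^sub>R Y i (F w'))) \<and>
     z = (\<Sum>i<r. frechet_derivative (c i) (at w) a *\<^sub>R Y i (F w)
              + c i w *\<^sub>R levi_civita N G (frechet_derivative F (at w) a) (Y i) (F w))" for z
  proof -
    obtain r :: nat and c Y where "\<forall>i<r. Y i \<in> vfields N \<and> c i differentiable (at w)"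
      "\<forall>w'\<in>W. V w' = (\<Sum>i<r. c i w' *\<^sub>R Y i (F w'))"
      "z = (\<Sum>i<r. frechet_derivative (c i) (at w) a *\<^sub>R Y i (F w)
              + c i w *\<^sub>R levi_civita N G (frechet_derivative F (at w) a) (Y i) (F w))"
      using z by blast
    with unique[of r Y c] show ?thesis by simp
  qed
qed

end

section \<open>The matrix exponential and the isotropy representation\<close>

declare transpose_matrix_vector [simp del]

text \<open>The orbit of \<open>a\<close> under the one-parameter group generated by
  \<open>L\<close>. Taking \<open>L\<close> to be left multiplication by \<open>X\<close> and
  \<open>a\<close> the identity gives \<open>mat_exp (t *\<^sub>R X)\<close>.\<close>

definition lin_exp :: "('k::euclidean_space \<Rightarrow> 'k) \<Rightarrow> 'k \<Rightarrow> real \<Rightarrow> 'k" where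
  "lin_exp L a t = (\<Sum>k. (t ^ k / fact k) *\<^sub>R (L ^^ k) a)"

lemma lin_exp_summable:
  fixes L :: "'k::euclidean_space \<Rightarrow> 'k"
  assumes "linear L"
  shows "summable (\<lambda>k. (t ^ k / fact k) *\<^sub>R (L ^^ k) a)"
proof (rule summable_comparison_test')
  have bl: "bounded_linear L" using assms by (simp add: linear_conv_bounded_linear)
  have bound: "norm ((L ^^ k) a) \<le> onorm L ^ k * norm a" for k
  proof (induction k)
    case (Suc k)
    have "norm ((L ^^ Suc k) a) \<le> onorm L * norm ((L ^^ k) a)"
      using onorm[OF bl] by simp
    also have "\<dots> \<le> onorm L * (onorm L ^ k * norm a)"
      by (intro mult_left_mono Suc onorm_pos_le[OF bl])
    finally show ?case by simp
  qed simp
  show "norm ((t ^ k / fact k) *\<^sub>R (L ^^ k) a) \<le> inverse (fact k) * (\<bar>t\<bar> * onorm L) ^ k * norm a"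
    if "k \<ge> 0" for k
  proof -
    have "norm ((t ^ k / fact k) *\<^sub>R (L ^^ k) a) \<le> (\<bar>t\<bar> ^ k / fact k) * (onorm L ^ k * norm a)"
      unfolding norm_scaleR by (intro mult_mono bound) (auto simp: power_abs)
    then show ?thesis by (simp add: power_mult_distrib field_simps)
  qed
  show "summable (\<lambda>k. inverse (fact k) * (\<bar>t\<bar> * onorm L) ^ k * norm a)"
    by (intro summable_mult2 summable_exp)
qed

text \<open>Each coordinate is an everywhere convergent real power series. Termwise differentiation
  shifts the index by one, which amounts to one application of \<open>L\<close>.\<close>

lemma lin_exp_has_vector_derivative:
  fixes L :: "'k::euclidean_space \<Rightarrow> 'k"
  assumes "linear L"
  shows "(lin_exp L a has_vector_derivative L (lin_exp L a t)) (at t)"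
  unfolding has_vector_derivative_def has_derivative_componentwise_within[where f="lin_exp L a"]
proof
  fix i :: 'k
  have bl: "bounded_linear L" using assms by (simp add: linear_conv_bounded_linear)
  define c where "c k = ((L ^^ k) a \<bullet> i) / fact k" for k
  have coord: "(\<lambda>k. c k * t ^ k) sums (lin_exp L a t \<bullet> i)" for t
    using bounded_linear.sums[OF bounded_linear_inner_left
        summable_sums[OF lin_exp_summable[OF assms, of t a]], of i]
    unfolding lin_exp_def c_def by (simp add: field_simps)
  have "bounded_linear (\<lambda>x. L x \<bullet> i)"
    by (intro bounded_linear_inner_left_comp bl)
  have "(\<lambda>k. (L ((L ^^ k) a) \<bullet> i) / fact k * t ^ k) sums (L (lin_exp L a t) \<bullet> i)"
    using bounded_linear.sums[OF \<open>bounded_linear (\<lambda>x. L x \<bullet> i)\<close> summable_sums[OF lin_exp_summable[OF assms, of t a]]]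
    unfolding lin_exp_def by (simp add: linear_cmul[OF assms] mult.commute)
  moreover have "diffs c k = (L ((L ^^ k) a) \<bullet> i) / fact k" for k
    by (simp add: diffs_def c_def del: of_nat_Suc)
  ultimately have "(\<lambda>k. diffs c k * t ^ k) sums (L (lin_exp L a t) \<bullet> i)"
    by simp
  moreover have "((\<lambda>t. \<Sum>k. c k * t ^ k) has_field_derivative (\<Sum>k. diffs c k * t ^ k)) (at t)"
    by (rule termdiffs_strong_converges_everywhere) (use coord sums_summable in blast)
  ultimately have "((\<lambda>t. lin_exp L a t \<bullet> i) has_field_derivative (L (lin_exp L a t) \<bullet> i)) (at t)"
    by (simp add: sums_unique[OF coord, symmetric] sums_iff)
  then show "((\<lambda>x. lin_exp L a x \<bullet> i) has_derivative (\<lambda>x. x *\<^sub>R L (lin_exp L a t) \<bullet> i)) (at t)"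
    unfolding has_field_derivative_def by (simp add: mult_commute_abs)
qed

lemma lin_exp_0: "lin_exp L a 0 = a"
proof -
  have "lin_exp L a 0 = (\<Sum>k\<in>{0}. (0 ^ k / fact k) *\<^sub>R (L ^^ k) a)"
    unfolding lin_exp_def by (rule suminf_finite) auto
  then show ?thesis by simp
qed

lemma linear_matrix_mult: "linear ((**) (X :: 'n::finite rmat))"
  by (rule linearI) (simp_all add: matrix_add_ldistrib matrix_scalar_ac scalar_matrix_assoc)

lemma mat_exp_eq: "mat_exp (t *\<^sub>R X) = lin_exp ((**) X) (mat 1) t"
proof -
  have "((**) (t *\<^sub>R X) ^^ k) (mat 1) = t ^ k *\<^sub>R ((**) X ^^ k) (mat 1)" for k
    by (induction k) (simp_all add: scalar_matrix_assoc matrix_scalar_ac mult.commute)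
  then show ?thesis unfolding mat_exp_def lin_exp_def by simp
qed

lemma bounded_linear_matrix_apply: "bounded_linear (\<lambda>M :: 'n::finite rmat. M *v y)"
  unfolding linear_conv_bounded_linear[symmetric]
  by (rule linearI) (simp_all add: matrix_vector_mult_add_rdistrib scaleR_matrix_vector_assoc)

lemma mat_exp_apply_derivative:
  "((\<lambda>t. mat_exp (t *\<^sub>R X) *v y) has_vector_derivative X *v (mat_exp (t *\<^sub>R X) *v y)) (at t)"
  using bounded_linear.has_vector_derivative[OF bounded_linear_matrix_apply
      lin_exp_has_vector_derivative[OF linear_matrix_mult]]
  unfolding mat_exp_eq by (simp add: matrix_vector_mul_assoc)

lemma mat_exp_0: "mat_exp 0 = mat 1"
  using mat_exp_eq[of 0 0] by (simp add: lin_exp_0)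

section \<open>Skew matrices and their exponentials\<close>

lemma so_algebra_inner: "X \<in> so_algebra \<Longrightarrow> (X *v x) \<bullet> y = - (x \<bullet> (X *v y))"
proof -
  assume "X \<in> so_algebra"
  then have "transpose X = - X" unfolding so_algebra_def by simp
  moreover have "(X *v x) \<bullet> y = (transpose X *v y) \<bullet> x"
    by (metis transpose_matrix_vector dot_lmul_matrix inner_commute)
  moreover have "(- X) *v y = - (X *v y)"
    by (simp add: matrix_vector_mult_def vec_eq_iff sum_negf)
  ultimately show ?thesis by (simp add: inner_commute)
qed

lemma so_algebraI:
  fixes X :: "'n::finite rmat"
  assumes "\<And>x y. (X *v x) \<bullet> y = - (x \<bullet> (X *v y))"
  shows "X \<in> so_algebra"
proof -
  have "transpose X $ i $ j = (- X) $ i $ j" for i j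
    using assms[of "axis i 1" "axis j 1"]
    by (simp add: matrix_vector_mult_basis inner_axis column_def inner_axis' transpose_def)
  then have "transpose X = - X" unfolding vec_eq_iff by blast
  then show ?thesis by (simp add: so_algebra_def)
qed

lemma mat_exp_inner:
  assumes "X \<in> so_algebra"
  shows "(mat_exp (t *\<^sub>R X) *v x) \<bullet> (mat_exp (t *\<^sub>R X) *v y) = x \<bullet> y"
proof -
  let ?g = "\<lambda>t. (mat_exp (t *\<^sub>R X) *v x) \<bullet> (mat_exp (t *\<^sub>R X) *v y)"
  have "(?g has_vector_derivative 0) (at t within UNIV)" for t
    using bounded_bilinear.has_vector_derivative[OF bounded_bilinear_inner
        mat_exp_apply_derivative[of X x t] mat_exp_apply_derivative[of X y t]]
    by (simp add: so_algebra_inner[OF assms])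
  then obtain c where "\<And>t. ?g t = c"
    using has_vector_derivative_zero_constant[of UNIV ?g] by (metis UNIV_I convex_UNIV)
  moreover have "?g 0 = x \<bullet> y" by (simp add: mat_exp_0)
  ultimately show ?thesis by metis
qed

lemma orthogonal_matrixI:
  fixes E :: "'n::finite rmat"
  assumes "\<And>x y. (E *v x) \<bullet> (E *v y) = x \<bullet> y"
  shows "orthogonal_matrix E"
proof -
  have "orthogonal_transformation ((*v) E)"
    using assms by (simp add: orthogonal_transformation_def)
  then show ?thesis unfolding orthogonal_transformation_matrix by simp
qed

text \<open>Orthogonality confines the determinant to 1 and -1; being continuous in \<open>t\<close>
  it is constant, and it is 1 at \<open>t = 0\<close>.\<close>

lemma mat_exp_SO:
  assumes "X \<in> so_algebra"
  shows "mat_exp (t *\<^sub>R X) \<in> (SO_group :: 'n::finite rmat set)"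
proof -
  have orth: "orthogonal_matrix (mat_exp (t *\<^sub>R X))" for t
    by (rule orthogonal_matrixI) (rule mat_exp_inner[OF assms])
  let ?d = "\<lambda>t. det (mat_exp (t *\<^sub>R X))"
  have "continuous_on UNIV (\<lambda>t. mat_exp (t *\<^sub>R X))"
    unfolding mat_exp_eq
    by (intro continuous_at_imp_continuous_on ballI
      has_vector_derivative_continuous[OF lin_exp_has_vector_derivative[OF linear_matrix_mult]])
  then have "continuous_on UNIV ?d"
    unfolding det_def by (intro continuous_intros)
  moreover have fin: "?d ` UNIV \<subseteq> {1, -1}"
    using det_orthogonal_matrix[OF orth] by auto
  then have "finite (?d ` UNIV)" using finite_subset by blast
  ultimately have "?d constant_on UNIV"
    by (intro continuous_finite_range_constant connected_UNIV)
  then have "?d t = ?d 0" unfolding constant_on_def by (metis UNIV_I)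
  then have "?d t = 1" by (simp add: mat_exp_0)
  with orth show ?thesis by (simp add: SO_group_def rotation_matrix_def)
qed

lemma mat_exp_apply_kernel:
  assumes "X *v e = 0"
  shows "mat_exp (t *\<^sub>R X) *v e = (e :: 'n::finite rvec)"
proof -
  have funpow: "((**) X ^^ k) (mat 1) *v e = ((*v) X ^^ k) e" for k
    by (induction k) (simp_all add: matrix_vector_mul_assoc[symmetric])
  have zero: "((*v) X ^^ Suc k) e = 0" for k
    by (induction k) (simp_all add: assms)
  have "(\<lambda>k. ((t ^ k / fact k) *\<^sub>R ((**) X ^^ k) (mat 1)) *v e) sums (mat_exp (t *\<^sub>R X) *v e)"
    unfolding mat_exp_eq lin_exp_def
    by (intro bounded_linear.sums[OF bounded_linear_matrix_apply] summable_sums lin_exp_summable linear_matrix_mult)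
  then have "(\<lambda>k. (t ^ k / fact k) *\<^sub>R ((*v) X ^^ k) e) sums (mat_exp (t *\<^sub>R X) *v e)"
    by (simp add: scaleR_matrix_vector_assoc[symmetric] funpow)
  moreover have "(\<lambda>k. (t ^ k / fact k) *\<^sub>R ((*v) X ^^ k) e) sums (\<Sum>k\<in>{0}. (t ^ k / fact k) *\<^sub>R ((*v) X ^^ k) e)"
  proof (rule sums_finite)
    show "(t ^ k / fact k) *\<^sub>R ((*v) X ^^ k) e = 0" if "k \<notin> {0}" for k
      using that zero by (cases k) auto
  qed simp
  ultimately show ?thesis using sums_unique2 by fastforce
qed

text \<open>The skew rank-two building block of \<open>nu0\<close> and of \<open>beta_mat\<close>:
  conjugation by a rotation acts on both vectors, and pairing with it reads off a matrix
  coefficient.\<close>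

definition wedge :: "'n::finite rvec \<Rightarrow> 'n rvec \<Rightarrow> 'n rmat" where
  "wedge a b = (\<chi> i j. a $ i * b $ j - b $ i * a $ j)"

lemma wedge_apply: "wedge a b *v y = (b \<bullet> y) *\<^sub>R a - (a \<bullet> y) *\<^sub>R b"
  by (simp add: wedge_def vec_eq_iff matrix_vector_mult_def inner_vec_def sum_distrib_left
      left_diff_distrib right_diff_distrib sum_subtractf mult_ac)

lemma wedge_so: "wedge a b \<in> so_algebra"
  by (simp add: so_algebra_def transpose_def wedge_def vec_eq_iff)

lemma so_algebra_add: "X \<in> so_algebra \<Longrightarrow> Y \<in> so_algebra \<Longrightarrow> X + Y \<in> so_algebra"
  by (rule so_algebraI) (simp add: matrix_vector_mult_add_rdistrib inner_add so_algebra_inner)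

lemma so_inner_wedge:
  assumes "X \<in> so_algebra"
  shows "so_inner X (wedge c d) = c \<bullet> (X *v d)"
proof -
  have "trace (X ** wedge c d) = (\<Sum>i\<in>UNIV. \<Sum>k\<in>UNIV. X$i$k * (c$k * d$i - d$k * c$i))"
    by (simp add: trace_def matrix_matrix_mult_def wedge_def)
  also have "\<dots> = d \<bullet> (X *v c) - c \<bullet> (X *v d)"
    by (simp add: inner_vec_def matrix_vector_mult_def sum_distrib_left sum_subtractf right_diff_distrib mult_ac)
  also have "d \<bullet> (X *v c) = - (c \<bullet> (X *v d))"
    using so_algebra_inner[OF assms, of c d] by (simp add: inner_commute)
  finally show ?thesis by (simp add: so_inner_def)
qed

lemma so_inner_add_right: "so_inner X (Y + Z) = so_inner X Y + so_inner X Z"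
  by (simp add: so_inner_def matrix_add_ldistrib trace_add field_simps)

lemma SO_groupD:
  assumes "a \<in> SO_group"
  shows "transpose a ** a = mat 1" "a ** transpose a = mat 1"
    "(a *v x) \<bullet> (a *v y) = x \<bullet> y" "transpose a *v (a *v x) = x" "a *v (transpose a *v x) = x"
    "matrix_inv a = transpose a"
proof -
  show 1: "transpose a ** a = mat 1" and 2: "a ** transpose a = mat 1"
    using assms by (auto simp: SO_group_def rotation_matrix_def orthogonal_matrix_def)
  show 3: "transpose a *v (a *v x) = x" for x
    by (simp add: matrix_vector_mul_assoc 1)
  show "a *v (transpose a *v x) = x"
    by (simp add: matrix_vector_mul_assoc 2)
  have "(a *v x) \<bullet> (a *v y) = (transpose a *v (a *v x)) \<bullet> y"
    by (simp add: transpose_matrix_vector dot_lmul_matrix)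
  then show "(a *v x) \<bullet> (a *v y) = x \<bullet> y" by (simp add: 3)
  have "a ** matrix_inv a = mat 1 \<and> matrix_inv a ** a = mat 1"
    unfolding matrix_inv_def by (rule someI[of _ "transpose a"]) (simp add: 1 2)
  then show "matrix_inv a = transpose a"
    using 1 by (metis matrix_mul_assoc matrix_mul_lid matrix_mul_rid)
qed

lemma SO_transpose: "a \<in> SO_group \<Longrightarrow> transpose a \<in> SO_group"
  by (simp add: SO_group_def rotation_matrix_def)

lemma transpose_inner: "(transpose a *v x) \<bullet> y = x \<bullet> ((a :: 'n::finite rmat) *v y)"
  by (simp add: transpose_matrix_vector dot_lmul_matrix)

lemma inner_transpose: "x \<bullet> (transpose a *v y) = ((a :: 'n::finite rmat) *v x) \<bullet> y"
  by (metis transpose_inner inner_commute)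

lemma Ad_apply: "a \<in> SO_group \<Longrightarrow> Ad a X *v y = a *v (X *v (transpose a *v y))"
  by (simp add: Ad_def SO_groupD(6) matrix_vector_mul_assoc[symmetric])

lemma Ad_wedge: "a \<in> SO_group \<Longrightarrow> Ad a (wedge x y) = wedge (a *v x) (a *v y)"
  unfolding matrix_eq
  by (simp add: Ad_apply wedge_apply matrix_vector_mult_diff_distrib matrix_vector_mult_scaleR
      inner_transpose)

lemma Ad_so:
  assumes "a \<in> SO_group" "X \<in> so_algebra"
  shows "Ad a X \<in> so_algebra"
proof (rule so_algebraI)
  fix x y
  have "(Ad a X *v x) \<bullet> y = (X *v (transpose a *v x)) \<bullet> (transpose a *v y)"
    by (simp add: Ad_apply assms inner_transpose)
  also have "\<dots> = - ((transpose a *v x) \<bullet> (X *v (transpose a *v y)))"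
    by (rule so_algebra_inner[OF assms(2)])
  also have "\<dots> = - (x \<bullet> (Ad a X *v y))" by (simp add: Ad_apply assms transpose_inner)
  finally show "(Ad a X *v x) \<bullet> y = - (x \<bullet> (Ad a X *v y))" .
qed

section \<open>The isotropy algebra of the base vector and its orthogonal complement\<close>

definition second_pt :: "'n::{finite,linorder} rvec" where
  "second_pt = axis prev_ix 1"

lemma prev_neq_last:
  assumes "CARD('n::{finite,linorder}) \<ge> 2"
  shows "(prev_ix :: 'n) \<noteq> last_ix"
proof -
  have "UNIV - {last_ix :: 'n} \<noteq> {}"
  proof
    assume "UNIV - {last_ix :: 'n} = {}"
    then have "(UNIV :: 'n set) \<subseteq> {last_ix}" by auto
    from card_mono[OF _ this] assms show False by simp
  qed
  then have "Max (UNIV - {last_ix :: 'n}) \<in> UNIV - {last_ix}" by (intro Max_in) auto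
  then show ?thesis unfolding prev_ix_def by auto
qed

lemma nu0_eq:
  assumes "CARD('n::{finite,linorder}) \<ge> 2"
  shows "(nu0 :: 'n rmat) = wedge second_pt base_pt"
  using prev_neq_last[OF assms]
  by (auto simp: nu0_def wedge_def second_pt_def base_pt_def vec_eq_iff axis_def)

lemma base_orthonormal:
  assumes "CARD('n::{finite,linorder}) \<ge> 2"
  shows "base_pt \<bullet> (base_pt :: 'n rvec) = 1" "second_pt \<bullet> (second_pt :: 'n rvec) = 1"
    "base_pt \<bullet> (second_pt :: 'n rvec) = 0" "second_pt \<bullet> (base_pt :: 'n rvec) = 0"
  using prev_neq_last[OF assms] by (simp_all add: base_pt_def second_pt_def inner_axis_axis)

lemma base_vec_eq:
  assumes "CARD('n::{finite,linorder}) \<ge> 2"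
  shows "(base_vec :: 'n rvec \<times> 'n rvec) = (base_pt, second_pt)"
proof -
  have "((\<lambda>t. mat_exp (t *\<^sub>R nu0) *v base_pt) has_vector_derivative nu0 *v (base_pt :: 'n rvec)) (at 0)"
    using mat_exp_apply_derivative[of nu0 base_pt 0] by (simp add: mat_exp_0)
  then show ?thesis
    unfolding base_vec_def
    by (simp add: vector_derivative_at nu0_eq[OF assms] wedge_apply base_orthonormal[OF assms])
qed

text \<open>Since \<open>nu0\<close> is the wedge of the two base vectors, an element of
  \<open>K_group\<close> fixing \<open>nu0\<close> also fixes \<open>second_pt\<close>.
  Differentiating the constant orbits at 0 gives the two equations; conversely the exponential
  series of \<open>X\<close> fixes the kernel of \<open>X\<close>.\<close>

lemma h_algebra_eq:
  assumes c: "CARD('n::{finite,linorder}) \<ge> 2"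
  shows "(h_algebra :: 'n rmat set) = {X \<in> so_algebra. X *v base_pt = 0 \<and> X *v second_pt = 0}"
proof (intro equalityI subsetI)
  fix X :: "'n rmat" assume "X \<in> h_algebra"
  then have X: "X \<in> so_algebra" and H: "\<And>t. mat_exp (t *\<^sub>R X) \<in> H_group"
    unfolding h_algebra_def by auto
  let ?E = "\<lambda>t. mat_exp (t *\<^sub>R X)"
  have b: "?E t *v base_pt = base_pt" and S: "?E t \<in> SO_group" and A: "Ad (?E t) nu0 = nu0" for t
    using H[of t] unfolding H_group_def K_group_def by auto
  have s: "?E t *v second_pt = second_pt" for t
  proof -
    have w: "wedge (?E t *v second_pt) base_pt = wedge second_pt base_pt"
      using A[of t] b[of t] by (simp add: nu0_eq[OF c] Ad_wedge[OF S])
    have "(?E t *v second_pt) \<bullet> base_pt = 0"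
      using SO_groupD(3)[OF S, of t second_pt base_pt] b[of t] base_orthonormal[OF c] by simp
    then show ?thesis
      using arg_cong[OF w, of "\<lambda>M. M *v base_pt"] by (simp add: wedge_apply base_orthonormal[OF c])
  qed
  have "X *v e = 0" if "\<And>t. ?E t *v e = e" for e
  proof -
    have "((\<lambda>t. ?E t *v e) has_vector_derivative X *v (?E 0 *v e)) (at 0)"
      by (rule mat_exp_apply_derivative)
    then have "((\<lambda>t::real. e) has_vector_derivative X *v e) (at 0)" unfolding that .
    then show ?thesis using has_vector_derivative_const vector_derivative_unique_at by blast
  qed
  with b s X show "X \<in> {X \<in> so_algebra. X *v base_pt = 0 \<and> X *v second_pt = 0}" by blast
next
  fix X :: "'n rmat" assume "X \<in> {X \<in> so_algebra. X *v base_pt = 0 \<and> X *v second_pt = 0}"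
  then have X: "X \<in> so_algebra" "X *v base_pt = 0" "X *v second_pt = 0" by auto
  have "mat_exp (t *\<^sub>R X) \<in> H_group" for t
    using mat_exp_SO[OF X(1), of t] mat_exp_apply_kernel[OF X(2)] mat_exp_apply_kernel[OF X(3)]
    unfolding H_group_def K_group_def by (simp add: nu0_eq[OF c] Ad_wedge)
  with X show "X \<in> h_algebra" unfolding h_algebra_def by blast
qed

text \<open>The translate of \<open>p_space\<close> to the orthonormal pair \<open>(p, v)\<close>:
  skew matrices whose block on the orthogonal complement of \<open>p\<close> and \<open>v\<close>
  vanishes.\<close>

definition perp_flat :: "'n::finite rvec \<Rightarrow> 'n rvec \<Rightarrow> 'n rmat set" where
  "perp_flat p v = {X \<in> so_algebra. \<forall>x y. x \<bullet> p = 0 \<and> x \<bullet> v = 0 \<and> y \<bullet> p = 0 \<and> y \<bullet> v = 0 \<longrightarrow> x \<bullet> (X *v y) = 0}"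

lemma trace_eq_sum: "trace (X :: 'n::finite rmat) = (\<Sum>k\<in>UNIV. axis k 1 \<bullet> (X *v axis k 1))"
  by (simp add: trace_def matrix_vector_mult_basis inner_axis' column_def)

text \<open>One inclusion tests against \<open>wedge x y\<close> with \<open>x\<close>,
  \<open>y\<close> orthogonal to the base vectors, which lies in \<open>h_algebra\<close>. For the
  other the trace is taken in the standard basis: \<open>Y\<close> kills the two base axes and maps
  the remaining ones into their own span, where \<open>X\<close> has zero block.\<close>

lemma p_space_eq:
  assumes c: "CARD('n::{finite,linorder}) \<ge> 2"
  shows "(p_space :: 'n rmat set) = perp_flat base_pt second_pt"
proof (intro equalityI subsetI)
  fix X :: "'n rmat" assume "X \<in> p_space"
  then have X: "X \<in> so_algebra" "\<And>Y. Y \<in> h_algebra \<Longrightarrow> so_inner X Y = 0" unfolding p_space_def by auto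
  have "x \<bullet> (X *v y) = 0" if "x \<bullet> base_pt = 0" "x \<bullet> second_pt = 0" "y \<bullet> base_pt = 0" "y \<bullet> second_pt = 0" for x y
    using X(2)[of "wedge x y"] that by (simp add: h_algebra_eq[OF c] wedge_so wedge_apply so_inner_wedge X)
  with X show "X \<in> perp_flat base_pt second_pt" unfolding perp_flat_def by blast
next
  fix X :: "'n rmat" assume X: "X \<in> perp_flat base_pt second_pt"
  have "so_inner X Y = 0" if "Y \<in> h_algebra" for Y
  proof -
    have Y: "Y \<in> so_algebra" "Y *v base_pt = 0" "Y *v second_pt = 0" using that by (auto simp: h_algebra_eq[OF c])
    have "axis k 1 \<bullet> (X *v (Y *v axis k 1)) = 0" for k
    proof (cases "k = last_ix \<or> k = prev_ix")
      case True
      then have "Y *v axis k 1 = 0" using Y by (auto simp: base_pt_def second_pt_def)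
      then show ?thesis by simp
    next
      case False
      then have k: "axis k 1 \<bullet> (base_pt :: 'n rvec) = 0" "axis k 1 \<bullet> (second_pt :: 'n rvec) = 0"
        by (auto simp: base_pt_def second_pt_def inner_axis_axis)
      have "(Y *v axis k 1) \<bullet> base_pt = 0" "(Y *v axis k 1) \<bullet> second_pt = 0"
        using Y by (simp_all add: so_algebra_inner)
      with k X show ?thesis unfolding perp_flat_def by blast
    qed
    then have "trace (X ** Y) = 0"
      unfolding trace_eq_sum by (simp add: matrix_vector_mul_assoc[symmetric])
    then show ?thesis by (simp add: so_inner_def)
  qed
  with X show "X \<in> p_space" unfolding p_space_def perp_flat_def by blast
qed

lemma Ad_perp_flat:
  assumes a: "a \<in> SO_group" and X: "X \<in> perp_flat p v"
  shows "Ad a X \<in> perp_flat (a *v p) (a *v v)"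
proof -
  have X: "X \<in> so_algebra" "\<And>x y. x \<bullet> p = 0 \<Longrightarrow> x \<bullet> v = 0 \<Longrightarrow> y \<bullet> p = 0 \<Longrightarrow> y \<bullet> v = 0 \<Longrightarrow> x \<bullet> (X *v y) = 0"
    using X unfolding perp_flat_def by auto
  have "x \<bullet> (Ad a X *v y) = 0"
    if "x \<bullet> (a *v p) = 0" "x \<bullet> (a *v v) = 0" "y \<bullet> (a *v p) = 0" "y \<bullet> (a *v v) = 0" for x y
    using X(2)[of "transpose a *v x" "transpose a *v y"] that by (simp add: Ad_apply a transpose_inner)
  then show ?thesis using Ad_so[OF a X(1)] unfolding perp_flat_def by blast
qed

lemma Ad_image_perp_flat:
  assumes a: "a \<in> SO_group"
  shows "Ad a ` perp_flat p v = perp_flat (a *v p) (a *v v)"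
proof (intro equalityI subsetI)
  fix X assume X: "X \<in> perp_flat (a *v p) (a *v v)"
  note at = SO_transpose[OF a]
  have "Ad (transpose a) X \<in> perp_flat p v"
    using Ad_perp_flat[OF at X] by (simp add: SO_groupD(4)[OF a])
  moreover have "X = Ad a (Ad (transpose a) X)"
    unfolding matrix_eq by (simp add: Ad_apply a at SO_groupD(5)[OF a])
  ultimately show "X \<in> Ad a ` perp_flat p v" by blast
qed (use Ad_perp_flat[OF a] in blast)

section \<open>The unit tangent bundle as a homogeneous space\<close>

text \<open>For \<open>c = 0\<close> the quotient is 0 and the map is the identity, which covers
  points that do not have to be moved.\<close>

definition hyperplane_reflection :: "'k::euclidean_space \<Rightarrow> 'k \<Rightarrow> 'k" where
  "hyperplane_reflection c y = y - (2 * (c \<bullet> y) / (c \<bullet> c)) *\<^sub>R c"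

lemma hyperplane_reflection_orthogonal: "orthogonal_transformation (hyperplane_reflection c)"
  unfolding orthogonal_transformation_def
proof
  show "linear (hyperplane_reflection c)"
    by (rule linearI) (simp_all add: hyperplane_reflection_def inner_simps algebra_simps add_divide_distrib)
  show "\<forall>x y. hyperplane_reflection c x \<bullet> hyperplane_reflection c y = x \<bullet> y"
    by (cases "c = 0") (auto simp: hyperplane_reflection_def inner_simps inner_commute field_simps)
qed

lemma hyperplane_reflection_swap:
  assumes "x \<bullet> x = y \<bullet> y"
  shows "hyperplane_reflection (x - y) x = y"
proof (cases "x = y")
  case False
  have "2 * ((x - y) \<bullet> x) = (x - y) \<bullet> (x - y)"
    using assms by (simp add: inner_simps inner_commute)
  moreover have "(x - y) \<bullet> (x - y) \<noteq> 0" using False by simp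
  ultimately show ?thesis by (simp add: hyperplane_reflection_def)
qed (simp add: hyperplane_reflection_def)

lemma hyperplane_reflection_fix: "c \<bullet> z = 0 \<Longrightarrow> hyperplane_reflection c z = z"
  by (simp add: hyperplane_reflection_def)

text \<open>A first reflection moves \<open>base_pt\<close> to \<open>p\<close>. A second one moves
  the image of \<open>second_pt\<close> to \<open>v\<close>; it fixes \<open>p\<close> because both
  of these vectors are orthogonal to \<open>p\<close>. Only the sign of the determinant may remain
  to be corrected.\<close>

lemma SO_transitive:
  fixes p v :: "'n::{finite,linorder} rvec"
  assumes c: "CARD('n) \<ge> 3" and pv: "p \<bullet> p = 1" "v \<bullet> v = 1" "p \<bullet> v = 0"
  shows "\<exists>a\<in>SO_group. a *v base_pt = p \<and> a *v second_pt = v"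
proof -
  have c2: "CARD('n) \<ge> 2" using c by simp
  note bo = base_orthonormal[OF c2]
  let ?r1 = "hyperplane_reflection (base_pt - p)"
  let ?w = "?r1 second_pt"
  let ?r2 = "hyperplane_reflection (?w - v)"
  have r1p: "?r1 base_pt = p" by (rule hyperplane_reflection_swap) (simp add: bo pv)
  have o1: "?r1 x \<bullet> ?r1 y = x \<bullet> y" for x y
    using hyperplane_reflection_orthogonal[of "base_pt - p"] unfolding orthogonal_transformation_def by blast
  have wp: "?w \<bullet> p = 0" using o1[of second_pt base_pt] by (simp add: r1p bo)
  have r2w: "?r2 ?w = v" by (rule hyperplane_reflection_swap) (simp add: o1 bo pv)
  have "v \<bullet> p = 0" using pv by (simp add: inner_commute)
  then have r2p: "?r2 p = p" using wp
    by (intro hyperplane_reflection_fix) (simp add: inner_diff_left)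
  let ?f = "?r2 \<circ> ?r1"
  have f: "orthogonal_transformation ?f"
    by (intro orthogonal_transformation_compose hyperplane_reflection_orthogonal)
  let ?Q = "matrix ?f"
  have Q: "orthogonal_matrix ?Q" and lf: "linear ?f"
    using f unfolding orthogonal_transformation_matrix by auto
  have app: "?Q *v x = ?f x" for x using matrix_works[OF lf[unfolded linear_matrix_vector_mul_eq[symmetric]]]
    by simp
  have Qb: "?Q *v base_pt = p" "?Q *v second_pt = v" by (simp_all add: app r1p r2p r2w)
  show ?thesis
  proof (cases "det ?Q = 1")
    case True
    with Q Qb show ?thesis unfolding SO_group_def rotation_matrix_def by blast
  next
    case False
    then have d: "det ?Q = -1" using det_orthogonal_matrix[OF Q] by auto
    have "UNIV - {last_ix, prev_ix :: 'n} \<noteq> {}"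
    proof
      assume "UNIV - {last_ix, prev_ix :: 'n} = {}"
      then have "(UNIV :: 'n set) \<subseteq> {last_ix, prev_ix}" by auto
      from card_mono[OF _ this] have "CARD('n) \<le> card {last_ix, prev_ix :: 'n}" by simp
      also have "\<dots> \<le> 2" by (simp add: card_insert_if)
      finally show False using c by simp
    qed
    then obtain k :: 'n where k: "k \<noteq> last_ix" "k \<noteq> prev_ix" by auto
    \<comment> \<open>The reflection in a third coordinate axis fixes both base vectors and changes
      the determinant; this is where three dimensions are required.\<close>
    let ?D = "\<chi> i j. if i = j then (if i = k then -1 else 1) else 0 :: 'n rmat"
    have detD: "det ?D = -1"
    proof -
      have "det ?D = (\<Prod>i\<in>UNIV. if i = k then -1 else 1)"
        by (subst det_diagonal) auto
      also have "\<dots> = -1" by (simp add: prod.delta)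
      finally show ?thesis .
    qed
    have "transpose ?D ** ?D = mat 1"
      by (auto simp: transpose_def matrix_matrix_mult_def mat_def vec_eq_iff if_distrib[of "\<lambda>x. x * _"] cong: if_cong)
    then have oD: "orthogonal_matrix ?D" by (simp add: orthogonal_matrix)
    have Dfix: "?D *v axis i 1 = axis i 1" if "i \<noteq> k" for i
      using that unfolding matrix_vector_mult_basis by (auto simp: column_def axis_def vec_eq_iff)
    have "det (?Q ** ?D) = 1" by (simp add: det_mul d detD)
    moreover have "orthogonal_matrix (?Q ** ?D)" by (rule orthogonal_matrix_mul[OF Q oD])
    moreover have "(?Q ** ?D) *v base_pt = p" "(?Q ** ?D) *v second_pt = v"
      using Dfix k Qb by (auto simp: matrix_vector_mul_assoc[symmetric] base_pt_def second_pt_def)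
    ultimately show ?thesis unfolding SO_group_def rotation_matrix_def by blast
  qed
qed

section \<open>Tangent vectors, metric and \<open>J_end\<close> at an orthonormal pair\<close>

definition ut_tangent :: "'n::finite rvec \<times> 'n rvec \<Rightarrow> ('n rvec \<times> 'n rvec) set" where
  "ut_tangent q = {X. fst X \<bullet> fst q = 0 \<and> snd X \<bullet> snd q = 0 \<and> fst X \<bullet> snd q + fst q \<bullet> snd X = 0}"

definition sasaki :: "'n::finite rvec \<times> 'n rvec \<Rightarrow> 'n rvec \<times> 'n rvec \<Rightarrow> 'n rvec \<times> 'n rvec \<Rightarrow> real" where
  "sasaki q X Y = fst X \<bullet> fst Y + snd X \<bullet> snd Y - (fst X \<bullet> snd q) * (fst Y \<bullet> snd q)"

text \<open>The element of \<open>perp_flat\<close> with prescribed images \<open>fst X\<close> and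
  \<open>snd X\<close> of the pair. The first wedge already sends \<open>snd q\<close> to
  \<open>- (fst X \<bullet> snd q) *\<^sub>R fst q\<close>; the added multiple of
  \<open>fst q\<close> compensates for this.\<close>

definition beta_mat :: "'n::finite rvec \<times> 'n rvec \<Rightarrow> 'n rvec \<times> 'n rvec \<Rightarrow> 'n rmat" where
  "beta_mat q X = wedge (fst X) (fst q) + wedge (snd X + (fst X \<bullet> snd q) *\<^sub>R fst q) (snd q)"

lemma ut_iff: "q \<in> unit_tangent_bundle \<longleftrightarrow> fst q \<bullet> fst q = 1 \<and> snd q \<bullet> snd q = 1 \<and> fst q \<bullet> snd q = 0"
  by (cases q) (auto simp: unit_tangent_bundle_def norm_eq_1)

lemma ut_inner:
  assumes "q \<in> unit_tangent_bundle"
  shows "fst q \<bullet> fst q = 1" "snd q \<bullet> snd q = 1" "fst q \<bullet> snd q = 0" "snd q \<bullet> fst q = 0"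
  using assms by (auto simp: ut_iff inner_commute)

lemma ut_tangentD:
  assumes "X \<in> ut_tangent q"
  shows "fst X \<bullet> fst q = 0" "fst q \<bullet> fst X = 0" "snd X \<bullet> snd q = 0" "snd q \<bullet> snd X = 0"
    "fst q \<bullet> snd X = - (fst X \<bullet> snd q)" "snd X \<bullet> fst q = - (fst X \<bullet> snd q)"
    "snd q \<bullet> fst X = fst X \<bullet> snd q"
  using assms by (auto simp: ut_tangent_def inner_commute)

lemma beta_mat_apply:
  assumes "q \<in> unit_tangent_bundle" "X \<in> ut_tangent q"
  shows "beta_mat q X *v fst q = fst X" "beta_mat q X *v snd q = snd X"
  using ut_inner[OF assms(1)] ut_tangentD[OF assms(2)]
  by (simp_all add: beta_mat_def matrix_vector_mult_add_rdistrib wedge_apply inner_simps)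

lemma beta_mat_so: "beta_mat q X \<in> so_algebra"
  by (simp add: beta_mat_def so_algebra_add wedge_so)

lemma beta_mat_perp_flat: "beta_mat q X \<in> perp_flat (fst q) (snd q)"
  unfolding perp_flat_def
  by (auto simp: beta_mat_so) (simp add: beta_mat_def matrix_vector_mult_add_rdistrib wedge_apply inner_simps inner_commute)

text \<open>Split both arguments of the bilinear form of \<open>X\<close> by the projection
  \<open>?pr\<close> off \<open>p\<close> and \<open>v\<close>. The doubly projected part is zero,
  and skewness expresses the rest through \<open>X *v p\<close> and \<open>X *v v\<close>.\<close>

lemma perp_flat_unique:
  assumes pv: "p \<bullet> p = 1" "v \<bullet> v = 1" "p \<bullet> v = 0"
    and XY: "X \<in> perp_flat p v" "Y \<in> perp_flat p v" "X *v p = Y *v p" "X *v v = Y *v v"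
  shows "X = Y"
  unfolding matrix_eq
proof
  fix y
  have so: "X \<in> so_algebra" "Y \<in> so_algebra" using XY unfolding perp_flat_def by auto
  let ?pr = "\<lambda>y. y - (y \<bullet> p) *\<^sub>R p - (y \<bullet> v) *\<^sub>R v"
  have vp: "v \<bullet> p = 0" using pv by (simp add: inner_commute)
  have perp: "?pr y \<bullet> p = 0" "?pr y \<bullet> v = 0" for y
    by (simp_all add: inner_simps pv vp)
  have flat: "?pr z \<bullet> (Z *v ?pr y) = 0" if "Z \<in> perp_flat p v" for Z z y
    using that perp unfolding perp_flat_def by blast
  have expand: "z \<bullet> (Z *v y) = (y \<bullet> p) * (z \<bullet> (Z *v p)) + (y \<bullet> v) * (z \<bullet> (Z *v v))
      - (z \<bullet> p) * ((Z *v p) \<bullet> ?pr y) - (z \<bullet> v) * ((Z *v v) \<bullet> ?pr y)"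
    if Z: "Z \<in> perp_flat p v" for Z z
  proof -
    have soZ: "Z \<in> so_algebra" using Z unfolding perp_flat_def by auto
    have "z \<bullet> (Z *v y) = z \<bullet> (Z *v (?pr y + (y \<bullet> p) *\<^sub>R p + (y \<bullet> v) *\<^sub>R v))" by simp
    also have "\<dots> = z \<bullet> (Z *v ?pr y) + (y \<bullet> p) * (z \<bullet> (Z *v p)) + (y \<bullet> v) * (z \<bullet> (Z *v v))"
      by (simp only: matrix_vector_right_distrib matrix_vector_mult_scaleR inner_add_right inner_scaleR_right)
    also have "z \<bullet> (Z *v ?pr y) = (?pr z + (z \<bullet> p) *\<^sub>R p + (z \<bullet> v) *\<^sub>R v) \<bullet> (Z *v ?pr y)" by simp
    also have "\<dots> = (z \<bullet> p) * (p \<bullet> (Z *v ?pr y)) + (z \<bullet> v) * (v \<bullet> (Z *v ?pr y))"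
      by (simp only: inner_add_left inner_scaleR_left flat[OF Z] add_0)
    also have "\<dots> = - (z \<bullet> p) * ((Z *v p) \<bullet> ?pr y) - (z \<bullet> v) * ((Z *v v) \<bullet> ?pr y)"
      by (simp only: so_algebra_inner[OF soZ])
    finally show ?thesis by simp
  qed
  have "z \<bullet> (X *v y) = z \<bullet> (Y *v y)" for z
    unfolding expand[OF XY(1)] expand[OF XY(2)] XY(3,4) ..
  then show "X *v y = Y *v y" by (metis vector_eq_rdot inner_commute)
qed

lemma act_exp_derivative:
  "((\<lambda>t. act (mat_exp (t *\<^sub>R \<xi>)) q) has_vector_derivative (\<xi> *v fst q, \<xi> *v snd q)) (at 0)"
  using has_vector_derivative_Pair[OF mat_exp_apply_derivative[of \<xi> "fst q" 0] mat_exp_apply_derivative[of \<xi> "snd q" 0]]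
  by (simp add: act_def mat_exp_0)

text \<open>This differentiates equations that hold on \<open>N\<close> only: those defining
  \<open>N\<close>, and those satisfied by tangent fields along \<open>N\<close>.\<close>

lemma tangent_space_const:
  assumes "v \<in> tangent_space N q" "\<And>q. q \<in> N \<Longrightarrow> \<phi> q = k" "(\<phi> has_derivative D) (at q)"
  shows "D v = 0"
proof -
  have "q \<in> N" using assms(1) eventually_nhds_x_imp_x unfolding tangent_space_def by fastforce
  have "deriv_along N \<phi> q v = D v"
    by (rule deriv_along_eqI[OF assms(1) has_derivative_at_withinI[OF assms(3)]])
  moreover have "deriv_along N \<phi> q v = 0"
  proof (rule deriv_along_eqI[OF assms(1), of \<phi> "\<lambda>_. 0"])
    show "(\<phi> has_derivative (\<lambda>_. 0)) (at q within N)"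
      by (rule has_derivative_transform[OF \<open>q \<in> N\<close> assms(2)]) (auto intro: has_derivative_const)
  qed
  ultimately show ?thesis by simp
qed

text \<open>Differentiating the three defining equations gives one inclusion. For the other, the
  orbit of \<open>q\<close> under the one-parameter group of \<open>beta_mat q X\<close> is a curve
  in the bundle with velocity \<open>X\<close>.\<close>

lemma tangent_space_ut:
  fixes q :: "'n::{finite,linorder} rvec \<times> 'n rvec"
  assumes q: "q \<in> unit_tangent_bundle"
  shows "tangent_space unit_tangent_bundle q = ut_tangent q"
proof (intro equalityI subsetI)
  fix X assume X: "X \<in> tangent_space unit_tangent_bundle q"
  have "2 * (fst X \<bullet> fst q) = 0"
    by (rule tangent_space_const[OF X, of "\<lambda>q. fst q \<bullet> fst q" 1 "\<lambda>X. 2 * (fst X \<bullet> fst q)"])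
      (auto simp: ut_inner inner_commute intro!: derivative_eq_intros)
  moreover have "2 * (snd X \<bullet> snd q) = 0"
    by (rule tangent_space_const[OF X, of "\<lambda>q. snd q \<bullet> snd q" 1 "\<lambda>X. 2 * (snd X \<bullet> snd q)"])
      (auto simp: ut_inner inner_commute intro!: derivative_eq_intros)
  moreover have "fst X \<bullet> snd q + fst q \<bullet> snd X = 0"
    by (rule tangent_space_const[OF X, of "\<lambda>q. fst q \<bullet> snd q" 0 "\<lambda>X. fst X \<bullet> snd q + fst q \<bullet> snd X"])
      (auto simp: ut_inner inner_commute intro!: derivative_eq_intros)
  ultimately show "X \<in> ut_tangent q" unfolding ut_tangent_def by simp
next
  fix X assume X: "X \<in> ut_tangent q"
  let ?c = "\<lambda>t. act (mat_exp (t *\<^sub>R beta_mat q X)) q"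
  have "?c 0 = q" by (simp add: mat_exp_0 act_def)
  moreover have "?c t \<in> unit_tangent_bundle" for t
    by (simp add: ut_iff act_def mat_exp_inner[OF beta_mat_so] ut_inner[OF q])
  moreover have "(?c has_vector_derivative X) (at 0)"
    using act_exp_derivative[of "beta_mat q X" q] by (simp add: beta_mat_apply[OF q X])
  ultimately show "X \<in> tangent_space unit_tangent_bundle q"
    unfolding tangent_space_def by (intro CollectI exI[of _ ?c]) auto
qed

lemma tangent_space_sphere:
  fixes p :: "'n::{finite,linorder} rvec"
  assumes p: "p \<in> sphere 0 1"
  shows "tangent_space (sphere 0 1) p = {v. v \<bullet> p = 0}"
proof (intro equalityI subsetI)
  have pp: "p \<bullet> p = 1" if "p \<in> sphere 0 1" for p :: "'n rvec" using that by (simp add: norm_eq_1)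
  {
    fix X assume X: "X \<in> tangent_space (sphere 0 1) p"
    have "2 * (X \<bullet> p) = 0"
      by (rule tangent_space_const[OF X, of "\<lambda>q. q \<bullet> q" 1 "\<lambda>X. 2 * (X \<bullet> p)"])
        (auto simp: norm_eq_1 inner_commute intro!: derivative_eq_intros)
    then show "X \<in> {v. v \<bullet> p = 0}" by simp
  next
    fix X assume X: "X \<in> {v. v \<bullet> p = 0}"
    let ?c = "\<lambda>t. mat_exp (t *\<^sub>R wedge X p) *v p"
    have "?c 0 = p" by (simp add: mat_exp_0)
    moreover have "?c t \<in> sphere 0 1" for t
      using pp[OF p] by (simp add: norm_eq_1 mat_exp_inner[OF wedge_so])
    moreover have "(?c has_vector_derivative X) (at 0)"
      using mat_exp_apply_derivative[of "wedge X p" p 0] pp[OF p] X by (simp add: mat_exp_0 wedge_apply)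
    ultimately show "X \<in> tangent_space (sphere 0 1) p"
      unfolding tangent_space_def by (intro CollectI exI[of _ ?c]) auto
  }
qed

context
  assumes card: "CARD('n::{finite,linorder}) \<ge> 3"
begin

lemma frame_exists:
  assumes "(q :: 'n rvec \<times> 'n rvec) \<in> unit_tangent_bundle"
  shows "\<exists>a\<in>SO_group. act a base_vec = q"
proof -
  have c2: "CARD('n) \<ge> 2" using card by simp
  from SO_transitive[OF card, of "fst q" "snd q"] ut_inner[OF assms]
  show ?thesis by (auto simp: act_def base_vec_eq[OF c2] prod_eq_iff)
qed

text \<open>The right-hand sides depend on \<open>q\<close> alone, so the choice of the rotation
  \<open>a\<close> in \<open>beta_H\<close> and \<open>J_end\<close> is immaterial.\<close>

lemma frame_Ad:
  assumes "a \<in> SO_group" "act a base_vec = (q :: 'n rvec \<times> 'n rvec)"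
  shows "Ad a ` p_space = perp_flat (fst q) (snd q)" "Ad a nu0 = wedge (snd q) (fst q)"
proof -
  have c2: "CARD('n) \<ge> 2" using card by simp
  have "a *v base_pt = fst q" "a *v second_pt = snd q"
    using assms(2) by (auto simp: act_def base_vec_eq[OF c2])
  then show "Ad a ` p_space = perp_flat (fst q) (snd q)" "Ad a nu0 = wedge (snd q) (fst q)"
    by (simp_all add: p_space_eq[OF c2] Ad_image_perp_flat[OF assms(1)] nu0_eq[OF c2] Ad_wedge[OF assms(1)])
qed

lemma beta_H_eq:
  fixes q X :: "'n rvec \<times> 'n rvec"
  assumes q: "q \<in> unit_tangent_bundle" and X: "X \<in> ut_tangent q"
  shows "beta_H q X = beta_mat q X"
  unfolding beta_H_def
proof (rule the_equality)
  obtain a where a: "a \<in> SO_group" "act a base_vec = q" using frame_exists[OF q] by blast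
  show "(\<exists>a\<in>SO_group. act a base_vec = q \<and> beta_mat q X \<in> Ad a ` p_space) \<and>
    ((\<lambda>t. act (mat_exp (t *\<^sub>R beta_mat q X)) q) has_vector_derivative X) (at 0)"
    using beta_mat_perp_flat[of q X] act_exp_derivative[of "beta_mat q X" q]
    by (intro conjI bexI[OF _ a(1)] a(2)) (simp_all add: frame_Ad(1)[OF a] beta_mat_apply[OF q X])
  fix \<xi>
  assume \<xi>: "(\<exists>a\<in>SO_group. act a base_vec = q \<and> \<xi> \<in> Ad a ` p_space) \<and>
    ((\<lambda>t. act (mat_exp (t *\<^sub>R \<xi>)) q) has_vector_derivative X) (at 0)"
  then have "\<xi> \<in> perp_flat (fst q) (snd q)" using frame_Ad(1) by blast
  moreover have "(\<xi> *v fst q, \<xi> *v snd q) = X"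
    using \<xi> act_exp_derivative vector_derivative_unique_at by blast
  then have "\<xi> *v fst q = fst X" "\<xi> *v snd q = snd X" by auto
  ultimately show "\<xi> = beta_mat q X"
    using ut_inner[OF q] beta_mat_perp_flat[of q X] beta_mat_apply[OF q X]
    by (intro perp_flat_unique[of "fst q" "snd q"]) auto
qed

lemma h_metric_eq:
  fixes q X Y :: "'n rvec \<times> 'n rvec"
  assumes q: "q \<in> unit_tangent_bundle" and X: "X \<in> ut_tangent q" and Y: "Y \<in> ut_tangent q"
  shows "h_metric q X Y = sasaki q X Y"
proof -
  have "h_metric q X Y = so_inner (beta_mat q X) (wedge (fst Y) (fst q) + wedge (snd Y + (fst Y \<bullet> snd q) *\<^sub>R fst q) (snd q))"
    unfolding h_metric_def beta_H_eq[OF q X] beta_H_eq[OF q Y] by (simp add: beta_mat_def[of q Y])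
  also have "\<dots> = sasaki q X Y"
    using ut_tangentD[OF X]
    by (simp add: so_inner_add_right so_inner_wedge beta_mat_so beta_mat_apply[OF q X] sasaki_def inner_simps inner_commute)
  finally show ?thesis .
qed

text \<open>The terms with \<open>fst X \<bullet> snd q\<close> make \<open>J_end\<close> kill the
  geodesic direction \<open>(snd q, - fst q)\<close>, whose matrix is
  \<open>wedge (snd q) (fst q)\<close> itself and hence has zero commutator with it.\<close>

lemma J_end_eq:
  fixes q X :: "'n rvec \<times> 'n rvec"
  assumes q: "q \<in> unit_tangent_bundle" and X: "X \<in> ut_tangent q"
  shows "J_end q X = (- (snd X + (fst X \<bullet> snd q) *\<^sub>R fst q), fst X - (fst X \<bullet> snd q) *\<^sub>R snd q)"
    and "J_end q X \<in> ut_tangent q"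
proof -
  let ?Y = "(- (snd X + (fst X \<bullet> snd q) *\<^sub>R fst q), fst X - (fst X \<bullet> snd q) *\<^sub>R snd q)"
  note simps = ut_inner[OF q] ut_tangentD[OF X]
  have Y: "?Y \<in> ut_tangent q"
    unfolding ut_tangent_def by (simp add: inner_simps simps)
  have comm: "beta_mat q ?Y = commutator (wedge (snd q) (fst q)) (beta_mat q X)"
    unfolding matrix_eq
  proof
    fix y
    \<comment> \<open>Skewness moves \<open>beta_mat q X\<close> onto the pair, where its values are
      known.\<close>
    have 1: "fst q \<bullet> (beta_mat q X *v y) = - (fst X \<bullet> y)" "snd q \<bullet> (beta_mat q X *v y) = - (snd X \<bullet> y)"
      using so_algebra_inner[OF beta_mat_so, of q X "fst q" y] so_algebra_inner[OF beta_mat_so, of q X "snd q" y]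
      by (simp_all add: beta_mat_apply[OF q X])
    have "commutator (wedge (snd q) (fst q)) (beta_mat q X) *v y
      = - (fst X \<bullet> y) *\<^sub>R snd q + (snd X \<bullet> y) *\<^sub>R fst q - (fst q \<bullet> y) *\<^sub>R snd X + (snd q \<bullet> y) *\<^sub>R fst X"
      by (simp add: commutator_def matrix_vector_mult_diff_rdistrib matrix_vector_mul_assoc[symmetric]
        wedge_apply matrix_vector_mult_diff_distrib matrix_vector_mult_scaleR beta_mat_apply[OF q X] 1)
    moreover have "beta_mat q ?Y *v y = \<dots>"
      by (simp add: beta_mat_def matrix_vector_mult_add_rdistrib wedge_apply inner_simps simps algebra_simps)
    ultimately show "beta_mat q ?Y *v y = commutator (wedge (snd q) (fst q)) (beta_mat q X) *v y" by simp
  qed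
  show eq: "J_end q X = ?Y"
    unfolding J_end_def tangent_space_ut[OF q]
  proof (rule the_equality)
    obtain a where a: "a \<in> SO_group" "act a base_vec = q" using frame_exists[OF q] by blast
    show "?Y \<in> ut_tangent q \<and>
      (\<exists>a\<in>SO_group. act a base_vec = q \<and> beta_H q ?Y = commutator (Ad a nu0) (beta_H q X))"
      by (intro conjI bexI[OF _ a(1)] a(2) Y)
        (simp only: beta_H_eq[OF q Y] beta_H_eq[OF q X] frame_Ad(2)[OF a] comm)
    fix Z
    assume Z: "Z \<in> ut_tangent q \<and>
      (\<exists>a\<in>SO_group. act a base_vec = q \<and> beta_H q Z = commutator (Ad a nu0) (beta_H q X))"
    then have Zt: "Z \<in> ut_tangent q" by blast
    from Z have "beta_mat q Z = beta_mat q ?Y"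
      using frame_Ad(2) comm by (auto simp: beta_H_eq[OF q Zt] beta_H_eq[OF q X])
    then show "Z = ?Y" using beta_mat_apply[OF q Zt] beta_mat_apply[OF q Y] by (metis prod.collapse)
  qed
  show "J_end q X \<in> ut_tangent q" unfolding eq by (rule Y)
qed

end

section \<open>The connections of the sphere and of the unit tangent bundle\<close>

lemma vfieldsI:
  assumes "smooth_on UNIV X" "\<And>q. q \<in> N \<Longrightarrow> X q \<in> tangent_space N q"
  shows "X \<in> vfields N"
  unfolding vfields_def using assms by (intro CollectI conjI exI[of _ UNIV]) auto

definition sphere_proj :: "'n::finite rvec \<Rightarrow> 'n rvec \<Rightarrow> 'n rvec" where
  "sphere_proj q e = e - (e \<bullet> q) *\<^sub>R q"

lemma sphere_deriv_inner:
  assumes "Y \<in> vfields N" "Z \<in> vfields N" "q \<in> N" "d \<in> tangent_space N q"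
  shows "deriv_along N (\<lambda>p. Y p \<bullet> Z p) q d = Y q \<bullet> dd d Z q + dd d Y q \<bullet> Z q"
  by (rule deriv_along_eqI[OF assms(4) has_derivative_at_withinI[OF has_derivative_inner[OF
      dd_has_derivative[OF vfields_differentiable[OF assms(1,3)]]
      dd_has_derivative[OF vfields_differentiable[OF assms(2,3)]]]]])

text \<open>Koszul's identity for the flat derivative is the product rule alone; the radial part
  removed by \<open>sphere_proj\<close> is invisible to a tangent \<open>Z q\<close>.\<close>

lemma sphere_connection:
  "connection (sphere 0 1 :: 'n::{finite,linorder} rvec set) g_metric sphere_proj sphere_proj (\<lambda>_ _ _. 0)"
proof (rule connection.intro)
  let ?S = "sphere 0 1 :: 'n rvec set"
  have one: "q \<bullet> q = 1" if "q \<in> ?S" for q using that by (simp add: norm_eq_1)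
  have tan: "sphere_proj q e \<in> tangent_space ?S q" if "q \<in> ?S" for q e
    using one[OF that] by (simp add: tangent_space_sphere[OF that] sphere_proj_def inner_simps)
  show "(\<lambda>q. sphere_proj q e) \<in> vfields ?S" for e
    unfolding sphere_proj_def
  proof (rule vfieldsI)
    show "smooth_on UNIV (\<lambda>q. e - (e \<bullet> q) *\<^sub>R q)"
      by (intro smooth_on_diff smooth_on_scaleR smooth_on_const smooth_on_bounded_linear
        bounded_linear_inner_right bounded_linear_ident open_UNIV)
    show "e - (e \<bullet> q) *\<^sub>R q \<in> tangent_space ?S q" if "q \<in> ?S" for q
      using tan[OF that] unfolding sphere_proj_def .
  qed
  show lin: "linear (sphere_proj q)" for q :: "'n rvec"
    by (rule linearI) (simp_all add: sphere_proj_def inner_simps algebra_simps)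
  show "linear (sphere_proj q)" for q :: "'n rvec" by (rule lin)
  show id: "sphere_proj q e = e" if "q \<in> ?S" "e \<in> tangent_space ?S q" for q e
    using that by (simp add: tangent_space_sphere[OF that(1)] sphere_proj_def)
  show "sphere_proj q e = e" if "q \<in> ?S" "e \<in> tangent_space ?S q" for q e
    using that by (rule id)
  show "linear (\<lambda>_::'n rvec. 0 :: 'n rvec)" by (rule linear_zero)
  show "z = z'" if q: "q \<in> ?S" and z: "z \<in> tangent_space ?S q" "z' \<in> tangent_space ?S q"
    "\<And>t. t \<in> tangent_space ?S q \<Longrightarrow> g_metric q z t = g_metric q z' t" for q z z'
  proof -
    have "z - z' \<in> tangent_space ?S q" using z(1,2) by (simp add: tangent_space_sphere[OF q] inner_simps)
    from z(3)[OF this] have "(z - z') \<bullet> (z - z') = 0" by (simp add: g_metric_def inner_simps)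
    then show ?thesis by simp
  qed
  show "sphere_proj q (dd (X q) Y q) + 0 \<in> tangent_space ?S q" if "q \<in> ?S" for X Y q
    using tan[OF that] by simp
  show "2 * g_metric q (sphere_proj q (dd (X q) Y q) + 0) (Z q) = koszul ?S g_metric X Y Z q"
    if X: "X \<in> vfields ?S" and Y: "Y \<in> vfields ?S" and Z: "Z \<in> vfields ?S" and q: "q \<in> ?S" for X Y Z q
  proof -
    have "q \<bullet> Z q = 0"
      using vfields_tangent[OF Z q] by (simp add: tangent_space_sphere[OF q] inner_commute)
    then have "2 * g_metric q (sphere_proj q (dd (X q) Y q) + 0) (Z q) = 2 * (dd (X q) Y q \<bullet> Z q)"
      by (simp add: g_metric_def sphere_proj_def inner_simps)
    also have "\<dots> = koszul ?S g_metric X Y Z q"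
      unfolding koszul_def g_metric_def
      sphere_deriv_inner[OF Y Z q vfields_tangent[OF X q]] sphere_deriv_inner[OF X Z q vfields_tangent[OF Y q]]
      sphere_deriv_inner[OF X Y q vfields_tangent[OF Z q]]
      lie_bracket_eq[OF X Y q] lie_bracket_eq[OF X Z q] lie_bracket_eq[OF Y Z q]
      by (simp add: inner_simps inner_commute)
    finally show ?thesis .
  qed
qed

text \<open>Euclidean orthogonal projection onto the tangent space: with \<open>q = (p, v)\<close>
  the normal directions are \<open>(p, 0)\<close>, \<open>(0, v)\<close> and \<open>(v, p)\<close>,
  the last of squared length 2, hence the factor 1/2. It is polynomial in \<open>q\<close>, hence
  smooth on the whole ambient space.\<close>

definition ut_proj :: "'n::finite rvec \<times> 'n rvec \<Rightarrow> 'n rvec \<times> 'n rvec \<Rightarrow> 'n rvec \<times> 'n rvec" where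
  "ut_proj q e =
    (fst e - (fst e \<bullet> fst q) *\<^sub>R fst q - ((1/2) * (fst e \<bullet> snd q + snd e \<bullet> fst q)) *\<^sub>R snd q,
     snd e - (snd e \<bullet> snd q) *\<^sub>R snd q - ((1/2) * (fst e \<bullet> snd q + snd e \<bullet> fst q)) *\<^sub>R fst q)"

text \<open>The tangent vector representing, with respect to \<open>sasaki\<close>, the functional
  that pairs \<open>A\<close> with tangent vectors in the euclidean way.\<close>

definition ut_riesz :: "'n::finite rvec \<times> 'n rvec \<Rightarrow> 'n rvec \<times> 'n rvec \<Rightarrow> 'n rvec \<times> 'n rvec" where
  "ut_riesz q A =
    (fst A - (fst A \<bullet> fst q) *\<^sub>R fst q - (snd A \<bullet> fst q) *\<^sub>R snd q,
     snd A - (snd A \<bullet> snd q) *\<^sub>R snd q - (fst A \<bullet> snd q) *\<^sub>R fst q)"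

text \<open>Represents \<open>Z \<mapsto> sasaki q D Z\<close> by a tangent vector: the projection
  of an ambient derivative that is adapted to the metric.\<close>

definition ut_conn :: "'n::finite rvec \<times> 'n rvec \<Rightarrow> 'n rvec \<times> 'n rvec \<Rightarrow> 'n rvec \<times> 'n rvec" where
  "ut_conn q D = ut_riesz q (fst D - (fst D \<bullet> snd q) *\<^sub>R snd q, snd D)"

text \<open>The Christoffel term. Only the part
  \<open>- (fst Y \<bullet> snd q) * (fst Z \<bullet> snd q)\<close> of the metric depends on
  \<open>q\<close>; the usual half sum of its derivatives along \<open>X\<close>, \<open>Y\<close>
  and minus \<open>Z\<close>, read as a functional of \<open>Z\<close>, is raised by
  \<open>ut_riesz\<close>.\<close>

definition ut_gamma ::
  "'n::finite rvec \<times> 'n rvec \<Rightarrow> 'n rvec \<times> 'n rvec \<Rightarrow> 'n rvec \<times> 'n rvec \<Rightarrow> 'n rvec \<times> 'n rvec" where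
  "ut_gamma q X Y = ut_riesz q
    (- (1/2) *\<^sub>R ((snd X \<bullet> fst Y + snd Y \<bullet> fst X) *\<^sub>R snd q + (fst Y \<bullet> snd q) *\<^sub>R snd X + (fst X \<bullet> snd q) *\<^sub>R snd Y),
     (1/2) *\<^sub>R ((fst Y \<bullet> snd q) *\<^sub>R fst X + (fst X \<bullet> snd q) *\<^sub>R fst Y))"

lemma ut_riesz_tangent: "q \<in> unit_tangent_bundle \<Longrightarrow> ut_riesz q A \<in> ut_tangent q"
  by (simp add: ut_tangent_def ut_riesz_def inner_simps ut_inner inner_commute)

lemma ut_conn_linear: "linear (ut_conn q)"
  by (rule linearI) (simp_all add: ut_conn_def ut_riesz_def inner_simps algebra_simps)

lemma ut_gamma_linear: "linear (ut_gamma q X)"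
  by (rule linearI)
    (simp_all add: ut_gamma_def ut_riesz_def inner_simps algebra_simps add_divide_distrib)

lemma ut_gamma_linear_left: "linear (\<lambda>X. ut_gamma q X Y)"
  by (rule linearI)
    (simp_all add: ut_gamma_def ut_riesz_def inner_simps algebra_simps add_divide_distrib)

lemma ut_tangent_subspace: "subspace (ut_tangent q)"
  by (auto simp: subspace_def ut_tangent_def inner_simps algebra_simps)
    (metis distrib_left mult_zero_right)

lemma sasaki_add_left: "sasaki q (X + X') Y = sasaki q X Y + sasaki q X' Y"
  and sasaki_diff_left: "sasaki q (X - X') Y = sasaki q X Y - sasaki q X' Y"
  and sasaki_scaleR_left: "sasaki q (c *\<^sub>R X) Y = c * sasaki q X Y"
  and sasaki_commute: "sasaki q X Y = sasaki q Y X"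
  by (simp_all add: sasaki_def inner_simps algebra_simps inner_commute)

lemma sasaki_riesz:
  assumes "q \<in> unit_tangent_bundle" "Z \<in> ut_tangent q"
  shows "sasaki q (ut_riesz q A) Z = fst A \<bullet> fst Z + snd A \<bullet> snd Z"
  by (simp add: sasaki_def ut_riesz_def inner_simps ut_inner[OF assms(1)] ut_tangentD[OF assms(2)] algebra_simps)

text \<open>Completing the square writes \<open>sasaki q X X\<close> as
  \<open>?x \<bullet> ?x + snd X \<bullet> snd X\<close>. Once \<open>snd X\<close> vanishes,
  tangency makes the contact component \<open>fst X \<bullet> snd q\<close> vanish too.\<close>

lemma sasaki_definite:
  assumes "q \<in> unit_tangent_bundle" "X \<in> ut_tangent q" "sasaki q X X = 0"
  shows "X = 0"
proof -
  let ?x = "fst X - (fst X \<bullet> snd q) *\<^sub>R snd q"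
  have "?x \<bullet> ?x = fst X \<bullet> fst X - (fst X \<bullet> snd q) * (fst X \<bullet> snd q)"
    using ut_inner[OF assms(1)] ut_tangentD[OF assms(2)] by (simp add: inner_simps algebra_simps)
  then have "?x \<bullet> ?x + snd X \<bullet> snd X = 0"
    using assms(3) by (simp add: sasaki_def)
  then have 1: "?x = 0" "snd X = 0"
    by (simp_all add: add_nonneg_eq_0_iff)
  then have "fst X \<bullet> snd q = 0" using ut_tangentD(5)[OF assms(2)] by simp
  then show ?thesis using 1 by (simp add: prod_eq_iff)
qed

lemma ut_vfields_inner:
  assumes X: "X \<in> vfields unit_tangent_bundle" and q: "q \<in> (unit_tangent_bundle :: ('n::{finite,linorder} rvec \<times> 'n rvec) set)"
    and d: "d \<in> ut_tangent q"
  shows "fst (dd d X q) \<bullet> fst q + fst (X q) \<bullet> fst d = 0" (is ?a)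
    and "snd (dd d X q) \<bullet> snd q + snd (X q) \<bullet> snd d = 0" (is ?b)
    and "fst (dd d X q) \<bullet> snd q + fst (X q) \<bullet> snd d + fst d \<bullet> snd (X q) + fst q \<bullet> snd (dd d X q) = 0" (is ?c)
proof -
  have T: "X q \<in> ut_tangent q" if "q \<in> unit_tangent_bundle" for q
    using vfields_tangent[OF X that] by (simp add: tangent_space_ut[OF that])
  have dT: "d \<in> tangent_space unit_tangent_bundle q" using d by (simp add: tangent_space_ut[OF q])
  note D = dd_has_derivative[OF vfields_differentiable[OF X q]]
  have "fst (X q) \<bullet> fst d + fst (dd d X q) \<bullet> fst q = 0"
    by (rule tangent_space_const[OF dT, of "\<lambda>q. fst (X q) \<bullet> fst q" 0])
      (use ut_tangentD[OF T] in simp, intro has_derivative_inner has_derivative_fst D has_derivative_ident)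
  then show ?a by simp
  have "snd (X q) \<bullet> snd d + snd (dd d X q) \<bullet> snd q = 0"
    by (rule tangent_space_const[OF dT, of "\<lambda>q. snd (X q) \<bullet> snd q" 0])
      (use ut_tangentD[OF T] in simp, intro has_derivative_inner has_derivative_snd D has_derivative_ident)
  then show ?b by simp
  have "(fst (X q) \<bullet> snd d + fst (dd d X q) \<bullet> snd q) + (fst q \<bullet> snd (dd d X q) + fst d \<bullet> snd (X q)) = 0"
    by (rule tangent_space_const[OF dT, of "\<lambda>q. fst (X q) \<bullet> snd q + fst q \<bullet> snd (X q)" 0])
      (use ut_tangentD[OF T] in simp, intro has_derivative_add has_derivative_inner has_derivative_fst has_derivative_snd D has_derivative_ident)
  then show ?c by simp
qed

text \<open>\<open>h_metric\<close> is identified with \<open>sasaki\<close> on tangent vectors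
  only, and Koszul's formula inserts brackets into it. The second-order terms of the differentiated
  tangency equations are symmetric and cancel.\<close>

lemma ut_bracket_tangent:
  assumes X: "X \<in> vfields unit_tangent_bundle" and Y: "Y \<in> vfields unit_tangent_bundle"
    and q: "q \<in> (unit_tangent_bundle :: ('n::{finite,linorder} rvec \<times> 'n rvec) set)"
  shows "dd (X q) Y q - dd (Y q) X q \<in> ut_tangent q"
proof -
  have T: "X q \<in> ut_tangent q" "Y q \<in> ut_tangent q"
    using vfields_tangent[OF X q] vfields_tangent[OF Y q] by (simp_all add: tangent_space_ut[OF q])
  from ut_vfields_inner[OF X q T(2)] ut_vfields_inner[OF Y q T(1)] show ?thesis
    by (simp add: ut_tangent_def inner_simps inner_commute)
qed

text \<open>\<open>h_metric\<close> is known on the bundle only, hence the derivative within it. The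
  last two terms come from the motion of \<open>snd q\<close> in the contact form.\<close>

lemma deriv_along_h:
  assumes card: "CARD('n::{finite,linorder}) \<ge> 3"
    and Y: "Y \<in> vfields unit_tangent_bundle" and Z: "Z \<in> vfields unit_tangent_bundle"
    and q: "q \<in> (unit_tangent_bundle :: ('n rvec \<times> 'n rvec) set)" and d: "d \<in> ut_tangent q"
  shows "deriv_along unit_tangent_bundle (\<lambda>p. h_metric p (Y p) (Z p)) q d
    = sasaki q (dd d Y q) (Z q) + sasaki q (Y q) (dd d Z q)
      - (fst (Y q) \<bullet> snd d) * (fst (Z q) \<bullet> snd q) - (fst (Y q) \<bullet> snd q) * (fst (Z q) \<bullet> snd d)"
proof -
  have T: "V p \<in> ut_tangent p" if "V \<in> vfields unit_tangent_bundle" "p \<in> unit_tangent_bundle" for V and p :: "'n rvec \<times> 'n rvec"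
    using vfields_tangent[OF that] by (simp add: tangent_space_ut[OF that(2)])
  note DY = dd_has_derivative[OF vfields_differentiable[OF Y q]]
    and DZ = dd_has_derivative[OF vfields_differentiable[OF Z q]]
  have "((\<lambda>p. sasaki p (Y p) (Z p)) has_derivative
    (\<lambda>d. (fst (Y q) \<bullet> fst (dd d Z q) + fst (dd d Y q) \<bullet> fst (Z q))
      + (snd (Y q) \<bullet> snd (dd d Z q) + snd (dd d Y q) \<bullet> snd (Z q))
      - ((fst (Y q) \<bullet> snd q) * (fst (Z q) \<bullet> snd d + fst (dd d Z q) \<bullet> snd q)
       + (fst (Y q) \<bullet> snd d + fst (dd d Y q) \<bullet> snd q) * (fst (Z q) \<bullet> snd q)))) (at q)"
    unfolding sasaki_def
    by (intro has_derivative_add has_derivative_diff has_derivative_mult has_derivative_inner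
      has_derivative_fst has_derivative_snd DY DZ has_derivative_ident)
  then have "((\<lambda>p. sasaki p (Y p) (Z p)) has_derivative
    (\<lambda>d. sasaki q (dd d Y q) (Z q) + sasaki q (Y q) (dd d Z q)
      - (fst (Y q) \<bullet> snd d) * (fst (Z q) \<bullet> snd q) - (fst (Y q) \<bullet> snd q) * (fst (Z q) \<bullet> snd d))) (at q)"
    by (simp add: sasaki_def algebra_simps)
  then have "((\<lambda>p. h_metric p (Y p) (Z p)) has_derivative
    (\<lambda>d. sasaki q (dd d Y q) (Z q) + sasaki q (Y q) (dd d Z q)
      - (fst (Y q) \<bullet> snd d) * (fst (Z q) \<bullet> snd q) - (fst (Y q) \<bullet> snd q) * (fst (Z q) \<bullet> snd d)))
      (at q within unit_tangent_bundle)"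
    by (intro has_derivative_transform[OF q _ has_derivative_at_withinI])
      (simp_all add: h_metric_eq[OF card] T[OF Y] T[OF Z])
  from deriv_along_eqI[OF _ this] d show ?thesis by (simp add: tangent_space_ut[OF q])
qed

text \<open>In Koszul's formula the derivatives of the fields combine to
  \<open>sasaki q (dd (X q) Y q) (Z q)\<close>, twice, and the terms in which the contact form is
  differentiated are those collected in \<open>ut_gamma\<close>.\<close>

lemma ut_connection:
  assumes card: "CARD('n::{finite,linorder}) \<ge> 3"
  shows "connection (unit_tangent_bundle :: ('n rvec \<times> 'n rvec) set) h_metric ut_proj ut_conn ut_gamma"
proof (rule connection.intro)
  let ?N = "unit_tangent_bundle :: ('n rvec \<times> 'n rvec) set"
  have proj_tan: "ut_proj q e \<in> ut_tangent q" if "q \<in> ?N" for q e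
    using ut_inner[OF that] by (simp add: ut_tangent_def ut_proj_def inner_simps inner_commute)
  show "(\<lambda>q. ut_proj q e) \<in> vfields ?N" for e
  proof (rule vfieldsI)
    have bl: "bounded_linear (\<lambda>q :: 'n rvec \<times> 'n rvec. (fst q, 0 :: 'n rvec))"
      "bounded_linear (\<lambda>q :: 'n rvec \<times> 'n rvec. (0 :: 'n rvec, snd q))"
      "bounded_linear (\<lambda>q :: 'n rvec \<times> 'n rvec. (snd q, fst q))"
      by (intro bounded_linear_Pair bounded_linear_fst bounded_linear_snd bounded_linear_zero)+
    have "smooth_on UNIV (\<lambda>q. e - (fst e \<bullet> fst q) *\<^sub>R (fst q, 0) - (snd e \<bullet> snd q) *\<^sub>R (0, snd q)
      - ((1/2) * (fst e \<bullet> snd q + snd e \<bullet> fst q)) *\<^sub>R (snd q, fst q))"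
      by (intro smooth_on_diff smooth_on_scaleR smooth_on_const smooth_on_bounded_linear bl open_UNIV
        bounded_linear_const_mult bounded_linear_add bounded_linear_inner_right_comp bounded_linear_fst bounded_linear_snd)
    then show "smooth_on UNIV (\<lambda>q. ut_proj q e)"
      by (rule smooth_on_cong[rotated 2]) (simp_all add: ut_proj_def prod_eq_iff)
    show "ut_proj q e \<in> tangent_space ?N q" if "q \<in> ?N" for q
      using proj_tan[OF that] by (simp add: tangent_space_ut[OF that])
  qed
  show "linear (ut_proj q)" for q :: "'n rvec \<times> 'n rvec"
    by (rule linearI) (simp_all add: ut_proj_def inner_simps algebra_simps add_divide_distrib)
  show "ut_proj q e = e" if "q \<in> ?N" "e \<in> tangent_space ?N q" for q e
    using that(2) by (simp add: tangent_space_ut[OF that(1)] ut_proj_def ut_tangentD prod_eq_iff)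
  show "linear (ut_conn q)" for q :: "'n rvec \<times> 'n rvec" by (rule ut_conn_linear)
  show "ut_conn q e = e" if "q \<in> ?N" "e \<in> tangent_space ?N q" for q e
    using that(2) ut_inner[OF that(1)]
    by (simp add: tangent_space_ut[OF that(1)] ut_conn_def ut_riesz_def ut_tangentD prod_eq_iff inner_simps)
  show "linear (ut_gamma q v)" for q v :: "'n rvec \<times> 'n rvec" by (rule ut_gamma_linear)
  show "z = z'" if q: "q \<in> ?N" and z: "z \<in> tangent_space ?N q" "z' \<in> tangent_space ?N q"
    "\<And>t. t \<in> tangent_space ?N q \<Longrightarrow> h_metric q z t = h_metric q z' t" for q z z'
  proof -
    have zt: "z \<in> ut_tangent q" "z' \<in> ut_tangent q" using z(1,2) by (auto simp: tangent_space_ut[OF q])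
    then have d: "z - z' \<in> ut_tangent q" by (rule subspace_diff[OF ut_tangent_subspace])
    have "h_metric q z (z - z') = h_metric q z' (z - z')"
      using z(3) d by (simp add: tangent_space_ut[OF q])
    then have "sasaki q (z - z') (z - z') = 0"
      by (simp add: h_metric_eq[OF card q] zt d sasaki_diff_left)
    from sasaki_definite[OF q d this] show ?thesis by simp
  qed
  have tan: "ut_conn q D + ut_gamma q X Y \<in> ut_tangent q" if "q \<in> ?N" for q D X Y
    unfolding ut_conn_def ut_gamma_def
    by (intro subspace_add[OF ut_tangent_subspace] ut_riesz_tangent that)
  then show "ut_conn q (dd (X q) Y q) + ut_gamma q (X q) (Y q) \<in> tangent_space ?N q" if "q \<in> ?N" for X Y q
    using that by (simp add: tangent_space_ut)
  show "2 * h_metric q (ut_conn q (dd (X q) Y q) + ut_gamma q (X q) (Y q)) (Z q) = koszul ?N h_metric X Y Z q"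
    if X: "X \<in> vfields ?N" and Y: "Y \<in> vfields ?N" and Z: "Z \<in> vfields ?N" and q: "q \<in> ?N" for X Y Z q
  proof -
    have T: "X q \<in> ut_tangent q" "Y q \<in> ut_tangent q" "Z q \<in> ut_tangent q"
      using vfields_tangent[OF X q] vfields_tangent[OF Y q] vfields_tangent[OF Z q] by (simp_all add: tangent_space_ut[OF q])
    have lhs: "h_metric q (ut_conn q (dd (X q) Y q) + ut_gamma q (X q) (Y q)) (Z q)
      = (fst (dd (X q) Y q) - (fst (dd (X q) Y q) \<bullet> snd q) *\<^sub>R snd q) \<bullet> fst (Z q) + snd (dd (X q) Y q) \<bullet> snd (Z q)
       - (1/2) * ((snd (X q) \<bullet> fst (Y q) + snd (Y q) \<bullet> fst (X q)) * (snd q \<bullet> fst (Z q))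
          + (fst (Y q) \<bullet> snd q) * (snd (X q) \<bullet> fst (Z q)) + (fst (X q) \<bullet> snd q) * (snd (Y q) \<bullet> fst (Z q)))
       + (1/2) * ((fst (Y q) \<bullet> snd q) * (fst (X q) \<bullet> snd (Z q)) + (fst (X q) \<bullet> snd q) * (fst (Y q) \<bullet> snd (Z q)))"
      unfolding h_metric_eq[OF card q tan[OF q] T(3)] sasaki_add_left
      unfolding ut_conn_def ut_gamma_def sasaki_riesz[OF q T(3)]
      by (simp add: inner_simps algebra_simps)
    show ?thesis
      unfolding lhs koszul_def deriv_along_h[OF card Y Z q T(1)] deriv_along_h[OF card X Z q T(2)] deriv_along_h[OF card X Y q T(3)]
      lie_bracket_eq[OF X Y q] lie_bracket_eq[OF X Z q] lie_bracket_eq[OF Y Z q]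
      h_metric_eq[OF card q ut_bracket_tangent[OF X Y q] T(3)] h_metric_eq[OF card q ut_bracket_tangent[OF X Z q] T(2)]
      h_metric_eq[OF card q ut_bracket_tangent[OF Y Z q] T(1)]
      by (simp add: sasaki_def inner_simps inner_commute algebra_simps)
  qed
qed

section \<open>Immersions into the sphere in a chart\<close>

definition gram :: "(real ^ 'm::finite \<Rightarrow> 'k::euclidean_space) \<Rightarrow> real ^ 'm ^ 'm" where
  "gram L = (\<chi> i j. L (axis i 1) \<bullet> L (axis j 1))"

text \<open>Cramer's rule makes the dependence on \<open>L\<close> and \<open>z\<close> visibly differentiable.\<close>

definition tan_coord :: "(real ^ 'm::finite \<Rightarrow> 'k::euclidean_space) \<Rightarrow> 'k \<Rightarrow> real ^ 'm" where
  "tan_coord L z =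
    (\<chi> k. det (\<chi> i j. if j = k then L (axis i 1) \<bullet> z else gram L $ i $ j) / det (gram L))"

lemma linear_axis_expand:
  fixes L :: "real ^ 'm::finite \<Rightarrow> 'k::real_vector"
  assumes "linear L"
  shows "L y = (\<Sum>j\<in>UNIV. y $ j *\<^sub>R L (axis j 1))"
proof -
  have "L y = L (\<Sum>j\<in>UNIV. y $ j *\<^sub>R axis j 1)"
    by (simp add: basis_expansion scalar_mult_eq_scaleR[symmetric])
  also have "\<dots> = (\<Sum>j\<in>UNIV. y $ j *\<^sub>R L (axis j 1))"
    by (simp add: linear_sum[OF assms] linear_cmul[OF assms])
  finally show ?thesis .
qed

lemma gram_apply:
  assumes "linear L"
  shows "(gram L *v y) $ i = L (axis i 1) \<bullet> L y"
  unfolding linear_axis_expand[OF assms, of y]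
  by (simp add: gram_def matrix_vector_mult_def inner_sum_right mult.commute)

lemma det_gram:
  assumes "linear L" "inj L"
  shows "det (gram L) \<noteq> 0"
proof -
  have "inj ((*v) (gram L))"
  proof (subst linear_injective_0[OF matrix_vector_mul_linear], intro allI impI)
    fix y assume 0: "gram L *v y = 0"
    have "L y \<bullet> L y = (\<Sum>j\<in>UNIV. y $ j *\<^sub>R L (axis j 1)) \<bullet> L y"
      using linear_axis_expand[OF assms(1), of y] by simp
    also have "\<dots> = (\<Sum>j\<in>UNIV. y $ j * (gram L *v y) $ j)"
      by (simp add: inner_sum_left gram_apply[OF assms(1)])
    finally have "L y = 0" by (simp add: 0)
    then show "y = 0" using linear_injective_0[OF assms(1)] assms(2) by blast
  qed
  then show ?thesis
    using det_nz_iff_inj[OF matrix_vector_mul_linear, of "gram L"] by simp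
qed

text \<open>Cramer's rule solves the normal equations of the Gram matrix; so
  \<open>L (tan_coord L z)\<close> is the orthogonal projection of \<open>z\<close> to the range of
  \<open>L\<close>.\<close>

lemma tan_coord_inner:
  assumes "linear L" "inj L"
  shows "L (tan_coord L z) \<bullet> L y = z \<bullet> L y"
proof -
  have "gram L *v tan_coord L z = (\<chi> i. L (axis i 1) \<bullet> z)"
    unfolding cramer[OF det_gram[OF assms]] tan_coord_def by (simp cong: if_cong)
  then have e: "L (axis i 1) \<bullet> L (tan_coord L z) = L (axis i 1) \<bullet> z" for i
    using gram_apply[OF assms(1), of "tan_coord L z" i] by simp
  have "L y \<bullet> L (tan_coord L z) = L y \<bullet> z"
    unfolding linear_axis_expand[OF assms(1), of y] by (simp add: inner_sum_left e)
  then show ?thesis by (simp add: inner_commute)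
qed

lemma tan_coord_unique:
  assumes "linear L" "inj L" "\<And>y. L c \<bullet> L y = z \<bullet> L y"
  shows "tan_coord L z = c"
proof -
  let ?d = "tan_coord L z - c"
  have "L ?d \<bullet> L ?d = L (tan_coord L z) \<bullet> L ?d - L c \<bullet> L ?d"
    by (simp add: linear_diff[OF assms(1)] inner_simps)
  also have "\<dots> = 0" by (simp add: tan_coord_inner[OF assms(1,2)] assms(3))
  finally have "L ?d = 0" by simp
  then show ?thesis using linear_injective_0[OF assms(1)] assms(2) by auto
qed

lemma tan_coord_linear:
  assumes "linear L" "inj L"
  shows "linear (tan_coord L)"
proof (rule linearI)
  show "tan_coord L (a + b) = tan_coord L a + tan_coord L b" for a b
    by (rule tan_coord_unique[OF assms])
      (simp add: linear_add[OF assms(1)] inner_simps tan_coord_inner[OF assms])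
  show "tan_coord L (c *\<^sub>R a) = c *\<^sub>R tan_coord L a" for a c
    by (rule tan_coord_unique[OF assms])
      (simp add: linear_cmul[OF assms(1)] inner_simps tan_coord_inner[OF assms])
qed

lemma differentiable_prod:
  fixes f :: "'i \<Rightarrow> 'a::real_normed_vector \<Rightarrow> real"
  assumes "\<And>i. i \<in> I \<Longrightarrow> f i differentiable (at x)"
  shows "(\<lambda>x. \<Prod>i\<in>I. f i x) differentiable (at x)"
  using has_derivative_prod[of I f "\<lambda>i a. dd a (f i) x" x UNIV] assms dd_has_derivative
  unfolding differentiable_def by blast

lemma differentiable_det:
  fixes M :: "'a::real_normed_vector \<Rightarrow> real ^ 'm::finite ^ 'm"
  assumes "\<And>i j. (\<lambda>x. M x $ i $ j) differentiable (at x)"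
  shows "(\<lambda>x. det (M x)) differentiable (at x)"
  unfolding det_def
  by (intro differentiable_sum ballI differentiable_mult differentiable_prod assms
    differentiable_const) (simp add: finite_permutations)

lemma differentiable_vec_lambda:
  fixes f :: "'m::finite \<Rightarrow> 'a::real_normed_vector \<Rightarrow> real"
  assumes "\<And>i. f i differentiable (at x)"
  shows "(\<lambda>x. \<chi> i. f i x) differentiable (at x)"
  using assms
  by (subst differentiable_componentwise_within) (auto simp: Basis_vec_def inner_axis)

lemma differentiable_tan_coord:
  fixes L :: "'a::real_normed_vector \<Rightarrow> real ^ 'm::finite \<Rightarrow> 'k::euclidean_space"
  assumes L: "linear (L x)" "inj (L x)" and d: "\<And>a. (\<lambda>x. L x a) differentiable (at x)"
    and z: "z differentiable (at x)"
  shows "(\<lambda>x. tan_coord (L x) (z x)) differentiable (at x)"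
proof -
  have "(\<lambda>x. if P then f x else g x) differentiable (at x)"
    if "f differentiable (at x)" "g differentiable (at x)" for P and f g :: "'a \<Rightarrow> real"
    using that by (cases P) simp_all
  then show ?thesis
    unfolding tan_coord_def
    using det_gram[OF L]
    by (intro differentiable_vec_lambda differentiable_divide differentiable_det)
      (simp_all add: gram_def d z)
qed

lemma normal_part_tan_coord:
  assumes "linear L" "inj L"
  shows "normal_part (g_metric p) (range L) z = z - L (tan_coord L z)"
  unfolding normal_part_def
proof (rule the_equality)
  show "z - (z - L (tan_coord L z)) \<in> range L \<and> (\<forall>t\<in>range L. g_metric p (z - L (tan_coord L z)) t = 0)"
    by (auto simp: g_metric_def inner_simps tan_coord_inner[OF assms])
  fix y assume y: "z - y \<in> range L \<and> (\<forall>t\<in>range L. g_metric p y t = 0)"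
  then obtain c where c: "z - y = L c" by blast
  have "tan_coord L z = c"
  proof (rule tan_coord_unique[OF assms])
    show "L c \<bullet> L x = z \<bullet> L x" for x
      using y unfolding c[symmetric] by (simp add: inner_simps g_metric_def)
  qed
  moreover have "y = z - (z - y)" by simp
  ultimately show "y = z - L (tan_coord L z)" using c by simp
qed

lemma tangent_space_open:
  fixes U :: "'k::euclidean_space set"
  assumes "open U" "q \<in> U"
  shows "tangent_space U q = UNIV"
proof -
  have "a \<in> tangent_space U q" for a
    using tangent_space_curve[of "\<lambda>q. q" q U U a] assms dd_eqI[OF has_derivative_ident, of a q] by simp
  then show ?thesis by blast
qed

text \<open>The inner derivative is taken with the direction \<open>z u\<close> frozen; the motion
  of both directions shows up only in the two extra terms.\<close>

lemma has_derivative_dd_dd_compose: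
  fixes \<sigma> :: "'a::euclidean_space \<Rightarrow> 'b::euclidean_space"
  assumes U: "open U" "smooth_on U \<sigma>" "u \<in> U"
    and y: "y differentiable (at u)" and z: "z differentiable (at u)"
  shows "((\<lambda>u. dd (y u) (dd (z u) \<sigma>) u) has_derivative
     (\<lambda>a. dd a (dd (y u) (dd (z u) \<sigma>)) u + dd (dd a y u) (dd (z u) \<sigma>) u + dd (y u) (dd (dd a z u) \<sigma>) u)) (at u)"
proof -
  note sm = smooth_on_dd[OF U(2)]
  note exp = dd_dd_basis_sum[OF U(1,2)]
  have "((\<lambda>u. \<Sum>i\<in>Basis. (z u \<bullet> i) *\<^sub>R dd (y u) (dd i \<sigma>) u) has_derivative
     (\<lambda>a. \<Sum>i\<in>Basis. (z u \<bullet> i) *\<^sub>R (dd a (dd (y u) (dd i \<sigma>)) u + dd (dd a y u) (dd i \<sigma>) u)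
        + (dd a z u \<bullet> i) *\<^sub>R dd (y u) (dd i \<sigma>) u)) (at u)"
    by (intro has_derivative_sum has_derivative_scaleR has_derivative_inner_left dd_has_derivative[OF z]
      has_derivative_dd_compose[OF U(1) sm U(3) has_derivative_ident dd_has_derivative[OF y] U(1,3)])
  then have "((\<lambda>u. dd (y u) (dd (z u) \<sigma>) u) has_derivative
     (\<lambda>a. \<Sum>i\<in>Basis. (z u \<bullet> i) *\<^sub>R (dd a (dd (y u) (dd i \<sigma>)) u + dd (dd a y u) (dd i \<sigma>) u)
        + (dd a z u \<bullet> i) *\<^sub>R dd (y u) (dd i \<sigma>) u)) (at u)"
    by (rule has_derivative_transform_within_open[OF _ U(1,3)]) (rule exp[symmetric])
  moreover have "dd a (dd (y u) (dd (z u) \<sigma>)) u = (\<Sum>i\<in>Basis. (z u \<bullet> i) *\<^sub>R dd a (dd (y u) (dd i \<sigma>)) u)" for a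
  proof -
    have "dd a (dd (y u) (dd (z u) \<sigma>)) u = dd a (\<lambda>x. \<Sum>i\<in>Basis. (z u \<bullet> i) *\<^sub>R dd (y u) (dd i \<sigma>) x) u"
      by (rule dd_cong_open[OF U(1,3)]) (rule exp)
    also have "\<dots> = (\<Sum>i\<in>Basis. (z u \<bullet> i) *\<^sub>R dd a (dd (y u) (dd i \<sigma>)) u)"
      using smooth_on_differentiable[OF smooth_on_dd[OF sm] U(3)]
      by (subst dd_sum) (auto simp: dd_scaleR_const)
    finally show ?thesis .
  qed
  ultimately show ?thesis
    by (simp only: exp[OF U(3), symmetric] scaleR_add_right sum.distrib)
qed

section \<open>Second fundamental form and its covariant derivative in a chart\<close>

locale sphere_chart =
  fixes U :: "(real ^ 'm::finite) set" and \<sigma> :: "real ^ 'm \<Rightarrow> 'n::{finite,linorder} rvec"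
  assumes open_U: "open U" and smooth: "smooth_on U \<sigma>"
    and inj: "\<And>u. u \<in> U \<Longrightarrow> inj (\<lambda>a. dd a \<sigma> u)"
    and sphere: "\<And>u. u \<in> U \<Longrightarrow> \<sigma> u \<in> sphere 0 1"
begin

abbreviation "tc u \<equiv> tan_coord (\<lambda>a. dd a \<sigma> u)"

lemmas diff0 = smooth_on_differentiable[OF smooth]
lemmas diff1 = smooth_on_differentiable[OF smooth_on_dd[OF smooth]]
lemmas lin = dd_linear[OF diff0]
lemmas lin2 = dd_linear[OF diff1]
lemmas lin2' = dd_dd_linear[OF open_U smooth]

lemma tc_inner: "u \<in> U \<Longrightarrow> dd (tc u z) \<sigma> u \<bullet> dd y \<sigma> u = z \<bullet> dd y \<sigma> u"
  by (rule tan_coord_inner[OF lin inj])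

lemma tangent: "u \<in> U \<Longrightarrow> dd a \<sigma> u \<bullet> \<sigma> u = 0"
  using tangent_space_curve[OF diff0 open_U _ sphere, of u a] tangent_space_sphere[OF sphere, of u] by blast

lemma cov_sphere:
  assumes "u \<in> U" "V differentiable (at u)" "\<And>u. u \<in> U \<Longrightarrow> V u \<bullet> \<sigma> u = 0"
  shows "cov_along (sphere 0 1) g_metric U \<sigma> V u a = sphere_proj (\<sigma> u) (dd a V u)"
proof -
  have "V u \<in> tangent_space (sphere 0 1) (\<sigma> u)" if "u \<in> U" for u
    using assms(3)[OF that] by (simp add: tangent_space_sphere[OF sphere[OF that]])
  from connection.cov_along_eq[OF sphere_connection open_U assms(1) diff0[OF assms(1)] assms(2) sphere this]
  show ?thesis by simp
qed

lemma second_ff_eq: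
  assumes u: "u \<in> U"
  shows "second_ff (sphere 0 1) g_metric U \<sigma> u a b
    = sphere_proj (\<sigma> u) (dd a (dd b \<sigma>) u) - dd (tc u (dd a (dd b \<sigma>) u)) \<sigma> u"
proof -
  have cov: "cov_along (sphere 0 1) g_metric U \<sigma> (dd b \<sigma>) u a = sphere_proj (\<sigma> u) (dd a (dd b \<sigma>) u)"
    by (rule cov_sphere[OF u diff1[OF u] tangent])
  have "tc u (sphere_proj (\<sigma> u) z) = tc u z" for z
    by (rule tan_coord_unique[OF lin inj, OF u u])
      (simp add: tc_inner[OF u] sphere_proj_def inner_simps inner_commute[of "\<sigma> u"] tangent[OF u])
  then show ?thesis
    unfolding second_ff_def dd_def[symmetric]
    using normal_part_tan_coord[OF lin[OF u] inj[OF u]] cov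
    by simp
qed

lemma second_ff_inner:
  assumes u: "u \<in> U" and \<nu>: "\<sigma> u \<bullet> \<nu> = 0" "\<And>a. dd a \<sigma> u \<bullet> \<nu> = 0"
  shows "second_ff (sphere 0 1) g_metric U \<sigma> u a b \<bullet> \<nu> = dd a (dd b \<sigma>) u \<bullet> \<nu>"
  by (simp add: second_ff_eq[OF u] sphere_proj_def inner_simps \<nu>)

lemma induced_metric_derivative:
  assumes Y: "Y \<in> vfields U" and Z: "Z \<in> vfields U" and u: "u \<in> U"
  shows "deriv_along U (\<lambda>p. induced_metric g_metric \<sigma> p (Y p) (Z p)) u d
    = dd (Y u) \<sigma> u \<bullet> (dd d (dd (Z u) \<sigma>) u + dd (dd d Z u) \<sigma> u)
      + (dd d (dd (Y u) \<sigma>) u + dd (dd d Y u) \<sigma> u) \<bullet> dd (Z u) \<sigma> u"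
  unfolding induced_metric_def g_metric_def dd_def[symmetric]
  by (rule deriv_along_eqI[OF _ has_derivative_at_withinI[OF has_derivative_inner[OF
      has_derivative_dd_compose[OF open_U smooth u has_derivative_ident
        dd_has_derivative[OF vfields_differentiable[OF Y u]] open_U u]
      has_derivative_dd_compose[OF open_U smooth u has_derivative_ident
        dd_has_derivative[OF vfields_differentiable[OF Z u]] open_U u]]]])
    (simp_all add: tangent_space_open[OF open_U u])

text \<open>The Christoffel symbols of an induced metric are the coordinates of the tangential part
  of the second derivatives of \<open>\<sigma>\<close>. Koszul's formula then reduces to the
  symmetry of these derivatives.\<close>

lemma chart_connection:
  "connection U (induced_metric g_metric \<sigma>) (\<lambda>q e. e) (\<lambda>q e. e) (\<lambda>q v y. tc q (dd v (dd y \<sigma>) q))"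
proof (rule connection.intro)
  note T = tangent_space_open[OF open_U]
  show "(\<lambda>q. e) \<in> vfields U" for e by (rule vfieldsI) (simp_all add: smooth_on_const T)
  show "linear (\<lambda>e::real^'m. e)" by (rule linear_id[unfolded id_def])
  show "linear (\<lambda>e::real^'m. e)" by (rule linear_id[unfolded id_def])
  show "linear (\<lambda>y. tc q (dd v (dd y \<sigma>) q))" if "q \<in> U" for q v
    using linear_compose[OF lin2'[OF that, of v] tan_coord_linear[OF lin[OF that] inj[OF that]]]
    by (simp add: o_def)
  show "z = z'" if q: "q \<in> U" and z: "\<And>t. t \<in> tangent_space U q \<Longrightarrow>
    induced_metric g_metric \<sigma> q z t = induced_metric g_metric \<sigma> q z' t" for q z z'
  proof -
    note L = lin[OF q]
    have "dd z \<sigma> q \<bullet> dd (z - z') \<sigma> q = dd z' \<sigma> q \<bullet> dd (z - z') \<sigma> q"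
      using z[of "z - z'"] by (simp add: T[OF q] induced_metric_def g_metric_def dd_def)
    then have "dd (z - z') \<sigma> q \<bullet> dd (z - z') \<sigma> q = 0"
      unfolding linear_diff[OF L] by (simp add: inner_simps)
    then show ?thesis using linear_injective_0[OF L] inj[OF q] by auto
  qed
  show "2 * induced_metric g_metric \<sigma> q (dd (X q) Y q + tc q (dd (X q) (dd (Y q) \<sigma>) q)) (Z q)
    = koszul U (induced_metric g_metric \<sigma>) X Y Z q"
    if X: "X \<in> vfields U" and Y: "Y \<in> vfields U" and Z: "Z \<in> vfields U" and q: "q \<in> U" for X Y Z q
  proof -
    have im: "induced_metric g_metric \<sigma> q a b = dd a \<sigma> q \<bullet> dd b \<sigma> q" for a b
      by (simp add: induced_metric_def g_metric_def dd_def)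
    note L = lin[OF q]
    have sym: "dd a (dd b \<sigma>) q = dd b (dd a \<sigma>) q" for a b
      by (rule smooth_dd_commute[OF open_U smooth q])
    show ?thesis
      unfolding koszul_def induced_metric_derivative[OF Y Z q] induced_metric_derivative[OF X Z q]
        induced_metric_derivative[OF X Y q] lie_bracket_eq[OF X Y q] lie_bracket_eq[OF X Z q]
        lie_bracket_eq[OF Y Z q] im linear_diff[OF L] linear_add[OF L]
      unfolding inner_simps tc_inner[OF q] sym[of "Y q" "X q"] sym[of "Z q" "X q"] sym[of "Z q" "Y q"]
      by (simp add: inner_commute)
  qed
qed (use tangent_space_open[OF open_U] in auto)

lemma chart_levi_civita:
  assumes "u \<in> U" "smooth_on U Y"
  shows "levi_civita U (induced_metric g_metric \<sigma>) v Y u = dd v Y u + tc u (dd v (dd (Y u) \<sigma>) u)"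
proof (rule connection.levi_civita_eq[OF chart_connection assms(1)])
  show "v \<in> tangent_space U u" by (simp add: tangent_space_open[OF open_U assms(1)])
  show "Y \<in> vfields U" unfolding vfields_def
    using assms(2) open_U tangent_space_open[OF open_U] by blast
qed

text \<open>The derivatives of \<open>Y\<close> and \<open>Z\<close> cancel between the three terms,
  so only values at \<open>u\<close> remain. Differentiating the coordinates \<open>?c\<close> of
  the tangential part gives a tangential vector, which \<open>\<nu>\<close> does not see.\<close>

lemma nabla_II_inner:
  assumes u: "u \<in> U" and \<nu>: "\<sigma> u \<bullet> \<nu> = 0" "\<And>a. dd a \<sigma> u \<bullet> \<nu> = 0"
    and Y: "smooth_on U Y" and Z: "smooth_on U Z"
  shows "nabla_II (sphere 0 1) g_metric U \<sigma> X Y Z u \<bullet> \<nu>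
    = (dd (X u) (dd (Y u) (dd (Z u) \<sigma>)) u
       - dd (X u) (dd (tc u (dd (Y u) (dd (Z u) \<sigma>) u)) \<sigma>) u
       - dd (tc u (dd (X u) (dd (Y u) \<sigma>) u)) (dd (Z u) \<sigma>) u
       - dd (Y u) (dd (tc u (dd (X u) (dd (Z u) \<sigma>) u)) \<sigma>) u) \<bullet> \<nu>"
proof -
  let ?B = "\<lambda>u. dd (Y u) (dd (Z u) \<sigma>) u" and ?a = "X u"
  let ?c = "\<lambda>u. tc u (?B u)"
  let ?\<eta> = "\<lambda>u. second_ff (sphere 0 1) g_metric U \<sigma> u (Y u) (Z u)"
  let ?\<eta>' = "\<lambda>u. sphere_proj (\<sigma> u) (?B u) - dd (?c u) \<sigma> u"
  note dY = smooth_on_differentiable[OF Y u] and dZ = smooth_on_differentiable[OF Z u]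
  note B = has_derivative_dd_dd_compose[OF open_U smooth u dY dZ]
  have dB: "?B differentiable (at u)" using B unfolding differentiable_def by blast
  \<comment> \<open>Mere differentiability suffices here, and Cramer's rule provides it.\<close>
  have dc: "?c differentiable (at u)"
    by (rule differentiable_tan_coord[OF lin[OF u] inj[OF u] diff1[OF u] dB])
  have D: "(?\<eta>' has_derivative (\<lambda>a. (dd a ?B u - ((?B u \<bullet> \<sigma> u) *\<^sub>R dd a \<sigma> u + (?B u \<bullet> dd a \<sigma> u + dd a ?B u \<bullet> \<sigma> u) *\<^sub>R \<sigma> u))
      - (dd a (dd (?c u) \<sigma>) u + dd (dd a ?c u) \<sigma> u))) (at u)"
    unfolding sphere_proj_def
    by (intro has_derivative_diff has_derivative_scaleR has_derivative_inner dd_has_derivative[OF dB]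
      dd_has_derivative[OF diff0[OF u]]
      has_derivative_dd_compose[OF open_U smooth u has_derivative_ident dd_has_derivative[OF dc] open_U u])
  have D\<eta>: "(?\<eta> has_derivative (\<lambda>a. (dd a ?B u - ((?B u \<bullet> \<sigma> u) *\<^sub>R dd a \<sigma> u + (?B u \<bullet> dd a \<sigma> u + dd a ?B u \<bullet> \<sigma> u) *\<^sub>R \<sigma> u))
      - (dd a (dd (?c u) \<sigma>) u + dd (dd a ?c u) \<sigma> u))) (at u)"
    by (rule has_derivative_transform_within_open[OF D open_U u]) (rule second_ff_eq[symmetric])
  have \<eta>tan: "?\<eta> u \<bullet> \<sigma> u = 0" if "u \<in> U" for u
    using sphere[OF that] by (simp add: second_ff_eq[OF that] inner_simps tangent[OF that] sphere_proj_def norm_eq_1)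
  have d\<eta>: "?\<eta> differentiable (at u)" using D\<eta> unfolding differentiable_def by blast
  have cov: "cov_along (sphere 0 1) g_metric U \<sigma> ?\<eta> u ?a = sphere_proj (\<sigma> u) (dd ?a ?\<eta> u)"
    by (rule cov_sphere[OF u d\<eta>]) (rule \<eta>tan)
  have "normal_connection (sphere 0 1) g_metric U \<sigma> ?\<eta> u ?a \<bullet> \<nu>
    = (sphere_proj (\<sigma> u) (dd ?a ?\<eta> u) - dd (tc u (sphere_proj (\<sigma> u) (dd ?a ?\<eta> u))) \<sigma> u) \<bullet> \<nu>"
    unfolding normal_connection_def dd_def[symmetric] cov
      normal_part_tan_coord[OF lin[OF u] inj[OF u]] ..
  also have "\<dots> = dd ?a ?\<eta> u \<bullet> \<nu>"
    by (simp add: inner_simps \<nu> sphere_proj_def)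
  also have "\<dots> = (dd ?a ?B u - dd ?a (dd (?c u) \<sigma>) u) \<bullet> \<nu>"
    unfolding dd_eqI[OF D\<eta>] by (simp add: inner_simps \<nu>)
  finally have 1: "normal_connection (sphere 0 1) g_metric U \<sigma> ?\<eta> u ?a \<bullet> \<nu> = \<dots>" .
  have 2: "dd ?a ?B u = dd ?a (dd (Y u) (dd (Z u) \<sigma>)) u + dd (dd ?a Y u) (dd (Z u) \<sigma>) u + dd (Y u) (dd (dd ?a Z u) \<sigma>) u"
    by (rule dd_eqI[OF B])
  show ?thesis
    unfolding nabla_II_def inner_diff_left 1 2 second_ff_inner[OF u \<nu>] chart_levi_civita[OF u Y] chart_levi_civita[OF u Z]
      linear_add[OF lin2[OF u]] linear_add[OF lin2'[OF u]]
    by (simp add: inner_simps)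
qed

end

section \<open>Mean curvature of a Legendrian immersion\<close>

lemma orthonormal_independent:
  fixes g :: "'d::real_vector \<Rightarrow> 'd \<Rightarrow> real"
  assumes "finite I" and g: "\<And>b. linear (\<lambda>a. g a b)"
    and e: "\<And>i j. i \<in> I \<Longrightarrow> j \<in> I \<Longrightarrow> g (e i) (e j) = (if i = j then 1 else 0)"
  shows "inj_on e I" "independent (e ` I)"
proof -
  show inj: "inj_on e I"
    by (rule inj_onI) (metis e zero_neq_one)
  show "independent (e ` I)"
  proof (subst independent_explicit_finite_subsets, intro allI impI ballI)
    fix A c v assume A: "A \<subseteq> e ` I" "finite A" and 0: "(\<Sum>v\<in>A. c v *\<^sub>R v) = 0" and v: "v \<in> A"
    have "g w v = (if w = v then 1 else 0)" if "w \<in> A" for w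
    proof -
      obtain i j where "i \<in> I" "j \<in> I" "w = e i" "v = e j" using \<open>w \<in> A\<close> v A by blast
      then show ?thesis using e inj_on_eq_iff[OF inj] by simp
    qed
    then have "(\<Sum>w\<in>A. c w * g w v) = (\<Sum>w\<in>A. if w = v then c w else 0)"
      by (intro sum.cong) auto
    also have "\<dots> = c v" using A v by simp
    finally have "c v = g (\<Sum>w\<in>A. c w *\<^sub>R w) v"
      by (simp add: linear_sum[OF g] linear_cmul[OF g])
    then show "c v = 0" using 0 linear_0[OF g] by simp
  qed
qed

lemma orthonormal_expand:
  fixes g :: "'d::real_vector \<Rightarrow> 'd \<Rightarrow> real"
  assumes "finite I" and g: "\<And>b. linear (\<lambda>a. g a b)"
    and e: "\<And>i j. i \<in> I \<Longrightarrow> j \<in> I \<Longrightarrow> g (e i) (e j) = (if i = j then 1 else 0)"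
    and v: "v \<in> span (e ` I)"
  shows "v = (\<Sum>i\<in>I. g v (e i) *\<^sub>R e i)"
proof -
  have inj: "inj_on e I" by (rule orthonormal_independent[of I g e]) (use assms in auto)
  obtain c where "v = (\<Sum>x\<in>e ` I. c x *\<^sub>R x)"
    using v span_finite[of "e ` I"] assms(1) by auto
  then have c: "v = (\<Sum>i\<in>I. c (e i) *\<^sub>R e i)" by (simp add: sum.reindex[OF inj])
  have "g v (e j) = c (e j)" if j: "j \<in> I" for j
  proof -
    have "g v (e j) = (\<Sum>i\<in>I. c (e i) * g (e i) (e j))"
      unfolding c by (simp add: linear_sum[OF g] linear_cmul[OF g])
    also have "\<dots> = (\<Sum>i\<in>I. if i = j then c (e i) else 0)"
      using e j by (intro sum.cong) auto
    also have "\<dots> = c (e j)" using j assms(1) by simp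
    finally show ?thesis .
  qed
  then show ?thesis using c by simp
qed

lemma orthonormal_span_subspace:
  fixes g :: "'d::euclidean_space \<Rightarrow> 'd \<Rightarrow> real"
  assumes "finite I" and g: "\<And>b. linear (\<lambda>a. g a b)"
    and e: "\<And>i j. i \<in> I \<Longrightarrow> j \<in> I \<Longrightarrow> g (e i) (e j) = (if i = j then 1 else 0)"
    and T: "subspace T" "e ` I \<subseteq> T" "dim T \<le> card I"
  shows "span (e ` I) = T"
proof -
  note oi = orthonormal_independent[of I g e, OF assms(1) g e]
  have "dim T \<le> card (e ` I)" using T(3) card_image[OF oi(1)] by simp
  then have "T \<subseteq> span (e ` I)"
    by (intro card_ge_dim_independent[OF T(2) oi(2)])
  moreover have "span (e ` I) \<subseteq> T" using T(1,2) span_minimal by blast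
  ultimately show ?thesis by blast
qed

text \<open>Expand one copy of \<open>e\<close> in \<open>e'\<close>, exchange the sums, and
  recombine the other copy. This makes the description in \<open>mean_curvature\<close> independent
  of the frame.\<close>

lemma trace_orthonormal_invariant:
  fixes g :: "'d::euclidean_space \<Rightarrow> 'd \<Rightarrow> real" and B :: "'d \<Rightarrow> 'd \<Rightarrow> 'k::real_vector"
  assumes "finite I" "card I = DIM('d)" and g: "\<And>b. linear (\<lambda>a. g a b)" "\<And>a b. g a b = g b a"
    and B: "\<And>b. linear (\<lambda>a. B a b)" "\<And>a. linear (B a)"
    and e: "\<And>i j. i \<in> I \<Longrightarrow> j \<in> I \<Longrightarrow> g (e i) (e j) = (if i = j then 1 else 0)"
    and e': "\<And>i j. i \<in> I \<Longrightarrow> j \<in> I \<Longrightarrow> g (e' i) (e' j) = (if i = j then 1 else 0)"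
  shows "(\<Sum>i\<in>I. B (e i) (e i)) = (\<Sum>i\<in>I. B (e' i) (e' i))"
proof -
  have ex: "v = (\<Sum>i\<in>I. g v (f i) *\<^sub>R f i)"
    if f: "\<And>i j. i \<in> I \<Longrightarrow> j \<in> I \<Longrightarrow> g (f i) (f j) = (if i = j then 1 else 0)" for v f
  proof (rule orthonormal_expand[of I g f, OF assms(1) g(1) f])
    have "span (f ` I) = UNIV"
      by (rule orthonormal_span_subspace[of I g f, OF assms(1) g(1) f]) (use assms(2) in auto)
    then show "v \<in> span (f ` I)" by simp
  qed
  have "(\<Sum>i\<in>I. B (e i) (e i)) = (\<Sum>i\<in>I. B (\<Sum>k\<in>I. g (e i) (e' k) *\<^sub>R e' k) (e i))"
    using ex[of e', OF e'] by simp
  also have "\<dots> = (\<Sum>i\<in>I. \<Sum>k\<in>I. g (e i) (e' k) *\<^sub>R B (e' k) (e i))"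
    by (simp add: linear_sum[OF B(1)] linear_cmul[OF B(1)])
  also have "\<dots> = (\<Sum>k\<in>I. \<Sum>i\<in>I. g (e i) (e' k) *\<^sub>R B (e' k) (e i))"
    by (rule sum.swap)
  also have "\<dots> = (\<Sum>k\<in>I. B (e' k) (\<Sum>i\<in>I. g (e' k) (e i) *\<^sub>R e i))"
    by (simp add: linear_sum[OF B(2)] linear_cmul[OF B(2)] g(2)[of "e' _" "e _"])
  also have "\<dots> = (\<Sum>k\<in>I. B (e' k) (e' k))"
    using ex[of e, OF e] by simp
  finally show ?thesis .
qed

text \<open>The domain stays all of \<open>W\<close>, since \<open>cov_along\<close> demands a
  decomposition over it; second derivatives are only required at \<open>w\<^sub>0\<close>.\<close>

locale legendrian =
  fixes W :: "(real ^ 'b::finite) set" and \<mu> :: "real ^ 'b \<Rightarrow> 'n::{finite,linorder} rvec \<times> 'n rvec"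
    and w\<^sub>0 :: "real ^ 'b"
  assumes card: "CARD('n) \<ge> 3"
    and open_W: "open W" and w0: "w\<^sub>0 \<in> W"
    and diff: "\<And>w. w \<in> W \<Longrightarrow> \<mu> differentiable (at w)"
    and diff2: "\<And>a. dd a \<mu> differentiable (at w\<^sub>0)"
    and ut: "\<And>w. w \<in> W \<Longrightarrow> \<mu> w \<in> unit_tangent_bundle"
    and contact: "\<And>w a. w \<in> W \<Longrightarrow> fst (dd a \<mu> w) \<bullet> snd (\<mu> w) = 0"
begin

abbreviation "q\<^sub>0 \<equiv> \<mu> w\<^sub>0"
abbreviation "D \<equiv> \<lambda>a. dd a \<mu> w\<^sub>0"
abbreviation "DD \<equiv> \<lambda>a b. dd a (dd b \<mu>) w\<^sub>0"

lemma tangent: "w \<in> W \<Longrightarrow> dd a \<mu> w \<in> ut_tangent (\<mu> w)"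
  using tangent_space_curve[OF diff open_W _ ut] tangent_space_ut[OF ut] by blast

lemma D_tangent: "D a \<in> ut_tangent q\<^sub>0"
  by (rule tangent[OF w0])

lemma D_linear: "linear D"
  by (rule dd_linear[OF diff[OF w0]])

lemma DD_linear_left: "linear (\<lambda>a. DD a b)"
  by (rule dd_linear[OF diff2])

lemma DD_commute: "DD a b = DD b a"
  by (rule dd_dd_commute[OF open_W w0 diff diff2 diff2])

lemma DD_linear_right: "linear (\<lambda>b. DD a b)"
  unfolding DD_commute[of a] by (rule DD_linear_left)

lemma J_D: "J_end q\<^sub>0 (D c) = (- snd (D c), fst (D c))" "J_end q\<^sub>0 (D c) \<in> ut_tangent q\<^sub>0"
  using J_end_eq[OF card ut[OF w0] D_tangent[of c]] by (simp_all add: contact[OF w0])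

text \<open>The differential of the contact form vanishes on the image: differentiate
  \<open>contact\<close> and antisymmetrise, using that second derivatives commute.\<close>

lemma lagrangian: "fst (D a) \<bullet> snd (D c) = fst (D c) \<bullet> snd (D a)"
proof -
  have 1: "fst (DD c a) \<bullet> snd q\<^sub>0 = - (fst (D a) \<bullet> snd (D c))" for a c
  proof -
    have "((\<lambda>w. fst (dd a \<mu> w) \<bullet> snd (\<mu> w)) has_derivative
      (\<lambda>c. fst (D a) \<bullet> snd (D c) + fst (DD c a) \<bullet> snd q\<^sub>0)) (at w\<^sub>0)"
      by (intro has_derivative_inner has_derivative_fst has_derivative_snd
        dd_has_derivative[OF diff2] dd_has_derivative[OF diff[OF w0]])
    then have "((\<lambda>w. 0) has_derivative (\<lambda>c. fst (D a) \<bullet> snd (D c) + fst (DD c a) \<bullet> snd q\<^sub>0)) (at w\<^sub>0)"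
      by (rule has_derivative_transform_within_open[OF _ open_W w0]) (rule contact)
    from dd_eqI[OF this, of c] show ?thesis by (simp add: dd_def)
  qed
  show ?thesis using 1[of c a] 1[of a c] DD_commute[of a c] by simp
qed

lemma cov_eq:
  "cov_along unit_tangent_bundle h_metric W \<mu> (dd b \<mu>) w\<^sub>0 a = ut_conn q\<^sub>0 (DD a b) + ut_gamma q\<^sub>0 (D a) (D b)"
proof (rule connection.cov_along_eq[OF ut_connection[OF card] open_W w0 diff[OF w0] diff2 ut])
  show "dd b \<mu> w \<in> tangent_space unit_tangent_bundle (\<mu> w)" if "w \<in> W" for w
    using tangent[OF that] by (simp add: tangent_space_ut[OF ut[OF that]])
qed

abbreviation "cov a b \<equiv> ut_conn q\<^sub>0 (DD a b) + ut_gamma q\<^sub>0 (D a) (D b)"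

lemma cov_tangent: "cov a b \<in> ut_tangent q\<^sub>0"
  unfolding ut_conn_def ut_gamma_def
  by (intro subspace_add[OF ut_tangent_subspace] ut_riesz_tangent ut[OF w0])

text \<open>All factors of the contact form vanish on \<open>D a\<close> and \<open>D b\<close>.
  What is left of \<open>ut_gamma\<close> is a multiple of \<open>snd q\<^sub>0\<close> in the first
  slot, paired with \<open>- snd (D c)\<close>, which is orthogonal to it.\<close>

lemma sasaki_cov_J: "sasaki q\<^sub>0 (cov a b) (J_end q\<^sub>0 (D c))
  = snd (DD a b) \<bullet> fst (D c) - fst (DD a b) \<bullet> snd (D c)"
  unfolding sasaki_add_left
  unfolding ut_conn_def ut_gamma_def sasaki_riesz[OF ut[OF w0] J_D(2)]
  using ut_tangentD[OF D_tangent[of c]]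
  by (simp add: J_D inner_simps contact[OF w0])

text \<open>The Lagrangian condition in metric form: \<open>J_end\<close> maps tangent vectors of
  the immersion to normal ones, so tangential parts do not contribute to the pairing.\<close>

lemma sasaki_D_J: "sasaki q\<^sub>0 (D a) (J_end q\<^sub>0 (D c)) = 0"
  using lagrangian[of a c]
  by (simp add: J_D sasaki_def contact[OF w0] inner_commute[of "snd (D a)"])

lemma pullback_linear: "linear (\<lambda>a. sasaki q\<^sub>0 (D a) Y)"
  by (rule linearI)
    (simp_all add: linear_add[OF D_linear] linear_cmul[OF D_linear] sasaki_add_left sasaki_scaleR_left)

context
  fixes e :: "nat \<Rightarrow> real ^ 'b"
  assumes e: "\<And>i j. i \<in> {1..CARD('b)} \<Longrightarrow> j \<in> {1..CARD('b)} \<Longrightarrow>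
    sasaki q\<^sub>0 (D (e i)) (D (e j)) = (if i = j then 1 else 0)"
begin

lemma frame_expand: "v = (\<Sum>i\<in>{1..CARD('b)}. sasaki q\<^sub>0 (D v) (D (e i)) *\<^sub>R e i)"
proof (rule orthonormal_expand[of "{1..CARD('b)}" "\<lambda>a b. sasaki q\<^sub>0 (D a) (D b)" e v])
  have "span (e ` {1..CARD('b)}) = UNIV"
    by (rule orthonormal_span_subspace[of _ "\<lambda>a b. sasaki q\<^sub>0 (D a) (D b)"])
      (auto simp: e pullback_linear)
  then show "v \<in> span (e ` {1..CARD('b)})" by simp
qed (auto simp: e pullback_linear)

lemma D_frame_expand: "D v = (\<Sum>i\<in>{1..CARD('b)}. sasaki q\<^sub>0 (D v) (D (e i)) *\<^sub>R D (e i))"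
  by (subst frame_expand[of v]) (simp only: linear_sum[OF D_linear] linear_cmul[OF D_linear])

text \<open>Orthogonal projection to the tangent space of the immersion, written in the frame
  \<open>e\<close>.\<close>

definition "tpart z = (\<Sum>i\<in>{1..CARD('b)}. sasaki q\<^sub>0 z (D (e i)) *\<^sub>R D (e i))"

lemma tpart_range: "tpart z \<in> range D"
proof -
  have "tpart z = D (\<Sum>i\<in>{1..CARD('b)}. sasaki q\<^sub>0 z (D (e i)) *\<^sub>R e i)"
    unfolding tpart_def by (simp only: linear_sum[OF D_linear] linear_cmul[OF D_linear])
  then show ?thesis by blast
qed

lemma tpart_tangent: "tpart z \<in> ut_tangent q\<^sub>0"
proof -
  obtain a where "tpart z = D a" using tpart_range[of z] by blast
  then show ?thesis using D_tangent[of a] by simp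
qed

lemma sasaki_linear: "linear (\<lambda>X. sasaki q X Y)"
  by (rule linearI) (simp_all add: sasaki_add_left sasaki_scaleR_left)

lemma tpart_linear: "linear tpart"
  by (rule linearI)
    (simp_all add: tpart_def sasaki_add_left sasaki_scaleR_left scaleR_add_left sum.distrib scaleR_sum_right)

lemma sasaki_tpart: "sasaki q\<^sub>0 (tpart z) (D v) = sasaki q\<^sub>0 z (D v)"
proof -
  have "sasaki q\<^sub>0 (tpart z) (D v) = (\<Sum>i\<in>{1..CARD('b)}. sasaki q\<^sub>0 z (D (e i)) * sasaki q\<^sub>0 (D v) (D (e i)))"
    unfolding tpart_def linear_sum[OF sasaki_linear] sasaki_scaleR_left
    by (intro sum.cong refl) (simp add: sasaki_commute[of q\<^sub>0 "D v"])
  also have "\<dots> = sasaki q\<^sub>0 (\<Sum>i\<in>{1..CARD('b)}. sasaki q\<^sub>0 (D v) (D (e i)) *\<^sub>R D (e i)) z"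
    unfolding linear_sum[OF sasaki_linear] sasaki_scaleR_left
    by (intro sum.cong refl) (simp add: sasaki_commute[of q\<^sub>0 z])
  also have "\<dots> = sasaki q\<^sub>0 (D v) z" using D_frame_expand[of v] by simp
  finally show ?thesis by (simp add: sasaki_commute)
qed

lemma normal_part_eq:
  assumes z: "z \<in> ut_tangent q\<^sub>0"
  shows "normal_part (h_metric q\<^sub>0) (range D) z = z - tpart z"
  unfolding normal_part_def
proof (rule the_equality)
  note q = ut[OF w0] and sub = ut_tangent_subspace[of q\<^sub>0]
  have zt: "z - tpart z \<in> ut_tangent q\<^sub>0" by (rule subspace_diff[OF sub z tpart_tangent])
  show "z - (z - tpart z) \<in> range D \<and> (\<forall>t\<in>range D. h_metric q\<^sub>0 (z - tpart z) t = 0)"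
    using tpart_range by (auto simp: h_metric_eq[OF card q zt D_tangent] sasaki_diff_left sasaki_tpart)
  fix y assume y: "z - y \<in> range D \<and> (\<forall>t\<in>range D. h_metric q\<^sub>0 y t = 0)"
  obtain b where b: "tpart z = D b" using tpart_range[of z] by blast
  obtain a where a: "z - y = D a" using y by blast
  note ab = a b
  have "z - y \<in> ut_tangent q\<^sub>0" using D_tangent[of a] a by simp
  from subspace_diff[OF sub z this] have yt: "y \<in> ut_tangent q\<^sub>0" by simp
  let ?d = "y - (z - tpart z)"
  have d: "?d = D (b - a)" unfolding linear_diff[OF D_linear] ab[symmetric] by simp
  have "sasaki q\<^sub>0 y (D (b - a)) = 0"
    using y by (simp add: h_metric_eq[OF card q yt D_tangent, symmetric])
  moreover have "sasaki q\<^sub>0 (z - tpart z) (D (b - a)) = 0"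
    by (simp add: sasaki_diff_left sasaki_tpart)
  ultimately have "sasaki q\<^sub>0 ?d ?d = 0"
    unfolding d[symmetric] by (simp add: sasaki_diff_left)
  moreover have "?d \<in> ut_tangent q\<^sub>0" unfolding d by (rule D_tangent)
  ultimately have "?d = 0" using sasaki_definite[OF q] by blast
  then show "y = z - tpart z" by simp
qed

lemma second_ff_eq:
  "second_ff unit_tangent_bundle h_metric W \<mu> w\<^sub>0 a b = cov a b - tpart (cov a b)"
  unfolding second_ff_def dd_def[symmetric] using cov_eq normal_part_eq[OF cov_tangent] by simp

lemma mean_curvature_eq:
  "mean_curvature unit_tangent_bundle h_metric W \<mu> w\<^sub>0
    = (\<Sum>i=1..CARD('b). cov (e i) (e i) - tpart (cov (e i) (e i)))"
proof -
  let ?B = "\<lambda>a b. cov a b - tpart (cov a b)"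
  have l1: "linear (\<lambda>a. cov a b)" for b
    using linear_compose_add[OF linear_compose[OF DD_linear_left ut_conn_linear]
        linear_compose[OF D_linear ut_gamma_linear_left]] by (simp add: o_def)
  have l2: "linear (\<lambda>b. cov a b)" for a
    using linear_compose_add[OF linear_compose[OF DD_linear_right ut_conn_linear]
        linear_compose[OF D_linear ut_gamma_linear]] by (simp add: o_def)
  have B1: "linear (\<lambda>a. ?B a b)" for b
    using l1 linear_compose[OF l1 tpart_linear, unfolded o_def] by (rule linear_compose_sub)
  have B2: "linear (?B a)" for a
    using l2 linear_compose[OF l2 tpart_linear, unfolded o_def] by (rule linear_compose_sub)
  have metric: "h_metric (\<mu> w\<^sub>0) (frechet_derivative \<mu> (at w\<^sub>0) a) (frechet_derivative \<mu> (at w\<^sub>0) b)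
    = sasaki q\<^sub>0 (D a) (D b)" for a b
    using h_metric_eq[OF card ut[OF w0] D_tangent D_tangent] by (simp add: dd_def)
  show ?thesis
    unfolding mean_curvature_def second_ff_eq metric
  proof (rule the_equality)
    show "\<forall>e'. (\<forall>i\<in>{1..DIM(real^'b)}. \<forall>j\<in>{1..DIM(real^'b)}. sasaki q\<^sub>0 (D (e' i)) (D (e' j)) = (if i = j then 1 else 0)) \<longrightarrow>
      (\<Sum>i=1..CARD('b). ?B (e i) (e i)) = (\<Sum>i=1..DIM(real^'b). ?B (e' i) (e' i))"
    proof (intro allI impI)
      fix e' :: "nat \<Rightarrow> real^'b"
      assume "\<forall>i\<in>{1..DIM(real^'b)}. \<forall>j\<in>{1..DIM(real^'b)}. sasaki q\<^sub>0 (D (e' i)) (D (e' j)) = (if i = j then 1 else 0)"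
      then have e': "sasaki q\<^sub>0 (D (e' i)) (D (e' j)) = (if i = j then 1 else 0)"
        if "i \<in> {1..CARD('b)}" "j \<in> {1..CARD('b)}" for i j
        using that by simp
      have "(\<Sum>i\<in>{1..CARD('b)}. ?B (e i) (e i)) = (\<Sum>i\<in>{1..CARD('b)}. ?B (e' i) (e' i))"
      proof (rule trace_orthonormal_invariant[of _ "\<lambda>a b. sasaki q\<^sub>0 (D a) (D b)" ?B])
        show "linear (\<lambda>a. sasaki q\<^sub>0 (D a) (D b))" for b by (rule pullback_linear)
        show "sasaki q\<^sub>0 (D a) (D b) = sasaki q\<^sub>0 (D b) (D a)" for a b by (rule sasaki_commute)
      qed (use e e' B1 B2 in auto)
      then show "(\<Sum>i=1..CARD('b). ?B (e i) (e i)) = (\<Sum>i=1..DIM(real^'b). ?B (e' i) (e' i))" by simp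
    qed
    fix H assume "\<forall>e'. (\<forall>i\<in>{1..DIM(real^'b)}. \<forall>j\<in>{1..DIM(real^'b)}. sasaki q\<^sub>0 (D (e' i)) (D (e' j)) = (if i = j then 1 else 0)) \<longrightarrow>
      H = (\<Sum>i=1..DIM(real^'b). ?B (e' i) (e' i))"
    then show "H = (\<Sum>i=1..CARD('b). ?B (e i) (e i))" using e by simp
  qed
qed

lemma mean_curvature_J:
  "h_metric q\<^sub>0 (mean_curvature unit_tangent_bundle h_metric W \<mu> w\<^sub>0) (J_end q\<^sub>0 (D c))
    = (\<Sum>i=1..CARD('b). snd (DD (e i) (e i)) \<bullet> fst (D c) - fst (DD (e i) (e i)) \<bullet> snd (D c))"
proof -
  have "(\<Sum>i=1..CARD('b). cov (e i) (e i) - tpart (cov (e i) (e i))) \<in> ut_tangent q\<^sub>0"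
    by (intro subspace_sum[OF ut_tangent_subspace] subspace_diff[OF ut_tangent_subspace] cov_tangent tpart_tangent)
  moreover have "sasaki q\<^sub>0 (tpart z) (J_end q\<^sub>0 (D c)) = 0" for z
    using tpart_range[of z] sasaki_D_J by auto
  ultimately show ?thesis
    by (simp add: mean_curvature_eq h_metric_eq[OF card ut[OF w0] _ J_D(2)] linear_sum[OF sasaki_linear]
      sasaki_diff_left sasaki_cov_J)
qed

end

end

section \<open>The spherical Gauss map\<close>

locale gauss_chart = sphere_chart U \<sigma>
  for U :: "(real ^ 'm::finite) set" and \<sigma> :: "real ^ 'm \<Rightarrow> 'n::{finite,linorder} rvec" +
  fixes W :: "(real ^ 'b::finite) set" and u :: "real ^ 'b \<Rightarrow> real ^ 'm" and \<nu> :: "real ^ 'b \<Rightarrow> 'n rvec"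
  assumes open_W: "open W" and smooth_u: "smooth_on W u" and smooth_\<nu>: "smooth_on W \<nu>"
    and u_in: "\<And>w. w \<in> W \<Longrightarrow> u w \<in> U"
    and \<nu>_unit: "\<And>w. w \<in> W \<Longrightarrow> \<nu> w \<bullet> \<nu> w = 1"
    and \<nu>_foot: "\<And>w. w \<in> W \<Longrightarrow> \<nu> w \<bullet> \<sigma> (u w) = 0"
    and \<nu>_normal: "\<And>w a. w \<in> W \<Longrightarrow> \<nu> w \<bullet> dd a \<sigma> (u w) = 0"
begin

definition \<mu> :: "real ^ 'b \<Rightarrow> 'n rvec \<times> 'n rvec" where
  "\<mu> w = (\<sigma> (u w), \<nu> w)"

lemmas du = dd_has_derivative[OF smooth_on_differentiable[OF smooth_u]]
lemmas ddu = dd_has_derivative[OF smooth_on_differentiable[OF smooth_on_dd[OF smooth_u]]]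
lemmas d\<nu> = dd_has_derivative[OF smooth_on_differentiable[OF smooth_\<nu>]]
lemmas dd\<nu> = dd_has_derivative[OF smooth_on_differentiable[OF smooth_on_dd[OF smooth_\<nu>]]]

lemma \<mu>_derivative:
  assumes w: "w \<in> W"
  shows "(\<mu> has_derivative (\<lambda>a. (dd (dd a u w) \<sigma> (u w), dd a \<nu> w))) (at w)"
  unfolding \<mu>_def[abs_def]
  by (intro has_derivative_Pair d\<nu>[OF w] has_derivative_dd_chain[OF du[OF w] diff0[OF u_in[OF w]]])

lemma dd_\<mu>: "w \<in> W \<Longrightarrow> dd a \<mu> w = (dd (dd a u w) \<sigma> (u w), dd a \<nu> w)"
  by (rule dd_eqI[OF \<mu>_derivative])

lemma dd_\<mu>_derivative:
  assumes w: "w \<in> W"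
  shows "(dd b \<mu> has_derivative (\<lambda>a. (dd (dd a u w) (dd (dd b u w) \<sigma>) (u w) + dd (dd a (dd b u) w) \<sigma> (u w),
    dd a (dd b \<nu>) w))) (at w)"
proof (rule has_derivative_transform_within_open[OF _ open_W w])
  show "((\<lambda>w. (dd (dd b u w) \<sigma> (u w), dd b \<nu> w)) has_derivative
    (\<lambda>a. (dd (dd a u w) (dd (dd b u w) \<sigma>) (u w) + dd (dd a (dd b u) w) \<sigma> (u w), dd a (dd b \<nu>) w))) (at w)"
    by (intro has_derivative_Pair dd\<nu>[OF w] has_derivative_dd_compose[OF open_U smooth u_in[OF w]
      du[OF w] ddu[OF w] open_W w u_in])
qed (simp add: dd_\<mu>)

lemma dd_dd_\<mu>:
  "w \<in> W \<Longrightarrow> dd a (dd b \<mu>) w = (dd (dd a u w) (dd (dd b u w) \<sigma>) (u w) + dd (dd a (dd b u) w) \<sigma> (u w), dd a (dd b \<nu>) w)"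
  by (rule dd_eqI[OF dd_\<mu>_derivative])

lemma weingarten:
  assumes w: "w \<in> W"
  shows "\<nu> w \<bullet> dd (dd a u w) (dd y \<sigma>) (u w) + dd a \<nu> w \<bullet> dd y \<sigma> (u w) = 0"
proof -
  have "((\<lambda>w. \<nu> w \<bullet> dd y \<sigma> (u w)) has_derivative
    (\<lambda>a. \<nu> w \<bullet> dd (dd a u w) (dd y \<sigma>) (u w) + dd a \<nu> w \<bullet> dd y \<sigma> (u w))) (at w)"
    by (intro has_derivative_inner d\<nu>[OF w] has_derivative_dd_chain[OF du[OF w] diff1[OF u_in[OF w]]])
  then have "((\<lambda>w. 0) has_derivative
    (\<lambda>a. \<nu> w \<bullet> dd (dd a u w) (dd y \<sigma>) (u w) + dd a \<nu> w \<bullet> dd y \<sigma> (u w))) (at w)"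
    by (rule has_derivative_transform_within_open[OF _ open_W w]) (rule \<nu>_normal)
  from dd_eqI[OF this, of a] show ?thesis by (simp add: dd_def)
qed

text \<open>The direction \<open>y\<close> is a constant coordinate vector, so it contributes no
  derivative; it is specialised to \<open>dd c u w\<close> only afterwards.\<close>

lemma weingarten_derivative:
  assumes w: "w \<in> W"
  shows "\<nu> w \<bullet> (dd (dd b u w) (dd (dd a u w) (dd y \<sigma>)) (u w) + dd (dd b (dd a u) w) (dd y \<sigma>) (u w))
    + dd b \<nu> w \<bullet> dd (dd a u w) (dd y \<sigma>) (u w)
    + (dd a \<nu> w \<bullet> dd (dd b u w) (dd y \<sigma>) (u w) + dd b (dd a \<nu>) w \<bullet> dd y \<sigma> (u w)) = 0"
proof -
  let ?D = "\<lambda>b. \<nu> w \<bullet> (dd (dd b u w) (dd (dd a u w) (dd y \<sigma>)) (u w) + dd (dd b (dd a u) w) (dd y \<sigma>) (u w))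
    + dd b \<nu> w \<bullet> dd (dd a u w) (dd y \<sigma>) (u w)
    + (dd a \<nu> w \<bullet> dd (dd b u w) (dd y \<sigma>) (u w) + dd b (dd a \<nu>) w \<bullet> dd y \<sigma> (u w))"
  have "((\<lambda>w. \<nu> w \<bullet> dd (dd a u w) (dd y \<sigma>) (u w) + dd a \<nu> w \<bullet> dd y \<sigma> (u w)) has_derivative ?D) (at w)"
    by (intro has_derivative_add has_derivative_inner d\<nu>[OF w] dd\<nu>[OF w]
      has_derivative_dd_chain[OF du[OF w] diff1[OF u_in[OF w]]]
      has_derivative_dd_compose[OF open_U smooth_on_dd[OF smooth] u_in[OF w] du[OF w] ddu[OF w] open_W w u_in])
  then have "((\<lambda>w. 0) has_derivative ?D) (at w)"
    by (rule has_derivative_transform_within_open[OF _ open_W w]) (rule weingarten)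
  from dd_eqI[OF this, of b] show ?thesis by (simp add: dd_def)
qed

lemma d\<nu>_foot:
  assumes w: "w \<in> W"
  shows "dd a \<nu> w \<bullet> \<sigma> (u w) = 0"
proof -
  have "((\<lambda>w. \<nu> w \<bullet> \<sigma> (u w)) has_derivative
    (\<lambda>a. \<nu> w \<bullet> dd (dd a u w) \<sigma> (u w) + dd a \<nu> w \<bullet> \<sigma> (u w))) (at w)"
    by (intro has_derivative_inner d\<nu>[OF w] has_derivative_dd_chain[OF du[OF w] diff0[OF u_in[OF w]]])
  then have "((\<lambda>w. 0) has_derivative
    (\<lambda>a. \<nu> w \<bullet> dd (dd a u w) \<sigma> (u w) + dd a \<nu> w \<bullet> \<sigma> (u w))) (at w)"
    by (rule has_derivative_transform_within_open[OF _ open_W w]) (rule \<nu>_foot)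
  from dd_eqI[OF this, of a] show ?thesis by (simp add: dd_def \<nu>_normal[OF w, unfolded dd_def])
qed

lemma d\<nu>_\<nu>:
  assumes w: "w \<in> W"
  shows "dd a \<nu> w \<bullet> \<nu> w = 0"
proof -
  have "((\<lambda>w. \<nu> w \<bullet> \<nu> w) has_derivative (\<lambda>a. \<nu> w \<bullet> dd a \<nu> w + dd a \<nu> w \<bullet> \<nu> w)) (at w)"
    by (intro has_derivative_inner d\<nu>[OF w])
  then have "((\<lambda>w. 1) has_derivative (\<lambda>a. \<nu> w \<bullet> dd a \<nu> w + dd a \<nu> w \<bullet> \<nu> w)) (at w)"
    by (rule has_derivative_transform_within_open[OF _ open_W w]) (rule \<nu>_unit)
  from dd_eqI[OF this, of a] show ?thesis by (simp add: dd_def inner_commute)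
qed

text \<open>The foot point, the normal vector and the vertical frame already span a complement of the
  right dimension to the tangent space of the immersion.\<close>

lemma range_if_orthogonal:
  assumes w: "w \<in> W" and dims: "m = CARD('m)" "CARD('n) = n + 1" "m \<le> n - 1" "n \<ge> 1"
    and vert: "\<And>i. i \<in> {m+1..n-1} \<Longrightarrow> dd (e i) u w = 0"
    and ortho: "\<And>i j. i \<in> {m+1..n-1} \<Longrightarrow> j \<in> {m+1..n-1} \<Longrightarrow>
      dd (e i) \<nu> w \<bullet> dd (e j) \<nu> w = (if i = j then 1 else 0)"
    and z: "z \<bullet> \<sigma> (u w) = 0" "z \<bullet> \<nu> w = 0" "\<And>i. i \<in> {m+1..n-1} \<Longrightarrow> z \<bullet> dd (e i) \<nu> w = 0"
  shows "z \<in> range (\<lambda>y. dd y \<sigma> (u w))"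
proof -
  note q = u_in[OF w]
  let ?R = "range (\<lambda>y. dd y \<sigma> (u w))"
  \<comment> \<open>The vertical indices end at \<open>n - 1\<close>, so \<open>n\<close> and
    \<open>n + 1\<close> are free for the foot point and the normal. The family has
    \<open>n + 1 - m\<close> members in dimension \<open>n + 1\<close>, and its complement has
    dimension \<open>m\<close>, like the range of the immersion's differential.\<close>
  define s where "s i = (if i = n then \<sigma> (u w) else if i = n + 1 then \<nu> w else dd (e i) \<nu> w)" for i
  let ?I = "{m+1..n+1}"
  have I: "i \<in> ?I \<longleftrightarrow> i = n \<or> i = n + 1 \<or> i \<in> {m+1..n-1}" for i using dims by auto
  have \<sigma>1: "\<sigma> (u w) \<bullet> \<sigma> (u w) = 1" using sphere[OF q] by (simp add: norm_eq_1)
  have s: "s i \<bullet> s j = (if i = j then 1 else 0)" if "i \<in> ?I" "j \<in> ?I" for i j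
    using that unfolding I s_def
    using \<sigma>1 \<nu>_unit[OF w] \<nu>_foot[OF w] d\<nu>_foot[OF w] d\<nu>_\<nu>[OF w] ortho
    by (auto simp: inner_commute)
  note ind = orthonormal_independent[of ?I "\<lambda>a b. a \<bullet> b" s, OF _ _ s]
  have indep: "independent (s ` ?I)" and inj_s: "inj_on s ?I"
    using ind by (auto intro: bounded_linear.linear[OF bounded_linear_inner_left])
  have "dim (span (s ` ?I)) = card (s ` ?I)"
    by (simp only: dim_span dim_eq_card_independent[OF indep])
  also have "\<dots> = n + 1 - m" using card_image[OF inj_s] by simp
  finally have dS: "dim (span (s ` ?I)) = n + 1 - m" .
  let ?C = "{y \<in> UNIV. \<forall>x\<in>span (s ` ?I). orthogonal x y}"
  have "dim ?C + dim (span (s ` ?I)) = dim (UNIV :: 'n rvec set)"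
    by (rule dim_subspace_orthogonal_to_vectors) auto
  then have dC: "dim ?C = m" using dS dims by simp
  have inC: "y \<in> ?C" if "\<And>i. i \<in> ?I \<Longrightarrow> s i \<bullet> y = 0" for y
  proof -
    have "orthogonal y x" if "x \<in> span (s ` ?I)" for x
      by (rule orthogonal_to_span[OF that]) (use \<open>\<And>i. i \<in> ?I \<Longrightarrow> s i \<bullet> y = 0\<close> in \<open>auto simp: orthogonal_def inner_commute\<close>)
    then show ?thesis by (simp add: orthogonal_commute)
  qed
  have "?R \<subseteq> ?C"
  proof
    fix y assume "y \<in> ?R"
    then obtain a where y: "y = dd a \<sigma> (u w)" by blast
    \<comment> \<open>Along vertical vectors the base point is fixed, so \<open>weingarten\<close>
      loses its second-derivative term.\<close>
    have "dd (e i) \<nu> w \<bullet> dd a \<sigma> (u w) = 0" if "i \<in> {m+1..n-1}" for i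
      using weingarten[OF w, of "e i" a] unfolding vert[OF that] linear_0[OF lin2[OF q]] by simp
    then have "s i \<bullet> y = 0" if "i \<in> ?I" for i
      using that tangent[OF q, of a] \<nu>_normal[OF w, of a] unfolding I s_def y by (auto simp: inner_commute)
    then show "y \<in> ?C" by (rule inC)
  qed
  moreover have "dim ?R = m"
    using dim_image_eq[OF lin[OF q], of UNIV] inj[OF q] dims(1) by simp
  moreover have "subspace ?R" by (rule linear_subspace_image[OF lin[OF q] subspace_UNIV])
  moreover have "subspace ?C" by (auto simp: subspace_def orthogonal_clauses)
  ultimately have "?R = ?C" using dC by (intro subspace_dim_equal) auto
  moreover have "z \<in> ?C"
    by (rule inC) (use z in \<open>auto simp: I s_def inner_commute\<close>)
  ultimately show ?thesis by blast
qed

lemma D2_commute: "q \<in> U \<Longrightarrow> dd a (dd b \<sigma>) q = dd b (dd a \<sigma>) q"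
  by (rule smooth_dd_commute[OF open_U smooth])

lemma D3_commute_left: "q \<in> U \<Longrightarrow> dd a (dd b (dd c \<sigma>)) q = dd b (dd a (dd c \<sigma>)) q"
  by (rule smooth_dd_commute[OF open_U smooth_on_dd[OF smooth]])

lemma D3_commute_right: "q \<in> U \<Longrightarrow> dd a (dd b (dd c \<sigma>)) q = dd a (dd c (dd b \<sigma>)) q"
  by (rule dd_cong_open[OF open_U]) (auto intro: D2_commute)

text \<open>As for any Legendrian immersion, the left-hand side is totally symmetric in \<open>a\<close>, \<open>b\<close>, \<open>c\<close>; the
  right-hand side makes this visible.\<close>

lemma cubic_form:
  assumes w: "w \<in> W"
  shows "snd (dd a (dd b \<mu>) w) \<bullet> fst (dd c \<mu> w) - fst (dd a (dd b \<mu>) w) \<bullet> snd (dd c \<mu> w)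
    = - (\<nu> w \<bullet> dd (dd a u w) (dd (dd b u w) (dd (dd c u w) \<sigma>)) (u w)
       + dd (dd a u w) (dd (dd b u w) \<sigma>) (u w) \<bullet> dd c \<nu> w
       + dd (dd b u w) (dd (dd c u w) \<sigma>) (u w) \<bullet> dd a \<nu> w
       + dd (dd a u w) (dd (dd c u w) \<sigma>) (u w) \<bullet> dd b \<nu> w)"
proof -
  let ?h = "dd a (dd b u) w"
  \<comment> \<open>The second derivatives of \<open>u\<close> occur in
    \<open>D\<^sub>a D\<^sub>b F\<close> and in the twice differentiated normality condition;
    \<open>weingarten\<close> along \<open>c\<close>, tested on \<open>?h\<close>, makes the two
    occurrences cancel.\<close>
  have "\<nu> w \<bullet> dd ?h (dd (dd c u w) \<sigma>) (u w) + dd ?h \<sigma> (u w) \<bullet> dd c \<nu> w = 0"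
    using weingarten[OF w, of c ?h] D2_commute[OF u_in[OF w], of "dd c u w" ?h] by (simp add: inner_commute)
  with weingarten_derivative[OF w, of a b "dd c u w"] show ?thesis
    by (simp add: dd_\<mu>[OF w] dd_dd_\<mu>[OF w] inner_simps inner_commute)
qed

lemma vertical_iff: "w \<in> W \<Longrightarrow> fst (dd a \<mu> w) = 0 \<longleftrightarrow> dd a u w = 0"
  using linear_injective_0[OF lin[OF u_in], of w] inj[OF u_in, of w] linear_0[OF lin[OF u_in], of w]
  by (auto simp: dd_\<mu>)

text \<open>With two arguments vertical, the outermost direction of each of the four terms of
  \<open>cubic_form\<close> is zero.\<close>

lemma cubic_form_vertical_left:
  assumes w: "w \<in> W" and a: "dd a u w = 0"
  shows "snd (dd a (dd a \<mu>) w) \<bullet> fst (dd c \<mu> w) - fst (dd a (dd a \<mu>) w) \<bullet> snd (dd c \<mu> w) = 0"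
proof -
  note l1 = linear_0[OF dd_linear[OF smooth_on_differentiable[OF smooth_on_dd[OF smooth_on_dd[OF smooth]] u_in[OF w]]]]
  show ?thesis unfolding cubic_form[OF w] a l1 linear_0[OF lin2[OF u_in[OF w]]] by simp
qed

text \<open>Only the term with \<open>dd c \<nu> w\<close> survives. By \<open>weingarten\<close>
  and \<open>d\<nu>_foot\<close> that vector is normal to the immersion inside the sphere, so it
  sees just the second fundamental form.\<close>

lemma cubic_form_vertical_right:
  assumes w: "w \<in> W" and c: "dd c u w = 0"
  shows "snd (dd a (dd a \<mu>) w) \<bullet> fst (dd c \<mu> w) - fst (dd a (dd a \<mu>) w) \<bullet> snd (dd c \<mu> w)
    = - (second_ff (sphere 0 1) g_metric U \<sigma> (u w) (dd a u w) (dd a u w) \<bullet> dd c \<nu> w)"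
proof -
  let ?q = "u w" and ?a = "dd a u w"
  note q = u_in[OF w]
  have D2: "dd ?a (dd 0 \<sigma>) ?q = 0" by (rule linear_0[OF lin2'[OF q]])
  have "dd ?a (dd ?a (dd 0 \<sigma>)) ?q = 0"
    using D3_commute_right[OF q, of ?a ?a 0] D3_commute_left[OF q, of ?a 0 ?a]
      linear_0[OF dd_linear[OF smooth_on_differentiable[OF smooth_on_dd[OF smooth_on_dd[OF smooth]] q]]] by metis
  moreover have "second_ff (sphere 0 1) g_metric U \<sigma> ?q ?a ?a \<bullet> dd c \<nu> w = dd ?a (dd ?a \<sigma>) ?q \<bullet> dd c \<nu> w"
  proof (rule second_ff_inner[OF q])
    show "dd y \<sigma> ?q \<bullet> dd c \<nu> w = 0" for y
      using weingarten[OF w, of c y] unfolding c linear_0[OF lin2[OF q]] by (simp add: inner_commute)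
    show "\<sigma> ?q \<bullet> dd c \<nu> w = 0" using d\<nu>_foot[OF w, of c] by (simp add: inner_commute)
  qed
  ultimately show ?thesis unfolding cubic_form[OF w] c by (simp add: D2)
qed

text \<open>A tangential \<open>dd e \<nu> w\<close> pairs only with the tangential part of a second
  derivative, and \<open>weingarten\<close> moves this pairing onto \<open>\<nu> w\<close>. The
  outcome is the formula of \<open>nabla_II_inner\<close>, up to the symmetry of derivatives of
  \<open>\<sigma>\<close>.\<close>

lemma cubic_form_horizontal:
  assumes w: "w \<in> W" and a: "dd a \<nu> w \<in> range (\<lambda>y. dd y \<sigma> (u w))" and c: "dd c \<nu> w \<in> range (\<lambda>y. dd y \<sigma> (u w))"
    and X: "X (u w) = dd c u w" and Y: "smooth_on U Y" "Y (u w) = dd a u w"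
  shows "snd (dd a (dd a \<mu>) w) \<bullet> fst (dd c \<mu> w) - fst (dd a (dd a \<mu>) w) \<bullet> snd (dd c \<mu> w)
    = - (nabla_II (sphere 0 1) g_metric U \<sigma> X Y Y (u w) \<bullet> \<nu> w)"
proof -
  let ?q = "u w" and ?a = "dd a u w" and ?c = "dd c u w"
  note q = u_in[OF w]
  have shape: "z \<bullet> dd e \<nu> w = - (dd (dd e u w) (dd (tc ?q z) \<sigma>) ?q \<bullet> \<nu> w)"
    if "dd e \<nu> w \<in> range (\<lambda>y. dd y \<sigma> ?q)" for e z
  proof -
    obtain y where y: "dd e \<nu> w = dd y \<sigma> ?q" using \<open>dd e \<nu> w \<in> _\<close> by blast
    have "z \<bullet> dd e \<nu> w = dd (tc ?q z) \<sigma> ?q \<bullet> dd e \<nu> w" unfolding y by (rule tc_inner[OF q, symmetric])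
    with weingarten[OF w, of e "tc ?q z"] show ?thesis by (simp add: inner_commute)
  qed
  have n: "\<sigma> ?q \<bullet> \<nu> w = 0" "dd e \<sigma> ?q \<bullet> \<nu> w = 0" for e
    using \<nu>_foot[OF w] \<nu>_normal[OF w] by (simp_all add: inner_commute)
  have D3: "dd ?a (dd ?a (dd ?c \<sigma>)) ?q = dd ?c (dd ?a (dd ?a \<sigma>)) ?q"
    using D3_commute_right[OF q, of ?a ?a ?c] D3_commute_left[OF q, of ?a ?c ?a] by simp
  show ?thesis
    unfolding cubic_form[OF w] shape[OF a] shape[OF c] nabla_II_inner[OF q n Y(1) Y(1)] X Y(2) D3
      D2_commute[OF q, of ?a ?c] D2_commute[OF q, of "tc ?q (dd ?c (dd ?a \<sigma>) ?q)" ?a] inner_diff_left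
    by (simp add: inner_commute[of "\<nu> w"])
qed

end

section \<open>Passing from the manifold to charts\<close>

lemma normal_bundle_paramD:
  assumes "normal_bundle_param M A f W \<psi>"
  shows "open W" "continuous_on W \<psi>" "\<And>w. w \<in> W \<Longrightarrow> \<psi> w \<in> unit_normal_bundle M A f"
    "smooth_on W (snd \<circ> \<psi>)"
proof -
  have lp: "local_param (unit_normal_bundle M A f) W \<psi>" and sm: "smooth_on W (snd \<circ> \<psi>)"
    using assms unfolding normal_bundle_param_def by auto
  show "open W" "continuous_on W \<psi>"
    using lp unfolding local_param_def homeomorphism_def by auto
  show "smooth_on W (snd \<circ> \<psi>)" by (rule sm)
  show "\<psi> w \<in> unit_normal_bundle M A f" if "w \<in> W" for w
    using lp openin_imp_subset that unfolding local_param_def by blast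
qed

lemma chart_domain_open:
  assumes atlas: "smooth_atlas M A" and nb: "normal_bundle_param M A f W \<psi>" and V: "(V, y) \<in> A"
  shows "open {w \<in> W. fst (\<psi> w) \<in> y ` V}"
proof -
  note nb' = normal_bundle_paramD[OF nb]
  have "openin (top_of_set M) (y ` V)"
    using atlas V unfolding smooth_atlas_def local_param_def by blast
  then obtain T where T: "open T" "y ` V = M \<inter> T" unfolding openin_open by blast
  have "fst (\<psi> w) \<in> M" if "w \<in> W" for w
    using nb'(3)[OF that] unfolding unit_normal_bundle_def by auto
  then have eq: "{w \<in> W. fst (\<psi> w) \<in> y ` V} = W \<inter> (\<lambda>w. fst (\<psi> w)) -` T" unfolding T(2) by auto
  show ?thesis
    unfolding eq by (intro continuous_open_preimage continuous_on_fst nb' T)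
qed

lemma normal_bundle_gauss_chart:
  fixes f :: "'a::topological_space \<Rightarrow> 'n::{finite,linorder} rvec"
  assumes atlas: "smooth_atlas M A" and imm: "smooth_immersion A f" and sph: "f ` M \<subseteq> sphere 0 1"
    and nb: "normal_bundle_param M A f W \<psi>" and V: "(V, y) \<in> A"
  shows "gauss_chart V (f \<circ> y) {w \<in> W. fst (\<psi> w) \<in> y ` V} (\<lambda>w. inv_into V y (fst (\<psi> w))) (snd \<circ> \<psi>)"
proof
  let ?W = "{w \<in> W. fst (\<psi> w) \<in> y ` V}" and ?u = "\<lambda>w. inv_into V y (fst (\<psi> w))"
  note nb' = normal_bundle_paramD[OF nb]
  have VM: "y ` V \<subseteq> M" using atlas V unfolding smooth_atlas_def by blast
  show "open V" using atlas V unfolding smooth_atlas_def local_param_def by blast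
  show "smooth_on V (f \<circ> y)" using imm V unfolding smooth_immersion_def by blast
  show "inj (\<lambda>a. dd a (f \<circ> y) u)" if "u \<in> V" for u
    using imm V that unfolding smooth_immersion_def dd_def by blast
  show "(f \<circ> y) u \<in> sphere 0 1" if "u \<in> V" for u
    unfolding o_def using VM sph that by blast
  show "open ?W" by (rule chart_domain_open[OF atlas nb V])
  show "smooth_on ?W ?u" using nb V unfolding normal_bundle_param_def by blast
  show "smooth_on ?W (snd \<circ> \<psi>)" by (rule smooth_on_subset[OF nb'(4)]) blast
  fix w assume w: "w \<in> ?W"
  then have "\<psi> w \<in> unit_normal_bundle M A f" using nb'(3) by blast
  then have N: "norm (snd (\<psi> w)) = 1" "snd (\<psi> w) \<bullet> f (fst (\<psi> w)) = 0"
    "\<And>u a. u \<in> V \<Longrightarrow> y u = fst (\<psi> w) \<Longrightarrow> snd (\<psi> w) \<bullet> frechet_derivative (f \<circ> y) (at u) a = 0"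
    using V unfolding unit_normal_bundle_def g_metric_def by (auto simp: case_prod_beta)
  show uV: "?u w \<in> V" using w by (auto intro: inv_into_into)
  have yu: "y (?u w) = fst (\<psi> w)" using w by (auto intro: f_inv_into_f)
  show "(snd \<circ> \<psi>) w \<bullet> (snd \<circ> \<psi>) w = 1" using N(1) by (simp add: norm_eq_1)
  show "(snd \<circ> \<psi>) w \<bullet> (f \<circ> y) (?u w) = 0" using N(2) yu by simp
  show "(snd \<circ> \<psi>) w \<bullet> dd a (f \<circ> y) (?u w) = 0" for a using N(3)[OF uV yu] by (simp add: dd_def)
qed

lemma gauss_map_chart:
  assumes "w \<in> {w \<in> W. fst (\<psi> w) \<in> y ` V}"
  shows "((f \<circ> y) (inv_into V y (fst (\<psi> w))), (snd \<circ> \<psi>) w) = (gauss_map f \<circ> \<psi>) w"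
  using assms by (auto simp: gauss_map_def f_inv_into_f)

text \<open>Each condition is local, so every point of \<open>W\<close> may be treated in a chart
  around its own foot point.\<close>

lemma gauss_map_legendrian:
  fixes f :: "'a::topological_space \<Rightarrow> 'n::{finite,linorder} rvec" and \<psi> :: "real ^ 'b::finite \<Rightarrow> 'a \<times> 'n rvec"
  assumes atlas: "smooth_atlas M A" and imm: "smooth_immersion A f" and sph: "f ` M \<subseteq> sphere 0 1"
    and nb: "normal_bundle_param M A f W \<psi>" and w0: "w\<^sub>0 \<in> W" and card: "CARD('n) \<ge> 3"
  shows "legendrian W (gauss_map f \<circ> \<psi>) w\<^sub>0"
proof
  let ?\<mu> = "gauss_map f \<circ> \<psi>"
  note nb' = normal_bundle_paramD[OF nb]
  have charts: "\<exists>V y. (V, y) \<in> A \<and> w \<in> {w \<in> W. fst (\<psi> w) \<in> y ` V}" if "w \<in> W" for w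
  proof -
    have "fst (\<psi> w) \<in> (\<Union>(U, x)\<in>A. x ` U)"
      using nb'(3)[OF that] atlas unfolding unit_normal_bundle_def smooth_atlas_def by auto
    with that show ?thesis by auto
  qed
  have local: "?\<mu> differentiable (at w) \<and> dd a ?\<mu> differentiable (at w) \<and> ?\<mu> w \<in> unit_tangent_bundle
    \<and> fst (dd a ?\<mu> w) \<bullet> snd (?\<mu> w) = 0" if wW: "w \<in> W" for w a
  proof -
    obtain V y where V: "(V, y) \<in> A" and w: "w \<in> {w \<in> W. fst (\<psi> w) \<in> y ` V}"
      using charts[OF wW] by blast
    let ?W = "{w \<in> W. fst (\<psi> w) \<in> y ` V}"
    interpret G: gauss_chart V "f \<circ> y" ?W "\<lambda>w. inv_into V y (fst (\<psi> w))" "snd \<circ> \<psi>"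
      by (rule normal_bundle_gauss_chart[OF atlas imm sph nb V])
    have eq: "G.\<mu> w = ?\<mu> w" if "w \<in> ?W" for w
      unfolding G.\<mu>_def by (rule gauss_map_chart[OF that])
    have deq: "dd a G.\<mu> w = dd a ?\<mu> w" if "w \<in> ?W" for w
      by (rule dd_cong_open[OF G.open_W that eq])
    have "?\<mu> differentiable (at w)"
      by (rule differentiable_cong_open[OF G.open_W w eq])
        (use G.\<mu>_derivative[OF w] in \<open>auto simp: differentiable_def\<close>)
    moreover have "dd a ?\<mu> differentiable (at w)"
      by (rule differentiable_cong_open[OF G.open_W w deq])
        (use G.dd_\<mu>_derivative[OF w] in \<open>auto simp: differentiable_def\<close>)
    moreover have "?\<mu> w \<in> unit_tangent_bundle"
      unfolding eq[OF w, symmetric] ut_iff G.\<mu>_def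
      using G.sphere[OF G.u_in[OF w]] G.\<nu>_unit[OF w] G.\<nu>_foot[OF w] by (simp add: norm_eq_1 inner_commute)
    moreover have "fst (dd a ?\<mu> w) \<bullet> snd (?\<mu> w) = 0"
      unfolding eq[OF w, symmetric] deq[OF w, symmetric] G.dd_\<mu>[OF w] G.\<mu>_def
      using G.\<nu>_normal[OF w] by (simp add: inner_commute)
    ultimately show ?thesis by blast
  qed
  show "CARD('n) \<ge> 3" "open W" "w\<^sub>0 \<in> W" by (fact card nb'(1) w0)+
  show "?\<mu> differentiable (at w)" if "w \<in> W" for w using local[OF that] by blast
  show "dd a ?\<mu> differentiable (at w\<^sub>0)" for a using local[OF w0] by blast
  show "?\<mu> w \<in> unit_tangent_bundle" if "w \<in> W" for w using local[OF that] by blast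
  show "fst (dd a ?\<mu> w) \<bullet> snd (?\<mu> w) = 0" if "w \<in> W" for w a using local[OF that] by blast
qed

theorem proposition3p9:
  fixes M :: "'a::{t2_space,second_countable_topology} set"
    and A :: "('a, 'm::finite) atlas"
    and f :: "'a \<Rightarrow> 'n::{finite,linorder} rvec"
    and \<psi> :: "real ^ 'b::finite \<Rightarrow> 'a \<times> 'n rvec"
    and E :: "nat \<Rightarrow> real ^ 'b \<Rightarrow> 'n rvec \<times> 'n rvec"
    and x :: "real ^ 'm \<Rightarrow> 'a"
    and X :: "nat \<Rightarrow> real ^ 'm \<Rightarrow> real ^ 'm"
    and m n :: nat
  assumes "m = CARD('m)" and "CARD('n) = n + 1" and "CARD('b) + 1 = n"
    \<comment> \<open>the oriented manifold and the immersion (with the induced metric) into the sphere\<close>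
    and "smooth_atlas M A" and "oriented_atlas A"
    and "smooth_immersion A f" and "f ` M \<subseteq> sphere 0 1"
    \<comment> \<open>the unit normal bundle near \<open>\<xi>\<close>, and the frames on this neighbourhood\<close>
    and "normal_bundle_param M A f W \<psi>" and "w\<^sub>0 \<in> W" and "\<psi> w\<^sub>0 = \<xi>"
    and "local_frame {1..m} f \<psi> W (horizontal_space f \<psi>) E"
    and "local_frame {m+1..n-1} f \<psi> W (vertical_space f \<psi>) E"
    \<comment> \<open>a chart of the manifold at the foot point of \<open>\<xi>\<close>, and vector fields on it
        extending the projections of the horizontal frame vectors\<close>
    and "(U, x) \<in> A" and "u\<^sub>0 \<in> U" and "x u\<^sub>0 = fst \<xi>"
    and "\<forall>i\<in>{1..m}. smooth_on U (X i) \<and>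
           frechet_derivative (f \<circ> x) (at u\<^sub>0) (X i u\<^sub>0) = fst (E i w\<^sub>0)"
  shows "(\<forall>i\<in>{1..m}.
           h_metric (gauss_map f \<xi>)
             (mean_curvature unit_tangent_bundle h_metric W (gauss_map f \<circ> \<psi>) w\<^sub>0)
             (J_end (gauss_map f \<xi>) (E i w\<^sub>0))
           = - g_metric (f (fst \<xi>))
                 (\<Sum>j=1..m. nabla_II (sphere 0 1) g_metric U (f \<circ> x) (X i) (X j) (X j) u\<^sub>0)
                 (snd \<xi>))
       \<and> (\<forall>\<beta>\<in>{m+1..n-1}.
           h_metric (gauss_map f \<xi>)
             (mean_curvature unit_tangent_bundle h_metric W (gauss_map f \<circ> \<psi>) w\<^sub>0)
             (J_end (gauss_map f \<xi>) (E \<beta> w\<^sub>0))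
           = g_metric (f (fst \<xi>))
                 (\<Sum>j=1..m. second_ff (sphere 0 1) g_metric U (f \<circ> x) u\<^sub>0 (X j u\<^sub>0) (X j u\<^sub>0))
                 (fst (J_end (gauss_map f \<xi>) (E \<beta> w\<^sub>0))))"
proof -
  note atlas = assms(4) and imm = assms(6) and sph = assms(7) and nb = assms(8) and w0 = assms(9)
    and \<xi> = assms(10) and hframe = assms(11) and vframe = assms(12) and chart = assms(13)
    and u0 = assms(14,15) and X = assms(16)
  let ?\<mu> = "gauss_map f \<circ> \<psi>" and ?\<sigma> = "f \<circ> x" and ?\<nu> = "snd \<circ> \<psi>"
  let ?W = "{w \<in> W. fst (\<psi> w) \<in> x ` U}" and ?u = "\<lambda>w. inv_into U x (fst (\<psi> w))"
  let ?D = "\<lambda>a. dd a ?\<mu> w\<^sub>0" and ?q = "?\<mu> w\<^sub>0"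
  \<comment> \<open>The index type \<open>'b\<close> is nonempty, so \<open>n\<close> is at least
    2.\<close>
  have card: "CARD('n) \<ge> 3" using assms(2,3) zero_less_card_finite[where 'a='b] by linarith
  have "fst (\<psi> w\<^sub>0) = x u\<^sub>0" using u0 \<xi> by simp
  then have w: "w\<^sub>0 \<in> ?W" using w0 u0 by blast
  interpret L: legendrian W ?\<mu> w\<^sub>0
    by (rule gauss_map_legendrian[OF atlas imm sph nb w0 card])
  interpret G: gauss_chart U ?\<sigma> ?W ?u ?\<nu>
    by (rule normal_bundle_gauss_chart[OF atlas imm sph nb chart])
  have q: "gauss_map f \<xi> = ?q" using \<xi> by simp
  have uw: "?u w\<^sub>0 = u\<^sub>0"
  proof -
    have "local_param M U x" using atlas chart unfolding smooth_atlas_def by blast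
    then have "inj_on x U" unfolding local_param_def homeomorphism_def by (metis inj_on_inverseI)
    then show ?thesis using u0 \<xi> by (metis inv_into_f_f)
  qed
  have \<mu>G: "G.\<mu> w = ?\<mu> w" if "w \<in> ?W" for w
    unfolding G.\<mu>_def by (rule gauss_map_chart[OF that])
  have dG: "dd a G.\<mu> w = dd a ?\<mu> w" if "w \<in> ?W" for w a
    by (rule dd_cong_open[OF G.open_W that \<mu>G])
  have ddG: "dd a (dd b G.\<mu>) w\<^sub>0 = dd a (dd b ?\<mu>) w\<^sub>0" for a b
    by (rule dd_cong_open[OF G.open_W w dG])
  have D: "?D a = (dd (dd a ?u w\<^sub>0) ?\<sigma> u\<^sub>0, dd a ?\<nu> w\<^sub>0)" for a
    using G.dd_\<mu>[OF w, of a] unfolding dG[OF w] uw .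
  have range: "range (frechet_derivative ?\<mu> (at w\<^sub>0)) = range ?D"
    by (simp add: dd_def)
  have foot: "frechet_derivative (f \<circ> fst \<circ> \<psi>) (at w\<^sub>0) a = fst (?D a)" for a
  proof -
    have "((\<lambda>w. fst (?\<mu> w)) has_derivative (\<lambda>a. fst (?D a))) (at w\<^sub>0)"
      by (intro has_derivative_fst dd_has_derivative L.diff w0)
    moreover have "(\<lambda>w. fst (?\<mu> w)) = f \<circ> fst \<circ> \<psi>" by (auto simp: gauss_map_def)
    ultimately show ?thesis using dd_eqI[of "f \<circ> fst \<circ> \<psi>"] unfolding dd_def by metis
  qed
  have vert: "vertical_space f \<psi> w\<^sub>0 = {?D a | a. fst (?D a) = 0}"
    unfolding vertical_space_def foot by (auto simp: dd_def)
  have "\<exists>a. E i w\<^sub>0 = ?D a \<and> (i \<in> {m+1..n-1} \<longrightarrow> fst (?D a) = 0)" if "i \<in> {1..m} \<union> {m+1..n-1}" for i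
  proof (cases "i \<in> {1..m}")
    case True
    then have "E i w\<^sub>0 \<in> range ?D"
      using hframe w0 range unfolding local_frame_def horizontal_space_def by blast
    with True show ?thesis by auto
  next
    case False
    then have "E i w\<^sub>0 \<in> vertical_space f \<psi> w\<^sub>0"
      using vframe w0 that unfolding local_frame_def by blast
    then show ?thesis unfolding vert by blast
  qed
  then obtain e where e: "\<And>i. i \<in> {1..m} \<union> {m+1..n-1} \<Longrightarrow> E i w\<^sub>0 = ?D (e i)"
    and e_vert: "\<And>i. i \<in> {m+1..n-1} \<Longrightarrow> fst (?D (e i)) = 0"
    by (metis UnI2)
  have h: "h_metric ?q (?D a) (?D b) = sasaki ?q (?D a) (?D b)" for a b
    by (rule h_metric_eq[OF card L.ut[OF w0] L.D_tangent L.D_tangent])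
  have orth: "sasaki ?q (?D (e i)) (?D (e j)) = (if i = j then 1 else 0)"
    if "i \<in> {1..m} \<and> j \<in> {1..m} \<or> i \<in> {m+1..n-1} \<and> j \<in> {m+1..n-1}" for i j
  proof -
    have "h_metric ?q (E i w\<^sub>0) (E j w\<^sub>0) = (if i = j then 1 else 0)"
      using hframe vframe w0 that unfolding local_frame_def by auto
    moreover have "E i w\<^sub>0 = ?D (e i)" "E j w\<^sub>0 = ?D (e j)" using e that by blast+
    ultimately show ?thesis by (simp only: h)
  qed
  have cross: "sasaki ?q (?D (e i)) (?D (e j)) = 0" if "i \<in> {1..m}" "j \<in> {m+1..n-1}" for i j
  proof -
    have "E i w\<^sub>0 \<in> horizontal_space f \<psi> w\<^sub>0" "E j w\<^sub>0 \<in> vertical_space f \<psi> w\<^sub>0"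
      using hframe vframe w0 that unfolding local_frame_def by blast+
    then have "h_metric ?q (E i w\<^sub>0) (E j w\<^sub>0) = 0" unfolding horizontal_space_def by auto
    moreover have "E i w\<^sub>0 = ?D (e i)" "E j w\<^sub>0 = ?D (e j)" using e that by blast+
    ultimately show ?thesis by (simp only: h)
  qed
  \<comment> \<open>There are \<open>m\<close> orthonormal vectors in dimension
    \<open>n - 1\<close>. For a hypersurface \<open>m = n - 1\<close> and the vertical index set is
    empty.\<close>
  have mn: "m \<le> n - 1"
  proof -
    note oi = orthonormal_independent[of "{1..m}" "\<lambda>a b. sasaki ?q (?D a) (?D b)" e]
    have "independent (e ` {1..m})" "inj_on e {1..m}"
      using oi orth L.pullback_linear by auto
    then have "m \<le> DIM(real^'b)" using independent_bound[of "e ` {1..m}"] card_image[of e "{1..m}"] by auto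
    then show ?thesis using assms(3) by simp
  qed
  have split: "{1..CARD('b)} = {1..m} \<union> {m+1..n-1}" using mn assms(3) by auto
  have frame: "sasaki ?q (?D (e i)) (?D (e j)) = (if i = j then 1 else 0)"
    if ij: "i \<in> {1..CARD('b)}" "j \<in> {1..CARD('b)}" for i j
  proof -
    consider "i \<in> {1..m} \<and> j \<in> {1..m} \<or> i \<in> {m+1..n-1} \<and> j \<in> {m+1..n-1}"
      | "i \<in> {1..m}" "j \<in> {m+1..n-1}" | "j \<in> {1..m}" "i \<in> {m+1..n-1}"
      using ij unfolding split by blast
    then show ?thesis
    proof cases
      case 1 then show ?thesis by (rule orth)
    next
      case 2 then show ?thesis using cross[OF 2] by auto
    next
      case 3 then show ?thesis using cross[OF 3] sasaki_commute[of ?q "?D (e i)"] by auto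
    qed
  qed
  have u_vert: "dd (e i) ?u w\<^sub>0 = 0" if "i \<in> {m+1..n-1}" for i
    using e_vert[OF that] G.vertical_iff[OF w, of "e i"] unfolding dG[OF w] by blast
  have \<nu>_orth: "dd (e i) ?\<nu> w\<^sub>0 \<bullet> dd (e j) ?\<nu> w\<^sub>0 = sasaki ?q (?D (e i)) (?D (e j))"
    if "j \<in> {m+1..n-1}" for i j
    using e_vert[OF that] by (simp add: sasaki_def) (simp add: D)
  \<comment> \<open>Against vertical vectors \<open>sasaki\<close> only sees the second components,
    so horizontality makes this vector orthogonal to the vertical frame; it is orthogonal to foot
    point and normal anyway.\<close>
  have hor: "dd (e i) ?\<nu> w\<^sub>0 \<in> range (\<lambda>y. dd y ?\<sigma> (?u w\<^sub>0))" if "i \<in> {1..m}" for i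
  proof (rule G.range_if_orthogonal[OF w, of m n e])
    show "n \<ge> 1" using assms(3) by simp
    show "dd (e i) ?\<nu> w\<^sub>0 \<bullet> dd (e j) ?\<nu> w\<^sub>0 = (if i = j then 1 else 0)"
      if "i \<in> {m+1..n-1}" "j \<in> {m+1..n-1}" for i j
      using orth that by (simp add: \<nu>_orth)
    show "dd (e i) ?\<nu> w\<^sub>0 \<bullet> dd (e j) ?\<nu> w\<^sub>0 = 0" if "j \<in> {m+1..n-1}" for j
      using cross \<open>i \<in> {1..m}\<close> that by (simp add: \<nu>_orth)
  qed (use assms(1,2) mn u_vert G.d\<nu>_foot[OF w] G.d\<nu>_\<nu>[OF w] in auto)
  have Xu: "X i u\<^sub>0 = dd (e i) ?u w\<^sub>0" if "i \<in> {1..m}" for i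
  proof -
    have "dd (X i u\<^sub>0) ?\<sigma> u\<^sub>0 = dd (dd (e i) ?u w\<^sub>0) ?\<sigma> u\<^sub>0"
      using X e[of i] that D[of "e i"] by (simp add: dd_def)
    then show ?thesis using G.inj[OF u0(1)] by (auto dest: injD)
  qed
  let ?C = "\<lambda>k c. snd (dd (e k) (dd (e k) ?\<mu>) w\<^sub>0) \<bullet> fst (?D c) - fst (dd (e k) (dd (e k) ?\<mu>) w\<^sub>0) \<bullet> snd (?D c)"
  have H: "h_metric ?q (mean_curvature unit_tangent_bundle h_metric W ?\<mu> w\<^sub>0) (J_end ?q (?D c)) = (\<Sum>k=1..m. ?C k c)" for c
  proof -
    have "h_metric ?q (mean_curvature unit_tangent_bundle h_metric W ?\<mu> w\<^sub>0) (J_end ?q (?D c)) = (\<Sum>k=1..CARD('b). ?C k c)"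
      by (rule L.mean_curvature_J[OF frame])
    \<comment> \<open>The trace runs over the whole tangent space of the normal bundle; its vertical
      half contributes nothing.\<close>
    also have "\<dots> = (\<Sum>k=1..m. ?C k c) + (\<Sum>k=m+1..n-1. ?C k c)"
      unfolding split by (rule sum.union_disjoint) auto
    also have "(\<Sum>k=m+1..n-1. ?C k c) = 0"
      using G.cubic_form_vertical_left[OF w u_vert, of _ c] unfolding ddG dG[OF w] by (intro sum.neutral ballI)
    finally show ?thesis by (simp only: add_0_right)
  qed
  show ?thesis
  proof (intro conjI ballI)
    fix i assume i: "i \<in> {1..m}"
    have "?C j (e i) = - (nabla_II (sphere 0 1) g_metric U ?\<sigma> (X i) (X j) (X j) u\<^sub>0 \<bullet> snd \<xi>)" if j: "j \<in> {1..m}" for j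
      using G.cubic_form_horizontal[OF w hor[OF j] hor[OF i], of "X i" "X j"] X j Xu[OF i] Xu[OF j] \<xi>
      unfolding ddG dG[OF w] uw by simp
    then have "(\<Sum>j=1..m. ?C j (e i)) = (\<Sum>j=1..m. - (nabla_II (sphere 0 1) g_metric U ?\<sigma> (X i) (X j) (X j) u\<^sub>0 \<bullet> snd \<xi>))"
      by (intro sum.cong refl)
    also have "\<dots> = - g_metric (f (fst \<xi>)) (\<Sum>j=1..m. nabla_II (sphere 0 1) g_metric U ?\<sigma> (X i) (X j) (X j) u\<^sub>0) (snd \<xi>)"
      by (simp only: g_metric_def inner_sum_left sum_negf)
    moreover have "E i w\<^sub>0 = ?D (e i)" using e i by blast
    ultimately show "h_metric (gauss_map f \<xi>) (mean_curvature unit_tangent_bundle h_metric W ?\<mu> w\<^sub>0) (J_end (gauss_map f \<xi>) (E i w\<^sub>0))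
      = - g_metric (f (fst \<xi>)) (\<Sum>j=1..m. nabla_II (sphere 0 1) g_metric U ?\<sigma> (X i) (X j) (X j) u\<^sub>0) (snd \<xi>)"
      by (simp only: q H)
  next
    fix \<beta> assume b: "\<beta> \<in> {m+1..n-1}"
    \<comment> \<open>This minus sign absorbs the one in \<open>cubic_form_vertical_right\<close>,
      hence the different signs in the two formulas.\<close>
    have J: "fst (J_end ?q (?D (e \<beta>))) = - dd (e \<beta>) ?\<nu> w\<^sub>0" by (simp only: L.J_D(1) fst_conv) (simp only: D snd_conv)
    have "?C j (e \<beta>) = second_ff (sphere 0 1) g_metric U ?\<sigma> u\<^sub>0 (X j u\<^sub>0) (X j u\<^sub>0) \<bullet> fst (J_end ?q (?D (e \<beta>)))"
      if j: "j \<in> {1..m}" for j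
      using G.cubic_form_vertical_right[OF w u_vert[OF b], of "e j"] Xu[OF j] unfolding ddG dG[OF w] uw J by simp
    then have "(\<Sum>j=1..m. ?C j (e \<beta>)) = (\<Sum>j=1..m. second_ff (sphere 0 1) g_metric U ?\<sigma> u\<^sub>0 (X j u\<^sub>0) (X j u\<^sub>0)
        \<bullet> fst (J_end ?q (?D (e \<beta>))))"
      by (intro sum.cong refl)
    also have "\<dots> = g_metric (f (fst \<xi>)) (\<Sum>j=1..m. second_ff (sphere 0 1) g_metric U ?\<sigma> u\<^sub>0 (X j u\<^sub>0) (X j u\<^sub>0))
        (fst (J_end ?q (?D (e \<beta>))))"
      by (simp only: g_metric_def inner_sum_left)
    moreover have "E \<beta> w\<^sub>0 = ?D (e \<beta>)" using e b by blast
    ultimately show "h_metric (gauss_map f \<xi>) (mean_curvature unit_tangent_bundle h_metric W ?\<mu> w\<^sub>0) (J_end (gauss_map f \<xi>) (E \<beta> w\<^sub>0))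
      = g_metric (f (fst \<xi>)) (\<Sum>j=1..m. second_ff (sphere 0 1) g_metric U ?\<sigma> u\<^sub>0 (X j u\<^sub>0) (X j u\<^sub>0))
          (fst (J_end (gauss_map f \<xi>) (E \<beta> w\<^sub>0)))"
      by (simp only: q H)
  qed
qed

end
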